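(* For $\Delta\in(0,1]$ let $E(\cdot,\Delta)$ be the analytic continuation to $\mathbb C\setminus\{1\}$ of $$E(s,\Delta)=\frac{1}{2^s}\zeta(s)+\frac{1}{2^{s+1}}\left[\zeta\!\left(s,\frac{1}{1+\Delta}\right)+\zeta\!\left(s,\frac{\Delta}{1+\Delta}\right)\right]\quad(\Re(s)>1).$$ Then, as $\varepsilon\to0^+$, the nontrivial off-critical zeros of $E(\cdot,1-\varepsilon)$ (i.e. its zeros other than those tending to zeros of the Riemann zeta function) are given by a family $\{\rho(k)=\rho_x(k)+{\rm i}\rho_y(k)\}_{k\in\mathbb Z}$ with $$\rho_x(k)=\frac{2}{\ln2}\ln\varepsilon+\left(-3+\frac{2}{\ln2}\ln\pi\right)+\frac{1}{\ln2}\varepsilon+\frac{1}{\ln2}\left(\frac14+\frac{7\pi^2}{24}\right)\varepsilon^2+\frac{1}{\ln2}\left(\frac1{12}+\frac{7\pi^2}{24}\right)\varepsilon^3+\frac{8}{3\ln2}\left(\frac{\pi^2}{8}\right)^{\frac{\ln3}{\ln2}}\cos\!\left[\frac{\ln3}{\ln2}(2k+1)\pi\right]\varepsilon^{2\frac{\ln3}{\ln2}}+o\!\left(\varepsilon^{2\frac{\ln3}{\ln2}}\right),$$ $$\rho_y(k)=\frac{1}{\ln2}(2k+1)\pi+\frac{8}{3\ln2}\left(\frac{\pi^2}{8}\right)^{\frac{\ln3}{\ln2}}\sin\!\left[\frac{\ln3}{\ln2}(2k+1)\pi\right]\varepsilon^{2\frac{\ln3}{\ln2}}+o\!\left(\varepsilon^{2\frac{\ln3}{\ln2}}\right).$$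 In particular: (1) $\lim_{\varepsilon\to0^+}\rho_x(k)=-\infty$ for each $k$; (2) at first order as $\varepsilon\to0^+$, the imaginary parts of these off-critical zeros are equidistributed on the lattice $\frac{(2\mathbb Z+1)\pi}{\ln2}$.
   Context: $\zeta(s)=\sum_{n\ge1}n^{-s}$ is the Riemann zeta function and $\zeta(s,a)=\sum_{n\ge0}(n+a)^{-s}$ is the Hurwitz zeta function, both analytically continued to $\mathbb C\setminus\{1\}$. A zero is called critical if its real part equals $\frac12$ and off-critical otherwise.
   Formalization: That all other zeros tend to zeta zeros is stated in each strip |Im s|≤T and for continuous zero branches without |Im s|→∞ (in Re s≤-a: no height bound), since for small ε there are further off-critical zeros at height about π/ε with large real part, outside the family. *)

theory Defs
  imports
    "HOL-Complex_Analysis.Complex_Analysis"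
    "HOL-Library.Landau_Symbols"
begin

text \<open>
  If \<open>U\<close> is open and connected and \<open>D \<subseteq> U\<close> is open and nonempty, any two candidates for the
  choice below agree on \<open>U\<close> by the identity theorem. The value outside \<open>U\<close> (below: at the
  pole \<open>1\<close>) is arbitrary and must not be relied upon.
\<close>

definition analytic_continuation ::
    "(complex \<Rightarrow> complex) \<Rightarrow> complex set \<Rightarrow> complex set \<Rightarrow> complex \<Rightarrow> complex" where
  "analytic_continuation f D U = (SOME g. g holomorphic_on U \<and> (\<forall>s\<in>D. g s = f s))"

definition zeta :: "complex \<Rightarrow> complex" where
  "zeta = analytic_continuation
     (\<lambda>s. \<Sum>n. of_nat (Suc n) powr (- s)) {s. Re s > 1} (- {1})"

definition hurwitz_zeta :: "real \<Rightarrow> complex \<Rightarrow> complex" where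
  "hurwitz_zeta a = analytic_continuation
     (\<lambda>s. \<Sum>n. (of_nat n + of_real a) powr (- s)) {s. Re s > 1} (- {1})"

definition E :: "real \<Rightarrow> complex \<Rightarrow> complex" where
  "E \<Delta> = analytic_continuation
     (\<lambda>s. 1 / 2 powr s * zeta s
          + 1 / 2 powr (s + 1) *
              (hurwitz_zeta (1 / (1 + \<Delta>)) s + hurwitz_zeta (\<Delta> / (1 + \<Delta>)) s))
     {s. Re s > 1} (- {1})"

definition zeta_zeros :: "complex set" where
  "zeta_zeros = {s. s \<noteq> 1 \<and> zeta s = 0}"

definition E_zeros :: "real \<Rightarrow> complex set" where
  "E_zeros \<Delta> = {s. s \<noteq> 1 \<and> E \<Delta> s = 0}"

definition off_critical :: "complex \<Rightarrow> bool" where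
  "off_critical s \<longleftrightarrow> Re s \<noteq> 1 / 2"

text \<open>A zero of \<open>E (1 - \<epsilon>)\<close> followed continuously as \<open>\<epsilon>\<close> decreases to \<open>0\<close>.\<close>

definition zero_branch :: "(real \<Rightarrow> complex) \<Rightarrow> bool" where
  "zero_branch s \<longleftrightarrow>
     (\<exists>\<delta>>0. \<delta> \<le> 1 \<and> continuous_on {0<..<\<delta>} s \<and> (\<forall>\<epsilon>\<in>{0<..<\<delta>}. s \<epsilon> \<in> E_zeros (1 - \<epsilon>)))"

definition tends_to_zeta_zero :: "(real \<Rightarrow> complex) \<Rightarrow> bool" where
  "tends_to_zeta_zero s \<longleftrightarrow> (\<exists>z\<in>zeta_zeros. (s \<longlongrightarrow> z) (at_right 0))"

definition odd_lattice :: "real set" where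
  "odd_lattice = {of_int (2 * m + 1) * pi / ln 2 | m :: int. True}"

end

theory Submission
  imports Defs "HOL-Real_Asymp.Real_Asymp"
begin

text \<open>
  The Hurwitz zeta function is continued by the recursion
  \<open>(s - 1) \<zeta>(s,a) = a\<^bsup>1-s\<^esup> + (s - 1) s \<integral> (1 - u) \<zeta>(s+1, a+u) du\<close> over \<open>0 \<le> u \<le> 1\<close>, which also yields
  joint continuity in \<open>(s,a)\<close>. With \<open>\<beta> = \<epsilon> / (2 - \<epsilon>)\<close> one has, for \<open>\<Re> s > 1\<close>,
  \<open>E(s) = \<Sum> (2n+2)\<^bsup>-s\<^esup> + \<onehalf> \<Sum> [(2n+1+\<beta>)\<^bsup>-s\<^esup> + (2n+1-\<beta>)\<^bsup>-s\<^esup>]\<close>, and \<open>\<Gamma>(s) E(s)\<close> is the Mellin transform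
  of \<open>(coth t - 1) / 2 + cosh(\<beta>t) / (2 sinh t)\<close>. Expanding this kernel into partial fractions and
  integrating termwise for \<open>-1 < s < 0\<close> gives the functional equation
  \<open>E(s) = \<Gamma>(1-s) sin(\<pi>s/2) \<pi>\<^bsup>s-1\<^esup> F(1-s)\<close> with \<open>F(w) = \<Sum> (1 + (-1)\<^sup>n cos(\<pi>n\<beta>)) n\<^bsup>-w\<^esup>\<close>.

  Hence the zeros of \<open>E\<close> in \<open>\<Re> s < 0\<close> are the trivial zeros of \<open>\<zeta>\<close> and the zeros of \<open>F(1-s)\<close>. As \<open>\<beta> \<rightarrow> 0\<close>,
  \<open>F(w)\<close> tends to \<open>2\<^bsup>1-w\<^esup> \<zeta>(w)\<close>, uniformly on \<open>\<Re> w \<ge> 1 + a\<close>, so zeros of \<open>F\<close> must move far to the right,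
  where \<open>F(w) = c\<^sub>1 (1 + A(w)) + c\<^sub>2 2\<^bsup>-w\<^esup> (1 + B(w))\<close> with tiny \<open>A\<close> and \<open>B\<close>. Taking logarithms, \<open>F(w) = 0\<close> becomes
  the fixed point equation of a contraction, one for each branch \<open>k\<close> of the logarithm. Iterating it once
  produces the expansions, in which the powers of \<open>\<epsilon>\<close> come from \<open>ln(c\<^sub>1/c\<^sub>2) + c\<^sub>1/c\<^sub>2\<close> and the oscillating
  term from \<open>8 \<cdot> 3\<^bsup>-w\<^esup>\<close>. To the right of the imaginary axis, \<open>E(s)\<close> tends to \<open>\<zeta>(s)\<close>.
\<close>

section \<open>Continuation of the Hurwitz zeta function\<close>

text \<open>The Dirichlet series of \<open>E\<close> needs \<open>s > 1\<close> and its dual needs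
  \<open>s < 0\<close>, so the two Mellin transforms share no domain on which to compare them. The
  integral is therefore cut at \<open>t = 1\<close>: both transforms turn out to consist of the same
  two convergent pieces and the same rational terms \<open>1 / (s - 1) - 1 / (2 * s)\<close>. These
  identities are obtained for real \<open>s\<close>, where all integrands are nonnegative and sums
  may be exchanged with integrals freely, and are then spread by the identity theorem. In the dual
  series the coefficient \<open>c1 \<beta>\<close> of \<open>n = 1\<close> tends to 0, so the term
  \<open>n = 2\<close> can balance it. Dividing the odd terms by \<open>c1 \<beta>\<close> is
  harmless only because \<open>1 - cos (n x)\<close> is at most \<open>n^2 (1 - cos x)\<close>. The
  half-plane \<open>Re w \<ge> 15\<close> is a convenient region where tails with such quadratic
  coefficients have small Lipschitz constants. The oscillating term has order
  \<open>2 ln 3 / ln 2\<close>, which lies between 3 and 4, so all errors of order 4 in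
  \<open>\<epsilon>\<close> may be discarded.\<close>

lemma continuous_on_suminf:
  fixes f :: "nat \<Rightarrow> 'a::topological_space \<Rightarrow> 'b::banach"
  assumes "\<And>n. continuous_on S (f n)" "\<And>n x. x \<in> S \<Longrightarrow> norm (f n x) \<le> M n" "summable M"
  shows "continuous_on S (\<lambda>x. \<Sum>n. f n x)"
  using Weierstrass_m_test[OF assms(2,3)]
  by (rule uniform_limit_theorem[rotated]) (auto intro!: always_eventually continuous_on_sum assms)

lemma holomorphic_on_suminf:
  assumes "open S" "\<And>n. f n holomorphic_on S"
    and M: "\<And>x. x \<in> S \<Longrightarrow> \<exists>d>0. cball x d \<subseteq> S \<and> (\<exists>M. summable M \<and> (\<forall>n. \<forall>y\<in>cball x d. norm (f n y) \<le> M n))"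
  shows "(\<lambda>x. \<Sum>n. f n x) holomorphic_on S"
proof (rule holomorphic_uniform_sequence[OF \<open>open S\<close>])
  show "(\<lambda>x. \<Sum>i<n. f i x) holomorphic_on S" for n
    by (intro holomorphic_intros assms)
  fix x assume "x \<in> S"
  from M[OF this] obtain d M where d: "d > 0" "cball x d \<subseteq> S" "summable M"
    "\<And>n y. y \<in> cball x d \<Longrightarrow> norm (f n y) \<le> M n" by blast
  show "\<exists>d>0. cball x d \<subseteq> S \<and> uniform_limit (cball x d) (\<lambda>n x. \<Sum>i<n. f i x) (\<lambda>x. \<Sum>n. f n x) sequentially"
    using d(1,2) Weierstrass_m_test[of "cball x d" f, OF d(4,3)] by (intro exI[of _ d]) simp
qed

text \<open>Morera's theorem: the integral over a triangle is exchanged with the integral over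
  \<open>u\<close>, and the inner triangle integrals vanish by Cauchy's theorem for each fixed
  \<open>u\<close>.\<close>

lemma holomorphic_on_integral:
  fixes f :: "complex \<Rightarrow> real \<Rightarrow> complex"
  assumes "open S" and cont: "continuous_on (S \<times> {0..1}) (\<lambda>(s,u). f s u)"
    and hol: "\<And>u. u \<in> {0..1} \<Longrightarrow> (\<lambda>s. f s u) holomorphic_on S"
  shows "(\<lambda>s. integral {0..1} (f s)) holomorphic_on S"
proof -
  have "(\<lambda>s. integral {0..1} (f s)) analytic_on S"
  proof (rule Morera_triangle[OF _ \<open>open S\<close>], goal_cases)
    case 1
    show ?case using integral_continuous_on_param[of S 0 1 f] cont by simp
  next
    case (2 a b c)
    show ?case
    proof
      assume sub: "convex hull {a,b,c} \<subseteq> S"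
      \<comment> \<open>The integral over \<open>u\<close> is rewritten as a contour integral along
        the complex segment from 0 to 1, so that Fubini for contour integrals applies;
        \<open>Re w\<close> recovers the real parameter.\<close>
      define g where "g = (\<lambda>s w. f s (Re w))"
      have eq: "integral {0..1} (f s) = contour_integral (linepath 0 1) (g s)" for s
        by (simp add: contour_integral_integral g_def linepath_def)
      have seg: "closed_segment x y \<subseteq> S" if "x \<in> {a,b,c}" "y \<in> {a,b,c}" for x y
        using sub that by (meson closed_segment_subset convex_convex_hull hull_inc order_trans)
      have seg01: "closed_segment 0 (1::complex) = of_real ` {0..1}"
        by (auto simp: closed_segment_def scaleR_conv_of_real)
      have contg: "continuous_on (S \<times> closed_segment 0 1) (\<lambda>(s,w). g s w)"
        unfolding g_def split_beta
        by (rule continuous_on_compose2[OF cont[unfolded split_beta], of _ "\<lambda>x. (fst x, Re (snd x))", simplified])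
           (auto intro!: continuous_intros simp: seg01)
      have swap: "contour_integral (linepath x y) (\<lambda>s. contour_integral (linepath 0 1) (g s)) =
            contour_integral (linepath 0 1) (\<lambda>w. contour_integral (linepath x y) (\<lambda>s. g s w))"
        if "x \<in> {a,b,c}" "y \<in> {a,b,c}" for x y
        by (rule contour_integral_swap)
           (use seg[OF that] in \<open>auto intro!: continuous_on_subset[OF contg] continuous_intros\<close>)
      have ci: "(\<lambda>w. contour_integral (linepath x y) (\<lambda>s. g s w)) contour_integrable_on linepath 0 1"
        if "x \<in> {a,b,c}" "y \<in> {a,b,c}" for x y
      proof (rule contour_integrable_continuous_linepath)
        have "continuous_on (closed_segment 0 1 \<times> cbox 0 1)
            (\<lambda>(w,t). g (linepath x y t) w * (y - x))"
          unfolding split_beta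
        proof (intro continuous_on_mult continuous_on_const)
          have 1: "continuous_on (closed_segment 0 1 \<times> cbox 0 1) (\<lambda>p. (linepath x y (snd p), fst p))"
            unfolding linepath_def by (intro continuous_intros)
          have 2: "(\<lambda>p. (linepath x y (snd p), fst p)) ` (closed_segment 0 1 \<times> cbox 0 1) \<subseteq> S \<times> closed_segment 0 1"
            using seg[OF that] linepath_in_path[of _ x y] by fastforce
          show "continuous_on (closed_segment 0 1 \<times> cbox 0 1) (\<lambda>p. g (linepath x y (snd p)) (fst p))"
            using continuous_on_compose2[OF contg 1 2] by simp
        qed
        from integral_continuous_on_param[OF this]
        show "continuous_on (closed_segment 0 1) (\<lambda>w. contour_integral (linepath x y) (\<lambda>s. g s w))"
          by (simp add: contour_integral_integral)
      qed
      have "contour_integral (linepath 0 1) (\<lambda>w. contour_integral (linepath a b) (\<lambda>s. g s w)) +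
         contour_integral (linepath 0 1) (\<lambda>w. contour_integral (linepath b c) (\<lambda>s. g s w)) +
         contour_integral (linepath 0 1) (\<lambda>w. contour_integral (linepath c a) (\<lambda>s. g s w)) =
         contour_integral (linepath 0 1) (\<lambda>w. contour_integral (linepath a b) (\<lambda>s. g s w) +
            contour_integral (linepath b c) (\<lambda>s. g s w) + contour_integral (linepath c a) (\<lambda>s. g s w))"
        by (simp add: contour_integral_add contour_integrable_add ci)
      also have "\<dots> = contour_integral (linepath 0 1) (\<lambda>w. 0)"
      proof (rule contour_integral_cong)
        fix w :: complex assume "w \<in> path_image (linepath 0 1)"
        then have w: "Re w \<in> {0..1}" by (auto simp: seg01)
        have "(\<lambda>s. g s w) holomorphic_on convex hull {a,b,c}"
          unfolding g_def using hol[OF w] sub holomorphic_on_subset by blast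
        from Cauchy_theorem_triangle[OF this]
        have "contour_integral (linepath a b +++ linepath b c +++ linepath c a) (\<lambda>s. g s w) = 0"
          by (rule contour_integral_unique)
        moreover have "(\<lambda>s. g s w) contour_integrable_on linepath x y"
          if "x \<in> {a,b,c}" "y \<in> {a,b,c}" for x y
          by (rule contour_integrable_continuous_linepath, rule continuous_on_subset[OF _ seg[OF that]])
             (use hol[OF w] in \<open>simp add: g_def holomorphic_on_imp_continuous_on\<close>)
        ultimately show "contour_integral (linepath a b) (\<lambda>s. g s w) +
            contour_integral (linepath b c) (\<lambda>s. g s w) + contour_integral (linepath c a) (\<lambda>s. g s w) = 0"
          by (simp add: contour_integrable_join add.assoc)
      qed auto
      finally show "contour_integral (linepath a b) (\<lambda>s. integral {0..1} (f s)) +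
        contour_integral (linepath b c) (\<lambda>s. integral {0..1} (f s)) +
        contour_integral (linepath c a) (\<lambda>s. integral {0..1} (f s)) = 0"
        by (simp add: eq swap)
    qed
  qed
  thus ?thesis by (rule analytic_imp_holomorphic)
qed

lemma analytic_continuation_eq:
  assumes "h holomorphic_on U" "open U" "connected U" "open D" "D \<noteq> {}" "D \<subseteq> U"
    "\<And>s. s \<in> D \<Longrightarrow> h s = f s" "s \<in> U"
  shows "analytic_continuation f D U s = h s"
proof -
  define g where "g = analytic_continuation f D U"
  have "\<exists>g. g holomorphic_on U \<and> (\<forall>s\<in>D. g s = f s)" using assms by blast
  from someI_ex[OF this] have g: "g holomorphic_on U" "\<And>s. s \<in> D \<Longrightarrow> g s = f s"
    by (auto simp: g_def analytic_continuation_def)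
  have "g s = h s"
    by (rule analytic_continuation_open[of D U g h]) (use assms g in auto)
  thus ?thesis by (simp add: g_def)
qed

section \<open>The Hurwitz series and its continuation by recursion in \<open>s\<close>\<close>

definition hseries :: "real \<Rightarrow> complex \<Rightarrow> complex" where
  "hseries a s = (\<Sum>n. (of_nat n + of_real a) powr (- s))"

lemma norm_hterm: "a \<ge> 0 \<Longrightarrow> norm ((of_nat n + of_real a) powr (- s)) = (of_nat n + a) powr (- Re s)"
  using norm_powr_real_powr'[of "real n + a" "- s"]
  by (simp add: norm_powr_real_powr)

lemma summable_M: "c > 1 \<Longrightarrow> summable (\<lambda>n. real (Suc n) powr (- c))"
  using summable_Suc_iff[of "\<lambda>n. real n powr (-c)"] by (simp add: summable_real_powr_iff)

lemma hterm_le: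
  assumes "a \<ge> 0" "c \<le> Re s" "c > 0"
  shows "norm ((of_nat (Suc n) + of_real a) powr (- s)) \<le> real (Suc n) powr (- c)"
proof -
  have "(real (Suc n) + a) powr (- Re s) \<le> (real (Suc n) + a) powr (- c)"
    using assms by (intro powr_mono) auto
  also have "\<dots> \<le> real (Suc n) powr (- c)"
    using assms by (intro powr_mono2') auto
  finally show ?thesis using norm_hterm[OF assms(1), of "Suc n" s] by simp
qed

lemma summable_norm_hterm:
  assumes "a \<ge> 0" "Re s > 1"
  shows "summable (\<lambda>n. norm ((of_nat n + of_real a) powr (- s) :: complex))"
proof -
  have "summable (\<lambda>n. norm ((of_nat (Suc n) + of_real a) powr (- s) :: complex))"
    by (rule summable_comparison_test'[OF summable_M[OF assms(2)]])
       (use hterm_le[of a "Re s" s] assms in \<open>simp\<close>)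
  thus ?thesis by (subst (asm) summable_Suc_iff)
qed

lemma summable_hterm:
  assumes "a \<ge> 0" "Re s > 1"
  shows "summable (\<lambda>n. (of_nat n + of_real a) powr (- s) :: complex)"
  by (rule summable_norm_cancel[OF summable_norm_hterm[OF assms]])

text \<open>The term \<open>n = 0\<close> has no bound uniform in \<open>a > 0\<close>, so it is
  kept apart and the M-test is applied to the remaining terms only.\<close>

lemma hseries_split:
  assumes "a \<ge> 0" "Re s > 1"
  shows "hseries a s = of_real a powr (- s) + (\<Sum>n. (of_nat (Suc n) + of_real a) powr (- s))"
  using suminf_split_head[OF summable_hterm[OF assms]] by (simp add: hseries_def)

lemma continuous_on_powr_pos:
  assumes "continuous_on S f" "continuous_on S g" "\<And>x. x \<in> S \<Longrightarrow> f x > 0"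
  shows "continuous_on S (\<lambda>x. complex_of_real (f x) powr g x)"
  by (intro continuous_on_powr_complex)
     (use assms in \<open>auto intro!: continuous_on_of_real simp: complex_nonpos_Reals_iff dest: assms(3)\<close>)

lemma continuous_on_hseries: "continuous_on ({0<..} \<times> {s. Re s > 1}) (\<lambda>(a,s). hseries a s)"
proof -
  have *: "continuous_on ({0<..} \<times> {s. Re s > c}) (\<lambda>(a,s). hseries a s)" if "c > 1" for c
  proof -
    have "continuous_on ({0<..} \<times> {s. Re s > c})
      (\<lambda>p. of_real (fst p) powr (- snd p) + (\<Sum>n. (of_real (real (Suc n) + fst p)) powr (- snd p)))"
    proof (intro continuous_on_add continuous_on_suminf[OF _ _ summable_M[OF \<open>c>1\<close>]])
      show "continuous_on ({0<..} \<times> {s. c < Re s}) (\<lambda>p. complex_of_real (real (Suc n) + fst p) powr - snd p)" for n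
        by (intro continuous_on_powr_pos continuous_intros) auto
      show "continuous_on ({0<..} \<times> {s. c < Re s}) (\<lambda>p. complex_of_real (fst p) powr - snd p)"
        by (intro continuous_on_powr_pos continuous_intros) auto
      show "norm (complex_of_real (real (Suc n) + fst p) powr - snd p) \<le> real (Suc n) powr - c"
        if "p \<in> {0<..} \<times> {s. c < Re s}" for n p
        using hterm_le[of "fst p" c "snd p" n] that \<open>c > 1\<close> by (auto simp: add_ac)
    qed
    thus ?thesis
      by (rule continuous_on_eq) (use that in \<open>auto simp: hseries_split add_ac\<close>)
  qed
  have "continuous_on (\<Union>c\<in>{1<..}. {0<..} \<times> {s. Re s > c}) (\<lambda>(a,s). hseries a s)"
    by (rule continuous_on_open_UN) (simp_all add: * open_Times open_halfspace_Re_gt)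
  moreover have "(\<Union>c\<in>{1<..}. {0::real<..} \<times> {s. Re s > c}) = {0<..} \<times> {s. Re s > 1}"
    by (auto simp: Bex_def) (meson dense)
  ultimately show ?thesis by simp
qed

lemma holomorphic_hseries: "a > 0 \<Longrightarrow> hseries a holomorphic_on {s. Re s > 1}"
proof -
  assume a: "a > 0"
  have "(\<lambda>s. of_real a powr (- s) + (\<Sum>n. (of_nat (Suc n) + of_real a) powr (- s))) holomorphic_on {s. Re s > 1}"
  proof (intro holomorphic_on_add holomorphic_on_suminf open_halfspace_Re_gt)
    show "(\<lambda>s. complex_of_real a powr - s) holomorphic_on {s. 1 < Re s}"
      by (intro holomorphic_intros) (use a in auto)
    show "(\<lambda>s. (of_nat (Suc n) + complex_of_real a) powr - s) holomorphic_on {s. 1 < Re s}" for n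
    proof -
      have eq: "of_nat (Suc n) + complex_of_real a = of_real (real (Suc n) + a)" by simp
      show ?thesis unfolding eq by (intro holomorphic_intros)
    qed
    fix x assume x: "x \<in> {s. 1 < Re s}"
    define d where "d = (Re x - 1) / 2"
    have d: "d > 0" "1 + d = Re x - d" using x by (auto simp: d_def field_simps)
    have *: "1 + d \<le> Re y" if "y \<in> cball x d" for y
      using abs_Re_le_cmod[of "x - y"] that d by (auto simp: dist_norm)
    show "\<exists>d>0. cball x d \<subseteq> {s. 1 < Re s} \<and>
         (\<exists>M. summable M \<and> (\<forall>n. \<forall>y\<in>cball x d. norm ((of_nat (Suc n) + complex_of_real a) powr - y) \<le> M n))"
    proof (intro exI[of _ d] conjI exI[of _ "\<lambda>n. real (Suc n) powr (- (1+d))"] allI ballI)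
      show "cball x d \<subseteq> {s. 1 < Re s}" using * d by (smt (verit) mem_Collect_eq subsetI)
      show "norm ((of_nat (Suc n) + complex_of_real a) powr - y) \<le> real (Suc n) powr (- (1+d))"
        if "y \<in> cball x d" for n y
        using hterm_le[OF _ *[OF that], of a n] d(1) a by simp
    qed (use d summable_M[of "1+d"] in auto)
  qed
  thus ?thesis by (rule holomorphic_transform) (use a in \<open>auto simp: hseries_split\<close>)
qed

text \<open>Termwise, \<open>s \<integral> (1 - u) (x + u)\<^bsup>-s-1\<^esup> du\<close> over \<open>[0,1]\<close> is the defect of the
  left Riemann sum of \<open>x\<^bsup>-s\<^esup>\<close>; summed over \<open>x = n + a\<close> this expresses \<open>\<zeta>(s,a)\<close> by \<open>\<zeta>(s+1,\<cdot>)\<close>.\<close>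

lemma hterm_recursion:
  fixes s :: complex
  assumes x: "x > 0"
  shows "((\<lambda>u. (s - 1) * ((1 - of_real u) * (s * of_real (x + u) powr (- (s + 1))))) has_integral
          (s - 1) * of_real x powr (- s) - (of_real x powr (1 - s) - of_real (x + 1) powr (1 - s))) {0..1}"
proof -
  \<comment> \<open>An antiderivative found by integration by parts. The factor \<open>1 - u\<close>
    vanishes at the upper end point, so \<open>x powr (-s)\<close> arises at the lower one
    alone.\<close>
  define P where "P = (\<lambda>u::real. - (s - 1) * (1 - of_real u) * of_real (x + u) powr (- s) + of_real (x + u) powr (1 - s))"
  have d: "((\<lambda>u. complex_of_real (x + u) powr p) has_vector_derivative p * of_real (x + u) powr (p - 1)) (at u within {0..1})"
    if "u \<in> {0..1}" for u p
  proof -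
    have "((\<lambda>z. z powr p) has_field_derivative p * of_real (x + u) powr (p - 1)) (at (of_real (x + u)))"
      using x that by (intro has_field_derivative_powr) (auto simp: complex_nonpos_Reals_iff)
    moreover have "((\<lambda>u. complex_of_real (x + u)) has_vector_derivative 1) (at u within {0..1})"
      by (auto intro!: derivative_eq_intros)
    ultimately show ?thesis
      using field_vector_diff_chain_within[of "\<lambda>u. complex_of_real (x + u)" 1 u "{0..1}" "\<lambda>z. z powr p"
          "p * of_real (x + u) powr (p - 1)"]
        has_field_derivative_at_within[of "\<lambda>z. z powr p" "p * of_real (x + u) powr (p - 1)" "of_real (x + u)"
          "(\<lambda>u. complex_of_real (x + u)) ` {0..1}"]
      by (simp add: o_def)
  qed
  have "((\<lambda>u. (s - 1) * ((1 - of_real u) * (s * of_real (x + u) powr (- (s + 1))))) has_integral P 1 - P 0) {0..1}"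
  proof (rule fundamental_theorem_of_calculus)
    fix u :: real assume u: "u \<in> {0..1}"
    show "(P has_vector_derivative (s - 1) * ((1 - of_real u) * (s * of_real (x + u) powr (- (s + 1))))) (at u within {0..1})"
    proof -
      have "((\<lambda>u. - (s - 1) * (1 - complex_of_real u)) has_vector_derivative (s - 1)) (at u within {0..1})"
        by (auto intro!: derivative_eq_intros)
      from has_vector_derivative_add[OF has_vector_derivative_mult[OF this d[OF u, of "- s"]] d[OF u, of "1 - s"]]
      show ?thesis unfolding P_def by (rule has_vector_derivative_eq_rhs) (simp add: algebra_simps minus_diff_commute[of s 1])
    qed
  qed auto
  thus ?thesis by (simp add: P_def algebra_simps)
qed

text \<open>Sum of \<open>hterm_recursion\<close> over \<open>x = n + a\<close>: the differences of
  \<open>(n + a) powr (1 - s)\<close> telescope to \<open>a powr (1 - s)\<close>, and uniform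
  convergence on [0,1] permits integration term by term. The right-hand side involves the series
  only at \<open>s + 1\<close>, so it makes sense already for \<open>Re s > 0\<close>; this gain of
  one unit drives the continuation.\<close>

lemma hseries_recursion:
  assumes a: "a > 0" and s: "Re s > 1"
  shows "(s - 1) * hseries a s =
    of_real a powr (1 - s) + (s - 1) * integral {0..1} (\<lambda>u. (1 - of_real u) * (s * hseries (a + u) (s + 1)))"
proof -
  define g where "g = (\<lambda>n u. (s - 1) * ((1 - of_real u) * (s * of_real (real n + a + u) powr (- (s + 1)))))"
  define T where "T = (\<lambda>n. (s - 1) * of_real (real n + a) powr (- s) - (of_real (real n + a) powr (1 - s) - of_real (real n + a + 1) powr (1 - s)))"
  have gi: "(g n has_integral T n) {0..1}" for n
    unfolding g_def T_def using hterm_recursion[of "real n + a" s] a by simp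
  have sm: "summable (\<lambda>n. (real n + a) powr (- (Re s + 1)))"
  proof -
    have "norm ((of_nat n + complex_of_real a) powr (- (s + 1))) = (real n + a) powr (- (Re s + 1))" for n
      using norm_hterm[of a n "s + 1"] a by simp
    thus ?thesis using summable_norm_hterm[of a "s + 1"] a s by simp
  qed
  have "uniform_limit {0..1} (\<lambda>N u. \<Sum>n<N. g n u) (\<lambda>u. \<Sum>n. g n u) sequentially"
  proof (rule Weierstrass_m_test[OF _ summable_mult[OF sm]])
    show "norm (g n u) \<le> norm (s - 1) * norm s * (real n + a) powr (- (Re s + 1))" if "u \<in> {0..1}" for n u
    proof -
      have "norm (complex_of_real (real n + a + u) powr (- (s + 1))) \<le> (real n + a) powr (- (Re s + 1))"
      proof -
        have "norm (complex_of_real (real n + a + u) powr (- (s + 1))) = (real n + a + u) powr (- (Re s + 1))"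
          using norm_hterm[of "a + u" n "s + 1"] that a by (simp add: add.assoc)
        also have "\<dots> \<le> (real n + a) powr (- (Re s + 1))"
          using that a s by (intro powr_mono2') auto
        finally show ?thesis .
      qed
      moreover have "norm (1 - complex_of_real u) \<le> 1"
      proof -
        have "norm (complex_of_real (1 - u)) \<le> 1" unfolding norm_of_real using that by auto
        thus ?thesis by simp
      qed
      ultimately have "norm (1 - complex_of_real u) * norm (complex_of_real (real n + a + u) powr (- (s + 1))) \<le> 1 * (real n + a) powr (- (Re s + 1))"
        by (intro mult_mono) auto
      hence "norm (s - 1) * norm s * (norm (1 - complex_of_real u) * norm (complex_of_real (real n + a + u) powr (- (s + 1)))) \<le> norm (s - 1) * norm s * (1 * (real n + a) powr (- (Re s + 1)))"
        by (rule mult_left_mono) auto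
      thus ?thesis unfolding g_def norm_mult by (simp only: mult_ac mult_1)
    qed
  qed
  moreover have gs: "(\<Sum>n. g n u) = (s - 1) * ((1 - of_real u) * (s * hseries (a + u) (s + 1)))" if "u \<in> {0..1}" for u
  proof -
    have "summable (\<lambda>n. (of_nat n + complex_of_real (a + u)) powr (- (s + 1)))"
      using a s that by (intro summable_hterm) auto
    thus ?thesis by (simp add: g_def hseries_def suminf_mult summable_mult add_ac)
  qed
  ultimately have ul: "uniform_limit {0..1} (\<lambda>N u. \<Sum>n<N. g n u)
          (\<lambda>u. (s - 1) * ((1 - of_real u) * (s * hseries (a + u) (s + 1)))) sequentially"
    using uniform_limit_cong'[where X = "{0..1}" and f = "\<lambda>N u. \<Sum>n<N. g n u" and F = sequentially, OF refl gs] by simp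
  have c: "continuous_on {0..1} (\<lambda>u. \<Sum>n<N. g n u)" for N
    unfolding g_def
    by (intro continuous_on_sum continuous_intros continuous_on_powr_pos) (use a in auto)
  obtain I J where IJ: "\<And>N. ((\<lambda>u. \<Sum>n<N. g n u) has_integral I N) {0..1}"
     "((\<lambda>u. (s - 1) * ((1 - of_real u) * (s * hseries (a + u) (s + 1)))) has_integral J) {0..1}" "I \<longlonglongrightarrow> J"
    by (rule uniform_limit_integral[OF ul c sequentially_bot], rule that)
  have "I N = (\<Sum>n<N. T n)" for N
    using has_integral_unique[OF IJ(1)[of N] has_integral_sum[of "{..<N}" g T]] gi by simp
  hence "I = (\<lambda>N. \<Sum>n<N. T n)" by auto
  hence "T sums J" using IJ(3) by (simp add: sums_def)
  moreover have "T sums ((s - 1) * hseries a s - (of_real a powr (1 - s) - 0))"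
    unfolding T_def
  proof (rule sums_diff)
    show "(\<lambda>n. (s - 1) * of_real (real n + a) powr - s) sums ((s - 1) * hseries a s)"
      using summable_hterm[of a s] a s unfolding hseries_def
      by (intro sums_mult) (simp add: summable_sums)
    have "(\<lambda>n. norm (complex_of_real (real n + a) powr (1 - s))) \<longlonglongrightarrow> 0"
    proof -
      have "(\<lambda>n. (real n + a) powr (1 - Re s)) \<longlonglongrightarrow> 0" using s by real_asymp
      thus ?thesis using norm_hterm[of a _ "s - 1"] a by simp
    qed
    hence "(\<lambda>n. complex_of_real (real n + a) powr (1 - s)) \<longlonglongrightarrow> 0"
      by (rule tendsto_norm_zero_cancel)
    from telescope_sums'[OF this]
    show "(\<lambda>n. complex_of_real (real n + a) powr (1 - s) - complex_of_real (real n + a + 1) powr (1 - s)) sums (of_real a powr (1 - s) - 0)"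
      by (simp add: add_ac)
  qed
  ultimately have "J = (s - 1) * hseries a s - of_real a powr (1 - s)"
    using sums_unique2 by fastforce
  moreover have "J = (s - 1) * integral {0..1} (\<lambda>u. (1 - of_real u) * (s * hseries (a + u) (s + 1)))"
    using IJ(2) by (simp add: has_integral_iff)
  ultimately show ?thesis by simp
qed

text \<open>The recursion unfolded \<open>k\<close> times, which represents
  \<open>(s - 1) \<zeta>(s,a)\<close> on \<open>Re s > 1 - k\<close>. The factor
  \<open>s - 1\<close> removes the pole, and at argument \<open>s + 1\<close> it becomes the factor
  \<open>s\<close> that stands under the integral in \<open>hseries_recursion\<close>.\<close>

fun Zaux :: "nat \<Rightarrow> real \<Rightarrow> complex \<Rightarrow> complex" where
  "Zaux 0 a s = (s - 1) * hseries a s"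
| "Zaux (Suc k) a s = of_real a powr (1 - s) + (s - 1) * integral {0..1} (\<lambda>u. (1 - of_real u) * Zaux k (a + u) (s + 1))"

text \<open>The three claims are proved in one induction: the next integral runs over
  \<open>a + u\<close>, so holomorphy in \<open>s\<close> at one level requires joint continuity in
  \<open>(a,s)\<close> at the level below, and agreement of consecutive levels is inherited under
  the integral.\<close>

lemma Zaux_props:
  "continuous_on ({0<..} \<times> {s. Re s > 1 - real k}) (\<lambda>(a,s). Zaux k a s) \<and>
   (\<forall>a>0. Zaux k a holomorphic_on {s. Re s > 1 - real k}) \<and>
   (\<forall>a>0. \<forall>s. Re s > 1 - real k \<longrightarrow> Zaux (Suc k) a s = Zaux k a s)"
proof (induction k)
  case 0
  have "continuous_on ({0<..} \<times> {s. Re s > 1}) (\<lambda>p. (snd p - 1) * (\<lambda>(a,s). hseries a s) p)"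
    by (intro continuous_intros continuous_on_hseries)
  moreover have "(\<lambda>s. (s - 1) * hseries a s) holomorphic_on {s. Re s > 1}" if "a > 0" for a
    by (intro holomorphic_intros holomorphic_hseries that)
  ultimately show ?case using hseries_recursion by (auto simp: split_beta)
next
  case (Suc k)
  define D where "D = {s. Re s > 1 - real (Suc k)}"
  have openD: "open D" by (simp add: D_def open_halfspace_Re_gt)
  have IH1: "continuous_on ({0<..} \<times> {s. Re s > 1 - real k}) (\<lambda>(a,s). Zaux k a s)"
   and IH2: "\<And>a. a > 0 \<Longrightarrow> Zaux k a holomorphic_on {s. Re s > 1 - real k}"
   and IH3: "\<And>a s. a > 0 \<Longrightarrow> Re s > 1 - real k \<Longrightarrow> Zaux (Suc k) a s = Zaux k a s" using Suc by auto
  have c: "continuous_on (({0<..} \<times> D) \<times> cbox 0 1) (\<lambda>(p,u). (1 - of_real u) * Zaux k (fst p + u) (snd p + 1))"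
  proof -
    have "continuous_on (({0<..} \<times> D) \<times> cbox (0::real) 1) (\<lambda>q. (\<lambda>(a,s). Zaux k a s) (fst (fst q) + snd q, snd (fst q) + 1))"
      by (rule continuous_on_compose2[OF IH1]) (auto intro!: continuous_intros simp: D_def)
    thus ?thesis unfolding split_beta by (intro continuous_on_mult continuous_on_diff continuous_on_const continuous_on_of_real continuous_on_snd continuous_on_id) simp
  qed
  have 1: "continuous_on ({0<..} \<times> D) (\<lambda>p. Zaux (Suc k) (fst p) (snd p))"
    using integral_continuous_on_param[OF c]
    by (auto intro!: continuous_intros continuous_on_powr_pos)
  have 2: "Zaux (Suc k) a holomorphic_on D" if "a > 0" for a
  proof -
    have "(\<lambda>s. integral {0..1} (\<lambda>u. (1 - of_real u) * Zaux k (a + u) (s + 1))) holomorphic_on D"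
    proof (rule holomorphic_on_integral[OF openD])
      have "continuous_on (D \<times> {0..1}) (\<lambda>q. (\<lambda>(p,u). (1 - of_real u) * Zaux k (fst p + u) (snd p + 1)) ((a, fst q), snd q))"
        by (rule continuous_on_compose2[OF c]) (auto intro!: continuous_intros simp: that)
      thus "continuous_on (D \<times> {0..1}) (\<lambda>(s,u). (1 - of_real u) * Zaux k (a + u) (s + 1))"
        by (simp add: split_beta)
      show "(\<lambda>s. (1 - of_real u) * Zaux k (a + u) (s + 1)) holomorphic_on D" if "u \<in> {0..1}" for u
      proof -
        have "(Zaux k (a + u) \<circ> (\<lambda>s. s + 1)) holomorphic_on D"
          by (rule holomorphic_on_compose_gen[OF _ IH2]) (use that \<open>a > 0\<close> in \<open>auto intro!: holomorphic_intros simp: D_def\<close>)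
        thus ?thesis by (intro holomorphic_intros) (simp add: o_def)
      qed
    qed
    moreover have "(\<lambda>s. of_real a powr (1 - s)) holomorphic_on D"
      using that by (intro holomorphic_intros) auto
    ultimately have "(\<lambda>s. of_real a powr (1 - s) + (s - 1) * integral {0..1} (\<lambda>u. (1 - of_real u) * Zaux k (a + u) (s + 1))) holomorphic_on D"
      by (intro holomorphic_intros)
    moreover have "Zaux (Suc k) a = (\<lambda>s. of_real a powr (1 - s) + (s - 1) * integral {0..1} (\<lambda>u. (1 - of_real u) * Zaux k (a + u) (s + 1)))"
      by auto
    ultimately show ?thesis by (simp only:)
  qed
  have 3: "Zaux (Suc (Suc k)) a s = Zaux (Suc k) a s" if "a > 0" "s \<in> D" for a s
  proof -
    have "integral {0..1} (\<lambda>u. (1 - of_real u) * Zaux (Suc k) (a + u) (s + 1)) =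
       integral {0..1} (\<lambda>u. (1 - of_real u) * Zaux k (a + u) (s + 1))"
    proof (rule integral_cong)
      fix u :: real assume "u \<in> {0..1}"
      thus "(1 - of_real u) * Zaux (Suc k) (a + u) (s + 1) = (1 - of_real u) * Zaux k (a + u) (s + 1)"
        using that by (subst IH3) (auto simp: D_def)
    qed
    thus ?thesis by (simp del: Zaux.simps(2) add: Zaux.simps(2)[of "Suc k"] Zaux.simps(2)[of k a s])
  qed
  show ?case using 1 2 3 by (auto simp: D_def split_beta simp del: Zaux.simps)
qed

lemma Zaux_eq:
  assumes "a > 0" "Re s > 1 - real k" "k \<le> m"
  shows "Zaux m a s = Zaux k a s"
  using assms(3)
proof (induction rule: dec_induct)
  case (step n)
  thus ?case using Zaux_props[of n] assms by (auto simp del: Zaux.simps)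
qed auto

text \<open>The entire function \<open>(s - 1) \<zeta>(s,a)\<close>.\<close>

definition hurwitz_Z :: "real \<Rightarrow> complex \<Rightarrow> complex" where
  "hurwitz_Z a s = Zaux (nat \<lceil>2 - Re s\<rceil>) a s"

lemma hurwitz_Z_eq: 
  assumes "a > 0" "Re s > 1 - real k" shows "hurwitz_Z a s = Zaux k a s"
proof -
  define m where "m = nat \<lceil>2 - Re s\<rceil>"
  have m: "Re s > 1 - real m" unfolding m_def by linarith
  have "Zaux m a s = Zaux k a s"
    using Zaux_eq[of a k s m] Zaux_eq[of a m s k] assms m by (metis nle_le)
  thus ?thesis by (simp add: hurwitz_Z_def m_def)
qed

lemma UN_halfplanes: "(\<Union>k. {s. Re s > 1 - real k}) = UNIV"
proof -
  have "\<exists>k. Re s > 1 - real k" for s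
    by (rule exI[of _ "nat \<lceil>2 - Re s\<rceil>"]) linarith
  thus ?thesis by blast
qed

lemma holomorphic_hurwitz_Z: "a > 0 \<Longrightarrow> hurwitz_Z a holomorphic_on A"
proof -
  assume a: "a > 0"
  have *: "hurwitz_Z a holomorphic_on (\<Union>k. {s. Re s > 1 - real k})"
  proof (rule holomorphic_on_UN_open)
    fix k
    show "hurwitz_Z a holomorphic_on {s. Re s > 1 - real k}"
    proof (rule holomorphic_transform)
      show "Zaux k a holomorphic_on {s. Re s > 1 - real k}" using Zaux_props[of k] a by blast
      show "Zaux k a s = hurwitz_Z a s" if "s \<in> {s. Re s > 1 - real k}" for s
        using hurwitz_Z_eq[OF a, of k s] that by (simp del: Zaux.simps)
    qed
  qed (auto simp: open_halfspace_Re_gt)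
  show ?thesis by (rule holomorphic_on_subset[OF *]) (simp add: UN_halfplanes)
qed

text \<open>For the later comparison of \<open>EZ \<beta>\<close> with \<open>EZ 0\<close>, which
  has to be uniform on compact sets of \<open>s\<close> as \<open>\<beta>\<close> tends to
  0.\<close>

lemma continuous_on_hurwitz_Z: "continuous_on ({0<..} \<times> UNIV) (\<lambda>(a,s). hurwitz_Z a s)"
proof -
  have "continuous_on (\<Union>k. {0<..} \<times> {s. Re s > 1 - real k}) (\<lambda>(a,s). hurwitz_Z a s)"
  proof (rule continuous_on_open_UN)
    fix k
    show "continuous_on ({0<..} \<times> {s. Re s > 1 - real k}) (\<lambda>(a,s). hurwitz_Z a s)"
    proof (rule continuous_on_eq)
      show "continuous_on ({0<..} \<times> {s. Re s > 1 - real k}) (\<lambda>(a,s). Zaux k a s)" using Zaux_props[of k] by blast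
      show "(case p of (a,s) \<Rightarrow> Zaux k a s) = (case p of (a,s) \<Rightarrow> hurwitz_Z a s)"
        if "p \<in> {0<..} \<times> {s. Re s > 1 - real k}" for p
        using hurwitz_Z_eq[of "fst p" k "snd p"] that by (cases p) (simp del: Zaux.simps)
    qed
  qed (auto intro!: open_Times simp: open_halfspace_Re_gt)
  moreover have "(\<Union>k. {0::real<..} \<times> {s. Re s > 1 - real k}) = {0<..} \<times> UNIV"
    using UN_halfplanes by blast
  ultimately show ?thesis by simp
qed

lemma hurwitz_Z_series: "a > 0 \<Longrightarrow> Re s > 1 \<Longrightarrow> hurwitz_Z a s = (s - 1) * hseries a s"
  using hurwitz_Z_eq[of a 0 s] by simp

text \<open>At \<open>s = 1\<close> one step of the recursion loses its integral and leaves
  \<open>a powr 0\<close>: the residue of the Hurwitz zeta function is 1.\<close>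

lemma hurwitz_Z_1: "a > 0 \<Longrightarrow> hurwitz_Z a 1 = 1"
  using hurwitz_Z_eq[of a 1 1] by simp

section \<open>Partial fractions\<close>

text \<open>Completeness of the cosine system via Stone-Weierstrass. Multiplying by
  \<open>cos (pi x)\<close> turns each cosine into a mean of its two neighbours, so orthogonality
  passes from cosines to all polynomials in \<open>cos (pi x)\<close>. Hence \<open>D\<close> is
  orthogonal to uniform approximations of itself, and the integral of its square is 0.\<close>

lemma cosine_orthogonal_imp_zero:
  fixes D :: "real \<Rightarrow> real"
  assumes D: "continuous_on {0..1} D"
    and orth: "\<And>n::nat. integral {0..1} (\<lambda>x. D x * cos (pi * real n * x)) = 0"
    and x: "x \<in> {0..1}"
  shows "D x = 0"
proof -
  define V where "V = (\<lambda>g. continuous_on {0..1} g \<and> (\<forall>n::nat. integral {0..1} (\<lambda>x. D x * g x * cos (pi * real n * x)) = 0))"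
  have int: "(\<lambda>x. D x * g x * cos (c * x)) integrable_on {0..1}" if "continuous_on {0..1} g" for g c
    by (intro integrable_continuous_interval continuous_intros D that)
  have V1: "V (\<lambda>x. 1)" using orth by (auto simp: V_def)
  have Vadd: "V (\<lambda>x. g x + h x)" if "V g" "V h" for g h
  proof -
    have "integral {0..1} (\<lambda>x. D x * (g x + h x) * cos (pi * real n * x)) =
       integral {0..1} (\<lambda>x. D x * g x * cos (pi * real n * x)) + integral {0..1} (\<lambda>x. D x * h x * cos (pi * real n * x))" for n
    proof -
      have "(\<lambda>x. D x * (g x + h x) * cos (pi * real n * x)) = (\<lambda>x. D x * g x * cos (pi * real n * x) + D x * h x * cos (pi * real n * x))"
        by (simp add: algebra_simps)
      thus ?thesis using that int by (simp add: V_def Henstock_Kurzweil_Integration.integral_add)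
    qed
    thus ?thesis using that by (auto simp: V_def intro!: continuous_intros)
  qed
  have Vc: "V (\<lambda>x. c * g x)" if "V g" for c g
  proof -
    have "integral {0..1} (\<lambda>x. D x * (c * g x) * cos (pi * real n * x)) =
       c * integral {0..1} (\<lambda>x. D x * g x * cos (pi * real n * x))" for n
      by (subst Henstock_Kurzweil_Integration.integral_mult_right[symmetric]) (simp add: algebra_simps)
    thus ?thesis using that by (auto simp: V_def intro!: continuous_intros)
  qed
  have Vcos: "V (\<lambda>x. cos (pi * x) * g x)" if "V g" for g
  proof -
    have g: "continuous_on {0..1} g" using that by (simp add: V_def)
    have "integral {0..1} (\<lambda>x. D x * (cos (pi * x) * g x) * cos (pi * real n * x)) = 0" for n
    proof (cases n)
      case 0
      have "integral {0..1} (\<lambda>x. D x * g x * cos (pi * real 1 * x)) = 0" using that unfolding V_def by blast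
      thus ?thesis using 0 by (simp add: mult_ac)
    next
      case (Suc m)
      have "cos (pi * x) * cos (pi * real n * x) = (cos (pi * real (Suc n) * x) + cos (pi * real m * x)) / 2" for x
        by (simp add: cos_times_cos Suc algebra_simps)
      hence "integral {0..1} (\<lambda>x. D x * (cos (pi * x) * g x) * cos (pi * real n * x)) =
         integral {0..1} (\<lambda>x. (D x * g x * cos (pi * real (Suc n) * x) + D x * g x * cos (pi * real m * x)) / 2)"
        by (intro integral_cong) (simp add: algebra_simps)
      also have "\<dots> = (integral {0..1} (\<lambda>x. D x * g x * cos (pi * real (Suc n) * x)) + integral {0..1} (\<lambda>x. D x * g x * cos (pi * real m * x))) / 2"
        by (simp add: Henstock_Kurzweil_Integration.integral_add int[OF g] del: of_nat_Suc)
      also have "\<dots> = 0" using that unfolding V_def by (simp del: of_nat_Suc)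
      finally show ?thesis .
    qed
    thus ?thesis using g by (auto simp: V_def intro!: continuous_intros)
  qed
  have Vpoly: "V (\<lambda>x. p (cos (pi * x)) * g x)" if "real_polynomial_function p" "V g" for p g
    using that
  proof (induction arbitrary: g rule: real_polynomial_function.induct)
    case (linear f)
    have fy: "f y = f 1 * y" for y
      using linear_scale[OF bounded_linear.linear[OF linear(1)], of y 1] by simp
    have "(\<lambda>x. f (cos (pi * x)) * g x) = (\<lambda>x. f 1 * (cos (pi * x) * g x))"
      by (rule ext, subst fy, rule mult.assoc)
    thus ?case using Vc[OF Vcos[OF linear(2)], of "f 1"] by (simp only:)
  next
    case (const c)
    thus ?case by (rule Vc)
  next
    case (add f h)
    thus ?case using Vadd by (simp add: algebra_simps)
  next
    case (mult f h)
    show ?case using mult(3)[OF mult(4)[OF mult(5)]] by (simp add: mult_ac)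
  qed
  have bd: "integral {0..1} (\<lambda>x. D x * D x) \<le> e" if e: "e > 0" for e
  proof -
    obtain M where M: "M > 0" "\<And>x. x \<in> {0..1} \<Longrightarrow> norm (D x) \<le> M"
      using compact_imp_bounded[OF compact_continuous_image[OF D compact_Icc]] by (auto simp: bounded_pos)
    \<comment> \<open>\<open>D\<close> in the variable \<open>y = cos (pi x)\<close>, which maps
      [0,1] bijectively onto [-1,1]; polynomials in \<open>y\<close> are then dense.\<close>
    define Q where "Q = (\<lambda>y. D (arccos y / pi))"
    have "continuous_on {-1..1} Q"
      unfolding Q_def by (rule continuous_on_compose2[OF D])
        (auto intro!: continuous_intros simp: arccos_lbound arccos_ubound field_simps)
    then obtain p where p: "real_polynomial_function p" "\<And>y. y \<in> {-1..1} \<Longrightarrow> \<bar>Q y - p y\<bar> < e / M"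
      using Stone_Weierstrass_real_polynomial_function[of "{-1..1}" Q "e / M"] e M by auto
    have pc: "continuous_on {0..1} (\<lambda>x. p (cos (pi * x)))" and pz: "integral {0..1} (\<lambda>x. D x * p (cos (pi * x))) = 0"
      using Vpoly[OF p(1) V1] unfolding V_def by (auto dest: spec[of _ 0])
    have "integral {0..1} (\<lambda>x. D x * D x) = integral {0..1} (\<lambda>x. D x * (D x - p (cos (pi * x))) + D x * p (cos (pi * x)))"
      by (simp add: algebra_simps)
    also have "\<dots> = integral {0..1} (\<lambda>x. D x * (D x - p (cos (pi * x))))"
      using pz by (subst Henstock_Kurzweil_Integration.integral_add)
        (auto intro!: integrable_continuous_interval continuous_on_mult continuous_on_diff D pc)
    also have "\<dots> \<le> integral {0..1} (\<lambda>x::real. M * (e / M))"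
    proof (rule integral_le)
      fix x :: real assume x: "x \<in> {0..1}"
      have "Q (cos (pi * x)) = D x" using x by (simp add: Q_def arccos_cos)
      hence "\<bar>D x - p (cos (pi * x))\<bar> < e / M" using p(2)[of "cos (pi * x)"] by simp
      hence "\<bar>D x\<bar> * \<bar>D x - p (cos (pi * x))\<bar> \<le> M * (e / M)" using M x by (intro mult_mono) auto
      thus "D x * (D x - p (cos (pi * x))) \<le> M * (e / M)" by (metis abs_ge_self abs_mult order_trans)
    qed (auto intro!: integrable_continuous_interval continuous_on_mult continuous_on_diff D pc)
    also have "\<dots> = e" using M by simp
    finally show ?thesis .
  qed
  have cDD: "continuous_on {0..1} (\<lambda>x. D x * D x)" by (intro continuous_on_mult D)
  have "integral {0..1} (\<lambda>x. D x * D x) \<le> 0"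
    by (rule field_le_epsilon) (simp add: bd)
  moreover have "integral {0..1} (\<lambda>x. D x * D x) \<ge> 0"
    by (intro integral_nonneg integrable_continuous_interval cDD) simp
  ultimately have "integral {0..1} (\<lambda>x. D x * D x) = 0" by simp
  hence "D x * D x = 0"
    using integral_eq_0_iff[OF cDD] x by simp
  thus ?thesis by simp
qed

lemma integral_cos_pi:
  fixes k :: int
  shows "((\<lambda>x. cos (pi * of_int k * x)) has_integral (if k = 0 then 1 else 0)) {0..1}"
proof (cases "k = 0")
  case True
  thus ?thesis using has_integral_const_real[of "1::real" 0 1] by simp
next
  case False
  have "((\<lambda>x. cos (pi * of_int k * x)) has_integral (sin (pi * of_int k * 1) / (pi * of_int k) - sin (pi * of_int k * 0) / (pi * of_int k))) {0..1}"
    by (rule fundamental_theorem_of_calculus)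
       (use False in \<open>auto intro!: derivative_eq_intros simp flip: has_real_derivative_iff_has_vector_derivative\<close>)
  moreover have "sin (pi * of_int k) = 0" using sin_int_times_real[of k] by (simp add: sin_times_pi_eq_0 mult.commute)
  ultimately show ?thesis using False by simp
qed

lemma integral_cosh_cos:
  assumes "t > 0"
  shows "((\<lambda>x. cosh (t * x) * cos (pi * real n * x)) has_integral (t * sinh t * (-1) ^ n / (t\<^sup>2 + pi\<^sup>2 * (real n)\<^sup>2))) {0..1}"
proof -
  define c where "c = pi * real n"
  have pos: "t\<^sup>2 + c\<^sup>2 > 0" using assms by (simp add: add_pos_nonneg)
  define P where "P = (\<lambda>x. (t * sinh (t * x) * cos (c * x) + c * cosh (t * x) * sin (c * x)) / (t\<^sup>2 + c\<^sup>2))"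
  have "((\<lambda>x. cosh (t * x) * cos (c * x)) has_integral P 1 - P 0) {0..1}"
  proof (rule fundamental_theorem_of_calculus)
    fix x :: real assume "x \<in> {0..1}"
    have "(P has_real_derivative ((t * (t * cosh (t * x)) * cos (c * x) - t * sinh (t * x) * (c * sin (c * x))
       + (c * (t * sinh (t * x)) * sin (c * x) + c * cosh (t * x) * (c * cos (c * x)))) / (t\<^sup>2 + c\<^sup>2))) (at x within {0..1})"
      unfolding P_def by (rule DERIV_cdivide) (auto intro!: derivative_eq_intros simp: algebra_simps)
    also have "(t * (t * cosh (t * x)) * cos (c * x) - t * sinh (t * x) * (c * sin (c * x))
       + (c * (t * sinh (t * x)) * sin (c * x) + c * cosh (t * x) * (c * cos (c * x)))) = (t\<^sup>2 + c\<^sup>2) * (cosh (t * x) * cos (c * x))"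
      by (simp add: algebra_simps power2_eq_square)
    finally show "(P has_vector_derivative cosh (t * x) * cos (c * x)) (at x within {0..1})"
      using pos assms by (simp add: has_real_derivative_iff_has_vector_derivative)
  qed auto
  moreover have "cos c = (-1) ^ n" "sin c = 0" using cos_npi[of n] sin_npi[of n] by (auto simp: c_def mult.commute)
  ultimately show ?thesis by (simp add: P_def c_def power_mult_distrib mult_ac)
qed

lemma summable_pf: "summable (\<lambda>n. 2 * t / (t\<^sup>2 + pi\<^sup>2 * (real (Suc n))\<^sup>2))" if "t > 0"
proof (rule summable_comparison_test')
  show "summable (\<lambda>n. 2 * t * (1 / (real (Suc n))\<^sup>2))"
    using inverse_squares_sums by (intro summable_mult) (simp add: sums_iff add_ac)
  show "norm (2 * t / (t\<^sup>2 + pi\<^sup>2 * (real (Suc n))\<^sup>2)) \<le> 2 * t * (1 / (real (Suc n))\<^sup>2)" for n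
  proof -
    have "1 * (real (Suc n))\<^sup>2 \<le> pi\<^sup>2 * (real (Suc n))\<^sup>2"
      by (intro mult_right_mono) (use pi_ge_two in \<open>auto simp: one_le_power\<close>)
    hence "(real (Suc n))\<^sup>2 \<le> t\<^sup>2 + pi\<^sup>2 * (real (Suc n))\<^sup>2" by (simp del: of_nat_Suc add: add_increasing)
    hence "2 * t / (t\<^sup>2 + pi\<^sup>2 * (real (Suc n))\<^sup>2) \<le> 2 * t / (real (Suc n))\<^sup>2"
      using that by (intro divide_left_mono mult_pos_pos) (auto simp: add_pos_nonneg simp del: of_nat_Suc)
    thus ?thesis using that by (simp add: add_nonneg_nonneg)
  qed
qed

text \<open>Both sides are continuous in \<open>x\<close> on [0,1] and have the same cosine
  coefficients, so completeness of the cosines makes them equal. The end point \<open>x = 1\<close>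
  is included because it yields the expansion of the hyperbolic cotangent.\<close>

lemma cosh_partial_fractions:
  assumes t: "t > 0" and x: "x \<in> {0..1}"
  shows "(\<lambda>n. (-1) ^ Suc n * cos (pi * real (Suc n) * x) * (2 * t / (t\<^sup>2 + pi\<^sup>2 * (real (Suc n))\<^sup>2)))
           sums (cosh (t * x) / sinh t - 1 / t)"
proof -
  define a where "a = (\<lambda>n. 2 * t / (t\<^sup>2 + pi\<^sup>2 * (real (Suc n))\<^sup>2))"
  define f where "f = (\<lambda>n x. (-1) ^ Suc n * cos (pi * real (Suc n) * x) * a n)"
  have a: "summable a" "a n \<ge> 0" for n using summable_pf[OF t] t by (auto simp: a_def)
  have fle: "norm (f n x) \<le> a n" for n x
  proof -
    have "\<bar>cos (pi * real (Suc n) * x)\<bar> * a n \<le> 1 * a n" by (intro mult_right_mono a) auto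
    thus ?thesis using a(2)[of n] by (simp add: f_def abs_mult del: of_nat_Suc)
  qed
  have fsum: "summable (\<lambda>n. f n x)" for x
    by (rule summable_comparison_test'[OF a(1)]) (use fle in auto)
  have fcont: "continuous_on A (f n)" for A n unfolding f_def by (intro continuous_intros)
  define D where "D = (\<lambda>x. cosh (t * x) / sinh t - 1 / t - (\<Sum>n. f n x))"
  have sh: "sinh t > 0" using t by simp
  have contD: "continuous_on {0..1} D"
    unfolding D_def by (intro continuous_intros continuous_on_suminf[OF fcont fle a(1)]) (use sh in auto)
  have "D x = 0"
  proof (rule cosine_orthogonal_imp_zero[OF contD _ x])
    fix m :: nat
    \<comment> \<open>The cosine coefficient of the series at frequency \<open>m\<close>. The term
      with index \<open>n\<close> has frequency \<open>n + 1\<close>, hence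
      \<open>a (m - 1)\<close>; the factor 1/2 is the mean of the squared cosine, and no term has
      frequency 0.\<close>
    define J where "J = (if m = 0 then 0 else (-1) ^ m * a (m - 1) / 2)"
    have ul: "uniform_limit {0..1} (\<lambda>N x. \<Sum>n<N. f n x * cos (pi * real m * x)) (\<lambda>x. \<Sum>n. f n x * cos (pi * real m * x)) sequentially"
    proof (rule Weierstrass_m_test[OF _ a(1)])
      show "norm (f n x * cos (pi * real m * x)) \<le> a n" for n x
        using mult_mono[OF fle[of n x] abs_cos_le_one[of "pi * real m * x"]] a(2)[of n] by (simp add: abs_mult)
    qed
    have c: "continuous_on {0..1} (\<lambda>x. \<Sum>n<N. f n x * cos (pi * real m * x))" for N
      by (intro continuous_intros fcont)
    obtain I J' where IJ: "\<And>N. ((\<lambda>x. \<Sum>n<N. f n x * cos (pi * real m * x)) has_integral I N) {0..1}"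
      "((\<lambda>x. \<Sum>n. f n x * cos (pi * real m * x)) has_integral J') {0..1}" "I \<longlonglongrightarrow> J'"
      by (rule uniform_limit_integral[OF ul c sequentially_bot], rule that)
    have 1: "((\<lambda>x. f n x * cos (pi * real m * x)) has_integral (if Suc n = m then J else 0)) {0..1}" for n
    proof -
      have "((\<lambda>x. (-1) ^ Suc n * a n / 2 * (cos (pi * of_int (int (Suc n) - int m) * x) + cos (pi * of_int (int (Suc n) + int m) * x)))
         has_integral (-1) ^ Suc n * a n / 2 * ((if int (Suc n) - int m = 0 then 1 else 0) + (if int (Suc n) + int m = 0 then 1 else 0))) {0..1}"
        by (intro has_integral_mult_right has_integral_add integral_cos_pi)
      moreover have "(-1) ^ Suc n * a n / 2 * (cos (pi * of_int (int (Suc n) - int m) * x) + cos (pi * of_int (int (Suc n) + int m) * x)) = f n x * cos (pi * real m * x)" for x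
      proof -
        have h: "cos (pi * real_of_int (int (Suc n) - int m) * x) + cos (pi * real_of_int (int (Suc n) + int m) * x) = 2 * (cos (pi * real (Suc n) * x) * cos (pi * real m * x))"
        proof -
          have "pi * real_of_int (int (Suc n) - int m) * x = pi * real (Suc n) * x - pi * real m * x"
            "pi * real_of_int (int (Suc n) + int m) * x = pi * real (Suc n) * x + pi * real m * x"
            by (simp_all add: algebra_simps)
          thus ?thesis by (simp only: cos_times_cos) simp
        qed
        show ?thesis unfolding h f_def by simp
      qed
      ultimately show ?thesis by (auto simp: J_def)
    qed
    have "I N = (\<Sum>n<N. if Suc n = m then J else 0)" for N
      using has_integral_unique[OF IJ(1)[of N] has_integral_sum[of "{..<N}", OF _ 1]] by simp
    moreover have "(\<Sum>n<N. if Suc n = m then J else 0) = J" if "N \<ge> m" for N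
    proof (cases m)
      case 0 thus ?thesis by (simp add: J_def)
    next
      case (Suc k)
      have "(\<Sum>n<N. if Suc n = m then J else 0) = (\<Sum>n<N. if n = k then J else 0)" by (intro sum.cong) (auto simp: Suc)
      also have "\<dots> = J" using that Suc by (subst sum.delta) auto
      finally show ?thesis .
    qed
    ultimately have "eventually (\<lambda>N. I N = J) sequentially" by (auto intro: eventually_sequentiallyI[of m])
    hence "I \<longlonglongrightarrow> J" by (rule tendsto_eventually)
    hence J: "J' = J" using IJ(3) LIMSEQ_unique by blast
    have "(\<Sum>n. f n x * cos (pi * real m * x)) = (\<Sum>n. f n x) * cos (pi * real m * x)" for x
      using suminf_mult2[OF fsum] by simp
    with IJ(2) J have i1: "((\<lambda>x. (\<Sum>n. f n x) * cos (pi * real m * x)) has_integral J) {0..1}" by simp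
    have i2: "((\<lambda>x. cosh (t * x) * cos (pi * real m * x) / sinh t) has_integral (t * sinh t * (-1) ^ m / (t\<^sup>2 + pi\<^sup>2 * (real m)\<^sup>2)) / sinh t) {0..1}"
      by (intro has_integral_divide integral_cosh_cos t)
    have i3: "((\<lambda>x. 1 / t * cos (pi * of_int (int m) * x)) has_integral 1 / t * (if int m = 0 then 1 else 0)) {0..1}"
      by (intro has_integral_mult_right integral_cos_pi)
    have "((\<lambda>x. D x * cos (pi * real m * x)) has_integral (t * sinh t * (-1) ^ m / (t\<^sup>2 + pi\<^sup>2 * (real m)\<^sup>2)) / sinh t - 1 / t * (if int m = 0 then 1 else 0) - J) {0..1}"
      using has_integral_diff[OF has_integral_diff[OF i2 i3] i1] by (simp add: D_def algebra_simps)
    moreover have "(t * sinh t * (-1) ^ m / (t\<^sup>2 + pi\<^sup>2 * (real m)\<^sup>2)) / sinh t - 1 / t * (if int m = 0 then 1 else 0) - J = 0"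
    proof (cases m)
      case 0
      thus ?thesis using t sh by (simp add: J_def power2_eq_square)
    next
      case (Suc k)
      define q where "q = t\<^sup>2 + pi\<^sup>2 * (real m)\<^sup>2"
      have "a k = 2 * t / q" by (simp add: a_def Suc q_def)
      hence "J = (-1) ^ m * t / q" by (simp add: J_def Suc)
      moreover have "(t * sinh t * (-1) ^ m / q) / sinh t = (-1) ^ m * t / q" using sh by simp
      ultimately show ?thesis using Suc by (simp add: q_def)
    qed
    ultimately show "integral {0..1} (\<lambda>x. D x * cos (pi * real m * x)) = 0" by (simp add: integral_unique)
  qed
  thus ?thesis using summable_sums[OF fsum[of x]] by (simp add: D_def f_def a_def)
qed

section \<open>Mellin transforms of the kernel\<close>

text \<open>Integrals with values in \<open>ennreal\<close>, so that monotone convergence exchanges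
  sums and integrals without integrability conditions; integrability is read off afterwards from
  finiteness.\<close>

abbreviation nnint :: "real set \<Rightarrow> (real \<Rightarrow> real) \<Rightarrow> ennreal" where
  "nnint S f \<equiv> (\<integral>\<^sup>+t. ennreal (f t) * indicator S t \<partial>lborel)"

lemma nnint_cong: "(\<And>t. t \<in> S \<Longrightarrow> f t = g t) \<Longrightarrow> nnint S f = nnint S g"
  by (intro nn_integral_cong) (auto simp: indicator_def)

lemma nnint_has_integral:
  assumes "\<And>t. t \<in> S \<Longrightarrow> f t \<ge> 0" "(f has_integral I) S"
  shows "nnint S f = ennreal I"
  using assms by (rule nn_integral_has_integral_lebesgue')

lemma nnint_sums:
  assumes [measurable]: "S \<in> sets borel" "\<And>n. f n \<in> borel_measurable borel"
    and nonneg: "\<And>n t. t \<in> S \<Longrightarrow> f n t \<ge> 0" and sums: "\<And>t. t \<in> S \<Longrightarrow> (\<lambda>n. f n t) sums F t"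
    and a: "\<And>n. nnint S (f n) = ennreal (a n)" "\<And>n. a n \<ge> 0" "summable a"
  shows "nnint S F = ennreal (\<Sum>n. a n)"
proof -
  have "nnint S F = (\<integral>\<^sup>+t. (\<Sum>n. ennreal (f n t) * indicator S t) \<partial>lborel)"
  proof (intro nn_integral_cong)
    fix t
    show "ennreal (F t) * indicator S t = (\<Sum>n. ennreal (f n t) * indicator S t)"
    proof (cases "t \<in> S")
      case True
      hence "(\<Sum>n. ennreal (f n t)) = ennreal (F t)"
        by (intro suminf_ennreal_eq nonneg sums)
      thus ?thesis using True by simp
    qed auto
  qed
  also have "\<dots> = (\<Sum>n. nnint S (f n))"
    by (intro nn_integral_suminf) measurable
  also have "\<dots> = (\<Sum>n. ennreal (a n))" by (simp only: a(1))
  also have "\<dots> = ennreal (\<Sum>n. a n)"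
    by (intro suminf_ennreal2 a)
  finally show ?thesis .
qed

lemma nnint_add:
  assumes [measurable]: "S \<in> sets borel" "f \<in> borel_measurable borel" "g \<in> borel_measurable borel"
    and "\<And>t. t \<in> S \<Longrightarrow> f t \<ge> 0" "\<And>t. t \<in> S \<Longrightarrow> g t \<ge> 0"
  shows "nnint S (\<lambda>t. f t + g t) = nnint S f + nnint S g"
proof -
  have "nnint S (\<lambda>t. f t + g t) = (\<integral>\<^sup>+t. ennreal (f t) * indicator S t + ennreal (g t) * indicator S t \<partial>lborel)"
    using assms by (intro nn_integral_cong) (auto simp: indicator_def ennreal_plus)
  also have "\<dots> = nnint S f + nnint S g" by (intro nn_integral_add) auto
  finally show ?thesis .
qed

lemma mellin_exp:
  assumes c: "c > 0" and s: "s > 0"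
  shows "nnint {0<..} (\<lambda>t. t powr (s - 1) * exp (- c * t)) = ennreal (Gamma s * c powr (- s))"
proof -
  have "ennreal (Gamma s) = (\<integral>\<^sup>+t. ennreal (indicator {0..} t * t powr (s - 1) / exp t) \<partial>lborel)"
    by (rule Gamma_conv_nn_integral_real[OF s])
  also have "\<dots> = \<bar>c\<bar> * (\<integral>\<^sup>+t. ennreal (indicator {0..} (0 + c * t) * (0 + c * t) powr (s - 1) / exp (0 + c * t)) \<partial>lborel)"
    by (rule nn_integral_real_affine) (use c in \<open>auto intro!: measurable_compose[OF _ measurable_ennreal]\<close>)
  also have "(\<integral>\<^sup>+t. ennreal (indicator {0..} (0 + c * t) * (0 + c * t) powr (s - 1) / exp (0 + c * t)) \<partial>lborel) =
     (\<integral>\<^sup>+t. ennreal (c powr (s - 1)) * (ennreal (t powr (s - 1) * exp (- c * t)) * indicator {0<..} t) \<partial>lborel)"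
  proof (intro nn_integral_cong)
    fix t :: real
    consider "t < 0" | "t = 0" | "t > 0" by linarith
    thus "ennreal (indicator {0..} (0 + c * t) * (0 + c * t) powr (s - 1) / exp (0 + c * t)) =
      ennreal (c powr (s - 1)) * (ennreal (t powr (s - 1) * exp (- c * t)) * indicator {0<..} t)"
    proof cases
      case 1
      thus ?thesis using c by (simp add: indicator_def zero_le_mult_iff)
    next
      case 3
      thus ?thesis using c
        by (simp add: indicator_def powr_mult exp_minus divide_inverse ennreal_mult[symmetric] mult_ac)
    qed auto
  qed
  also have "\<dots> = ennreal (c powr (s - 1)) * nnint {0<..} (\<lambda>t. t powr (s - 1) * exp (- c * t))"
    by (intro nn_integral_cmult) measurable
  also have "ennreal \<bar>c\<bar> * (ennreal (c powr (s - 1)) * nnint {0<..} (\<lambda>t. t powr (s - 1) * exp (- c * t))) =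
      ennreal (c powr s) * nnint {0<..} (\<lambda>t. t powr (s - 1) * exp (- c * t))"
  proof -
    have "c powr s = c * c powr (s - 1)" using c powr_mult_base[of c "s - 1"] by simp
    thus ?thesis using c by (simp add: ennreal_mult mult.assoc)
  qed
  finally have "ennreal (c powr (- s)) * ennreal (Gamma s) = ennreal (c powr (- s)) * (ennreal (c powr s) * nnint {0<..} (\<lambda>t. t powr (s - 1) * exp (- c * t)))"
    by simp
  also have "\<dots> = nnint {0<..} (\<lambda>t. t powr (s - 1) * exp (- c * t))"
    using c by (simp add: mult.assoc[symmetric] ennreal_mult[symmetric] powr_add[symmetric])
  finally show ?thesis using s by (simp add: ennreal_mult[symmetric] mult.commute Gamma_real_pos less_imp_le)
qed

lemma Beta_reflection:
  fixes s :: real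
  assumes "-1 < s" "s < 1"
  shows "Beta ((1 + s) / 2) ((1 - s) / 2) = pi / cos (pi * s / 2)"
proof -
  have refl: "Gamma x * Gamma (1 - x) = pi / sin (pi * x)" for x :: real
  proof -
    have "complex_of_real (Gamma x * Gamma (1 - x)) = Gamma (of_real x) * Gamma (of_real (1 - x))"
      by (simp only: of_real_mult Gamma_complex_of_real)
    also have "\<dots> = of_real pi / sin (of_real pi * of_real x)"
      by (simp only: of_real_diff of_real_1 Gamma_reflection_complex)
    also have "\<dots> = of_real (pi / sin (pi * x))"
      by (simp only: of_real_divide of_real_mult[symmetric] sin_of_real)
    finally show ?thesis by (simp only: of_real_eq_iff)
  qed
  have "1 - (1 + s) / 2 = (1 - s) / 2" by (simp add: field_simps)
  with refl[of "(1 + s) / 2"] have "Gamma ((1 + s) / 2) * Gamma ((1 - s) / 2) = pi / sin (pi * ((1 + s) / 2))"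
    by simp
  moreover have "sin (pi * ((1 + s) / 2)) = cos (pi * s / 2)"
    by (simp add: sin_cos_eq field_simps)
  ultimately show ?thesis by (simp add: Beta_def add_divide_distrib[symmetric])
qed

text \<open>The substitution \<open>u = t^2 / (t^2 + c^2)\<close> maps the half-line onto the unit
  interval and produces a Beta integral with arguments \<open>(1 + s) / 2\<close> and
  \<open>(1 - s) / 2\<close>; these add up to 1, so the reflection formula evaluates it.\<close>

lemma mellin_rational:
  assumes c: "c > 0" and s: "-1 < s" "s < 1"
  shows "nnint {0<..} (\<lambda>t. t powr s / (t\<^sup>2 + c\<^sup>2)) = ennreal (c powr (s - 1) * pi / (2 * cos (pi * s / 2)))"
proof -
  define f where "f = (\<lambda>u::real. u powr ((1 + s) / 2 - 1) * (1 - u) powr ((1 - s) / 2 - 1))"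
  define g where "g = (\<lambda>t::real. t\<^sup>2 / (t\<^sup>2 + c\<^sup>2))"
  define g' where "g' = (\<lambda>t::real. 2 * t * c\<^sup>2 / (t\<^sup>2 + c\<^sup>2)\<^sup>2)"
  have pos: "t\<^sup>2 + c\<^sup>2 > 0" for t using c by (simp add: add_nonneg_pos)
  have g1: "1 - g t = c\<^sup>2 / (t\<^sup>2 + c\<^sup>2)" for t
  proof -
    have "g t + c\<^sup>2 / (t\<^sup>2 + c\<^sup>2) = 1" using pos[of t] c unfolding g_def add_divide_distrib[symmetric] by simp
    thus ?thesis by linarith
  qed
  have g_ltI: "g t < 1" "g t > 0" if "t > 0" for t using that c pos[of t] by (auto simp: g_def field_simps)
  have inv: "sqrt (g t / (1 - g t)) * c = t" if "t > 0" for t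
  proof -
    have "g t / (1 - g t) = (t / c)\<^sup>2" using pos[of t] unfolding g1 by (simp add: g_def power_divide)
    thus ?thesis using that c by simp
  qed
  have img: "g ` {0<..} = {0<..<1}"
  proof (intro equalityI subsetI)
    fix u :: real assume u: "u \<in> {0<..<1}"
    define t where "t = c * sqrt (u / (1 - u))"
    have t: "t > 0" using u c by (simp add: t_def)
    have "t\<^sup>2 = c\<^sup>2 * (u / (1 - u))" using u by (simp add: t_def power_mult_distrib)
    moreover have "c\<^sup>2 * (u / (1 - u)) + c\<^sup>2 = c\<^sup>2 / (1 - u)" using u by (simp add: field_simps)
    ultimately have "g t = u" using c u by (simp add: g_def)
    thus "u \<in> g ` {0<..}" using t by force
  qed (use g_ltI in auto)
  have B: "(f has_integral Beta ((1 + s) / 2) ((1 - s) / 2)) {0<..<1}"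
    using has_integral_Beta_real[of "(1 + s) / 2" "(1 - s) / 2"] s
    by (simp add: f_def has_integral_Icc_iff_Ioo)
  have fnn: "f u \<ge> 0" for u by (simp add: f_def)
  have "f absolutely_integrable_on {0<..<1}"
    using B fnn by (intro nonnegative_absolutely_integrable_1) (auto simp: integrable_on_def)
  hence "(\<lambda>t. \<bar>g' t\<bar> * f (g t)) absolutely_integrable_on {0<..} \<and> integral {0<..} (\<lambda>t. \<bar>g' t\<bar> * f (g t)) = Beta ((1 + s) / 2) ((1 - s) / 2)"
  proof (subst has_absolute_integral_change_of_variables_1'[where g = g])
    show "inj_on g {0<..}" by (rule inj_on_inverseI[where g = "\<lambda>u. sqrt (u / (1 - u)) * c"]) (use inv in auto)
    show "(g has_field_derivative g' t) (at t within {0<..})" if "t \<in> {0<..}" for t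
    proof -
      have "(g has_field_derivative (2 * t * (t\<^sup>2 + c\<^sup>2) - t\<^sup>2 * (2 * t)) / ((t\<^sup>2 + c\<^sup>2) * (t\<^sup>2 + c\<^sup>2))) (at t within {0<..})"
        unfolding g_def using pos[of t] by (auto intro!: derivative_eq_intros)
      also have "(2 * t * (t\<^sup>2 + c\<^sup>2) - t\<^sup>2 * (2 * t)) / ((t\<^sup>2 + c\<^sup>2) * (t\<^sup>2 + c\<^sup>2)) = g' t"
        by (simp add: g'_def power2_eq_square algebra_simps)
      finally show ?thesis .
    qed
  qed (use B img in \<open>auto simp: integral_unique\<close>)
  hence "((\<lambda>t. \<bar>g' t\<bar> * f (g t)) has_integral Beta ((1 + s) / 2) ((1 - s) / 2)) {0<..}"
    by (auto simp: has_integral_iff set_lebesgue_integral_eq_integral)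
  moreover have eq: "\<bar>g' t\<bar> * f (g t) = 2 * c powr (1 - s) * (t powr s / (t\<^sup>2 + c\<^sup>2))" if "t > 0" for t
  proof -
    define q where "q = t\<^sup>2 + c\<^sup>2"
    have q: "q > 0" using pos by (simp add: q_def)
    have "f (g t) = (t\<^sup>2 / q) powr ((s - 1) / 2) * (c\<^sup>2 / q) powr (- (s + 1) / 2)"
    proof -
      have "(1 + s) / 2 - 1 = (s - 1) / 2" "(1 - s) / 2 - 1 = - (s + 1) / 2" by (simp_all add: field_simps)
      thus ?thesis unfolding f_def g1 by (simp only: g_def q_def)
    qed
    also have "\<dots> = t powr (s - 1) * c powr (- (s + 1)) * (q powr (- ((s - 1) / 2)) * q powr ((s + 1) / 2))"
    proof -
      have sq: "(x\<^sup>2) powr (y / 2) = x powr y" if "x > 0" for x y :: real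
        using powr_powr[of x 2 "y / 2"] that by simp
      have "(t\<^sup>2 / q) powr ((s - 1) / 2) * (c\<^sup>2 / q) powr (- (s + 1) / 2) =
         (t powr (s - 1) / q powr ((s - 1) / 2)) * (c powr (- (s + 1)) / q powr (- (s + 1) / 2))"
        using that c q by (simp only: powr_divide sq zero_le_power2 less_imp_le)
      moreover have "q powr (- (s + 1) / 2) = inverse (q powr ((s + 1) / 2))" "q powr (- ((s - 1) / 2)) = inverse (q powr ((s - 1) / 2))"
        by (simp_all only: minus_divide_left[symmetric] powr_minus)
      ultimately show ?thesis by (simp only: divide_inverse inverse_inverse_eq mult.assoc mult.left_commute mult.commute)
    qed
    also have "q powr (- ((s - 1) / 2)) * q powr ((s + 1) / 2) = q"
      using q by (simp add: powr_add[symmetric] field_simps)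
    finally have fg: "f (g t) = t powr (s - 1) * c powr (- (s + 1)) * q" .
    have "\<bar>g' t\<bar> = 2 * t * c\<^sup>2 / (q * q)"
      using that by (simp add: g'_def q_def power2_eq_square abs_mult)
    hence "\<bar>g' t\<bar> * f (g t) = 2 * (t * t powr (s - 1)) * (c\<^sup>2 * c powr (- (s + 1))) / q"
      using q unfolding fg by simp
    also have "t * t powr (s - 1) = t powr s" using that by (simp add: powr_mult_base)
    also have "c\<^sup>2 * c powr (- (s + 1)) = c powr (1 - s)" using c by (simp add: powr_add[symmetric] flip: powr_numeral)
    finally show ?thesis by (simp add: q_def)
  qed
  ultimately have "((\<lambda>t. 2 * c powr (1 - s) * (t powr s / (t\<^sup>2 + c\<^sup>2))) has_integral Beta ((1 + s) / 2) ((1 - s) / 2)) {0<..}"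
    by (subst has_integral_cong[OF eq[symmetric]]) auto
  hence "((\<lambda>t. inverse (2 * c powr (1 - s)) * (2 * c powr (1 - s) * (t powr s / (t\<^sup>2 + c\<^sup>2)))) has_integral
     inverse (2 * c powr (1 - s)) * Beta ((1 + s) / 2) ((1 - s) / 2)) {0<..}"
    by (rule has_integral_mult_right)
  moreover have "inverse (2 * c powr (1 - s)) * (2 * c powr (1 - s) * y) = y" for y using c by simp
  moreover have "inverse (2 * c powr (1 - s)) * Beta ((1 + s) / 2) ((1 - s) / 2) = c powr (s - 1) * pi / (2 * cos (pi * s / 2))"
  proof -
    have h: "c powr (s - 1) = inverse (c powr (1 - s))" using powr_minus[of c "1 - s"] by simp
    show ?thesis unfolding Beta_reflection[OF s] h by (simp add: field_simps)
  qed
  ultimately have "((\<lambda>t. t powr s / (t\<^sup>2 + c\<^sup>2)) has_integral c powr (s - 1) * pi / (2 * cos (pi * s / 2))) {0<..}"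
    by (simp only:)
  thus ?thesis by (intro nnint_has_integral) (auto simp: pos less_imp_le)
qed

text \<open>In the partial fractions of the kernel the summand 1 comes from the hyperbolic cotangent
  and the cosine from \<open>cosh (\<beta> * t) / sinh t\<close>.\<close>

definition coef :: "real \<Rightarrow> nat \<Rightarrow> real" where
  "coef \<beta> n = 1 + (-1) ^ n * cos (pi * real n * \<beta>)"

definition kern :: "real \<Rightarrow> real \<Rightarrow> real" where
  "kern \<beta> t = (cosh t / sinh t - 1) / 2 + cosh (\<beta> * t) / (2 * sinh t)"

text \<open>Near 0 the kernel behaves like \<open>1 / t - 1 / 2\<close>. Once this is removed the
  rest is O(t), so its Mellin integral converges at 0 for \<open>s > -1\<close>; the price is the
  constant limit 1/2 at infinity, which forces \<open>s < 0\<close> there.\<close>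

definition kern_reg :: "real \<Rightarrow> real \<Rightarrow> real" where
  "kern_reg \<beta> t = kern \<beta> t - 1 / t + 1 / 2"

definition dirichlet_real :: "real \<Rightarrow> real \<Rightarrow> real" where
  "dirichlet_real \<beta> s = (\<Sum>n. (2 * real n + 2) powr (- s) + (2 * real n + (1 + \<beta>)) powr (- s) / 2 + (2 * real n + (1 - \<beta>)) powr (- s) / 2)"

lemma abs_neg_one_cos: "\<bar>(-1) ^ n * cos x\<bar> \<le> (1::real)"
  by (simp add: abs_mult power_abs)

lemma coef_nonneg: "0 \<le> coef \<beta> n" and coef_le: "coef \<beta> n \<le> 2"
  using abs_neg_one_cos[of n "pi * real n * \<beta>"] by (auto simp: coef_def abs_le_iff)

text \<open>The mean of \<open>cosh_partial_fractions\<close> at \<open>x = \<beta>\<close> and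
  \<open>x = 1\<close>; at \<open>x = 1\<close> the two alternating signs cancel.\<close>

lemma kern_reg_sums:
  assumes t: "t > 0" and \<beta>: "\<beta> \<in> {0..1}"
  shows "(\<lambda>n. coef \<beta> (Suc n) * (t / (t\<^sup>2 + (pi * real (Suc n))\<^sup>2))) sums kern_reg \<beta> t"
proof -
  have "(\<lambda>n. ((-1) ^ Suc n * cos (pi * real (Suc n) * \<beta>) * (2 * t / (t\<^sup>2 + pi\<^sup>2 * (real (Suc n))\<^sup>2))
     + (-1) ^ Suc n * cos (pi * real (Suc n) * 1) * (2 * t / (t\<^sup>2 + pi\<^sup>2 * (real (Suc n))\<^sup>2))) / 2)
     sums (((cosh (t * \<beta>) / sinh t - 1 / t) + (cosh (t * 1) / sinh t - 1 / t)) / 2)"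
    by (intro sums_divide sums_add cosh_partial_fractions t \<beta>) auto
  moreover have "((-1) ^ Suc n * cos (pi * real (Suc n) * \<beta>) * (2 * t / (t\<^sup>2 + pi\<^sup>2 * (real (Suc n))\<^sup>2))
     + (-1) ^ Suc n * cos (pi * real (Suc n) * 1) * (2 * t / (t\<^sup>2 + pi\<^sup>2 * (real (Suc n))\<^sup>2))) / 2 =
     coef \<beta> (Suc n) * (t / (t\<^sup>2 + (pi * real (Suc n))\<^sup>2))" for n
  proof -
    have "cos (pi * real (Suc n) * 1) = (-1) ^ Suc n" using cos_npi[of "Suc n"] by (simp add: mult.commute)
    moreover have "(-1) ^ Suc n * (-1::real) ^ Suc n = 1" by (simp flip: power_mult_distrib)
    moreover have "(A * c * (2 * t / q) + 1 * (2 * t / q)) / 2 = (1 + A * c) * (t / q)" for A c q :: real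
      by (simp add: algebra_simps add_divide_distrib)
    ultimately show ?thesis by (simp only: coef_def power_mult_distrib)
  qed
  moreover have "((cosh (t * \<beta>) / sinh t - 1 / t) + (cosh (t * 1) / sinh t - 1 / t)) / 2 = kern_reg \<beta> t"
    by (simp add: kern_reg_def kern_def field_simps)
  ultimately show ?thesis by (simp only:)
qed

lemma kern_reg_nonneg: "t > 0 \<Longrightarrow> \<beta> \<in> {0..1} \<Longrightarrow> kern_reg \<beta> t \<ge> 0"
  by (rule sums_le[OF _ sums_zero kern_reg_sums])
     (auto intro!: mult_nonneg_nonneg divide_nonneg_nonneg coef_nonneg simp del: of_nat_Suc times_divide_eq_right)

lemma kern_reg_le:
  assumes t: "t > 0" and \<beta>: "\<beta> \<in> {0..1}"
  shows "kern_reg \<beta> t \<le> 2 * t"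
proof -
  have "kern_reg \<beta> t \<le> 2 * t / pi\<^sup>2 * (pi\<^sup>2 / 6)"
  proof (rule sums_le[OF _ kern_reg_sums[OF t \<beta>]])
    show "(\<lambda>n. 2 * t / pi\<^sup>2 * (1 / (real (Suc n))\<^sup>2)) sums (2 * t / pi\<^sup>2 * (pi\<^sup>2 / 6))"
      using inverse_squares_sums by (intro sums_mult) (simp add: add_ac)
    show "coef \<beta> (Suc n) * (t / (t\<^sup>2 + (pi * real (Suc n))\<^sup>2)) \<le> 2 * t / pi\<^sup>2 * (1 / (real (Suc n))\<^sup>2)" for n
    proof -
      have "t / (t\<^sup>2 + (pi * real (Suc n))\<^sup>2) \<le> t / (pi * real (Suc n))\<^sup>2"
        using t by (intro divide_left_mono) (auto intro!: mult_pos_pos add_nonneg_pos simp del: of_nat_Suc)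
      hence "coef \<beta> (Suc n) * (t / (t\<^sup>2 + (pi * real (Suc n))\<^sup>2)) \<le> 2 * (t / (pi * real (Suc n))\<^sup>2)"
        using t by (intro mult_mono coef_le) (auto simp del: of_nat_Suc)
      thus ?thesis by (simp add: power_mult_distrib del: of_nat_Suc)
    qed
  qed
  also have "\<dots> \<le> 2 * t" using t by simp
  finally show ?thesis .
qed

text \<open>A geometric series in \<open>exp (-2 * t)\<close>. Its exponents are the bases of the
  Dirichlet series of \<open>E\<close>, which links the kernel with
  \<open>dirichlet_real\<close>.\<close>

lemma kern_sums:
  assumes t: "t > 0"
  shows "(\<lambda>n. exp (- (2 * real n + 2) * t) + exp (- (2 * real n + (1 + \<beta>)) * t) / 2 + exp (- (2 * real n + (1 - \<beta>)) * t) / 2) sums kern \<beta> t"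
proof -
  define y where "y = exp (- t)"
  have y: "y > 0" "y < 1" using t by (auto simp: y_def)
  hence y2: "y\<^sup>2 < 1" "y\<^sup>2 > 0" by (auto simp: power_less_one_iff)
  define b where "b = exp (\<beta> * t)"
  have b: "b > 0" by (simp add: b_def)
  have ei: "exp t = inverse y" "exp (- t) = y" "exp (- (\<beta> * t)) = inverse b" "exp (\<beta> * t) = b"
    by (simp_all add: y_def b_def exp_minus)
  have "(\<lambda>n. (y\<^sup>2 + y * (inverse b + b) / 2) * (y\<^sup>2) ^ n) sums ((y\<^sup>2 + y * (inverse b + b) / 2) * (1 / (1 - y\<^sup>2)))"
    using y2 by (intro sums_mult geometric_sums) auto
  moreover have "(y\<^sup>2 + y * (inverse b + b) / 2) * (y\<^sup>2) ^ n =
     exp (- (2 * real n + 2) * t) + exp (- (2 * real n + (1 + \<beta>)) * t) / 2 + exp (- (2 * real n + (1 - \<beta>)) * t) / 2" for n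
  proof -
    have p: "(y\<^sup>2) ^ n = exp (- (2 * real n) * t)"
      by (simp add: y_def flip: exp_of_nat_mult power_mult)
    have "exp (- (2 * real n + 2) * t) = (y\<^sup>2) ^ n * (y * y)"
      "exp (- (2 * real n + (1 + \<beta>)) * t) = (y\<^sup>2) ^ n * (y * inverse b)"
      "exp (- (2 * real n + (1 - \<beta>)) * t) = (y\<^sup>2) ^ n * (y * b)"
      unfolding p unfolding ei[symmetric] exp_minus[symmetric] exp_add[symmetric] by (simp_all add: algebra_simps)
    thus ?thesis by (simp add: algebra_simps power2_eq_square)
  qed
  moreover have "(y\<^sup>2 + y * (inverse b + b) / 2) * (1 / (1 - y\<^sup>2)) = kern \<beta> t"
  proof -
    have c: "cosh t = (1 + y\<^sup>2) / (2 * y)" "sinh t = (1 - y\<^sup>2) / (2 * y)" "cosh (\<beta> * t) = (inverse b + b) / 2"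
      using y by (simp_all add: cosh_field_def sinh_field_def ei field_simps power2_eq_square)
    have "cosh t / sinh t = (1 + y\<^sup>2) / (1 - y\<^sup>2)" using y y2 unfolding c by simp
    moreover have "cosh (\<beta> * t) / (2 * sinh t) = (inverse b + b) / 2 * y / (1 - y\<^sup>2)" using y y2 unfolding c by simp
    hence "cosh (\<beta> * t) / (2 * sinh t) = y * (inverse b + b) / 2 / (1 - y\<^sup>2)" by (simp add: mult.commute)
    moreover have "((1 + y\<^sup>2) / (1 - y\<^sup>2) - 1) / 2 = y\<^sup>2 / (1 - y\<^sup>2)" using y2 by (simp add: field_simps)
    ultimately show ?thesis by (simp only: kern_def add_divide_distrib[symmetric] times_divide_eq_right mult_1_right)
  qed
  ultimately show ?thesis by simp
qed

lemma kern_nonneg: "t > 0 \<Longrightarrow> kern \<beta> t \<ge> 0"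
  by (rule sums_le[OF _ sums_zero kern_sums]) (auto intro!: add_nonneg_nonneg)

lemma continuous_on_kern: "continuous_on {0<..} (kern \<beta>)"
  unfolding kern_def by (intro continuous_intros) auto

lemma continuous_on_kern_reg: "continuous_on {0<..} (kern_reg \<beta>)"
  unfolding kern_reg_def[abs_def] by (intro continuous_intros continuous_on_kern) auto

lemma measurable_kern [measurable]: "kern \<beta> \<in> borel_measurable borel"
  unfolding kern_def[abs_def] sinh_field_def cosh_field_def by measurable

lemma measurable_kern_reg [measurable]: "kern_reg \<beta> \<in> borel_measurable borel"
  unfolding kern_reg_def[abs_def] by measurable

lemma summable_shift2: "a > 0 \<Longrightarrow> s > 1 \<Longrightarrow> summable (\<lambda>n. (2 * real n + a) powr (- s))"
proof -
  assume a: "a > 0" and s: "s > 1"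
  have "summable (\<lambda>n. 2 powr (- s) * norm ((of_nat n + complex_of_real (a / 2)) powr (- of_real s)))"
    using summable_norm_hterm[of "a / 2" "of_real s"] a s by (intro summable_mult) auto
  moreover have "2 powr (- s) * norm ((of_nat n + complex_of_real (a / 2)) powr (- of_real s)) = (2 * real n + a) powr (- s)" for n
    using norm_hterm[of "a / 2" n "of_real s"] a by (simp add: powr_mult[symmetric] algebra_simps)
  ultimately show ?thesis by (simp only:)
qed

lemma dirichlet_real_summable:
  assumes "s > 1" "0 \<le> \<beta>" "\<beta> < 1"
  shows "summable (\<lambda>n. (2 * real n + 2) powr (- s) + (2 * real n + (1 + \<beta>)) powr (- s) / 2 + (2 * real n + (1 - \<beta>)) powr (- s) / 2)"
  using assms by (intro summable_add summable_divide summable_shift2) auto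

lemma cos_half_pos:
  fixes s :: real
  assumes "-1 < s" "s < 1"
  shows "cos (pi * s / 2) > 0"
  using mult_strict_left_mono[of "-1" s pi] mult_strict_left_mono[of s 1 pi] assms
  by (intro cos_gt_zero_pi) auto

lemma mellin_kern:
  assumes s: "s > 1" and \<beta>: "0 \<le> \<beta>" "\<beta> < 1"
  shows "nnint {0<..} (\<lambda>t. t powr (s - 1) * kern \<beta> t) = ennreal (Gamma s * dirichlet_real \<beta> s)"
proof -
  define e where "e = (\<lambda>c t. t powr (s - 1) * exp (- c * t) :: real)"
  have [measurable]: "e c \<in> borel_measurable borel" for c unfolding e_def by measurable
  have e: "nnint {0<..} (e c) = ennreal (Gamma s * c powr (- s))" if "c > 0" for c
    unfolding e_def using mellin_exp[OF that] s by simp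
  have e2: "nnint {0<..} (\<lambda>t. e c t / 2) = ennreal (Gamma s * c powr (- s) / 2)" if "c > 0" for c
  proof -
    have "nnint {0<..} (\<lambda>t. e c t / 2) = (\<integral>\<^sup>+t. ennreal (1/2) * (ennreal (e c t) * indicator {0<..} t) \<partial>lborel)"
    proof (intro nn_integral_cong)
      fix t
      have "ennreal (e c t / 2) = ennreal (1/2) * ennreal (e c t)"
        using ennreal_mult'[of "1/2" "e c t"] by simp
      thus "ennreal (e c t / 2) * indicator {0<..} t = ennreal (1/2) * (ennreal (e c t) * indicator {0<..} t)"
        by (simp only: mult.assoc)
    qed
    also have "\<dots> = ennreal (1/2) * nnint {0<..} (e c)" by (intro nn_integral_cmult) measurable
    also have "\<dots> = ennreal (1/2 * (Gamma s * c powr (- s)))"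
      unfolding e[OF that] by (rule ennreal_mult'[symmetric]) simp
    finally show ?thesis by simp
  qed
  have g: "Gamma s \<ge> 0" using s Gamma_real_pos[of s] by simp
  have "nnint {0<..} (\<lambda>t. t powr (s - 1) * kern \<beta> t) = ennreal (\<Sum>n. Gamma s * ((2 * real n + 2) powr (- s) + (2 * real n + (1 + \<beta>)) powr (- s) / 2 + (2 * real n + (1 - \<beta>)) powr (- s) / 2))"
  proof (rule nnint_sums[where f = "\<lambda>n t. e (2 * real n + 2) t + (e (2 * real n + (1 + \<beta>)) t / 2 + e (2 * real n + (1 - \<beta>)) t / 2)"])
    fix t :: real assume t: "t \<in> {0<..}"
    have "(\<lambda>n. t powr (s - 1) * (exp (- (2 * real n + 2) * t) + exp (- (2 * real n + (1 + \<beta>)) * t) / 2 + exp (- (2 * real n + (1 - \<beta>)) * t) / 2)) sums (t powr (s - 1) * kern \<beta> t)"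
      by (intro sums_mult kern_sums) (use t in auto)
    thus "(\<lambda>n. e (2 * real n + 2) t + (e (2 * real n + (1 + \<beta>)) t / 2 + e (2 * real n + (1 - \<beta>)) t / 2)) sums (t powr (s - 1) * kern \<beta> t)"
      by (simp only: e_def distrib_left add.assoc times_divide_eq_right)
  next
    fix n
    have *: "nnint {0<..} (\<lambda>t. e u t + (e v t / 2 + e w t / 2)) = ennreal (Gamma s * u powr (- s)) + (ennreal (Gamma s * v powr (- s) / 2) + ennreal (Gamma s * w powr (- s) / 2))"
      if "u > 0" "v > 0" "w > 0" for u v w
    proof -
      have "nnint {0<..} (\<lambda>t. e v t / 2 + e w t / 2) = nnint {0<..} (\<lambda>t. e v t / 2) + nnint {0<..} (\<lambda>t. e w t / 2)"
        by (rule nnint_add) (measurable, simp_all add: e_def)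
      moreover have "nnint {0<..} (\<lambda>t. e u t + (e v t / 2 + e w t / 2)) = nnint {0<..} (e u) + nnint {0<..} (\<lambda>t. e v t / 2 + e w t / 2)"
        by (rule nnint_add) (measurable, simp_all add: e_def)
      ultimately show ?thesis by (simp only: e e2 that)
    qed
    have "nnint {0<..} (\<lambda>t. e (2 * real n + 2) t + (e (2 * real n + (1 + \<beta>)) t / 2 + e (2 * real n + (1 - \<beta>)) t / 2))
       = ennreal (Gamma s * (2 * real n + 2) powr (- s)) + (ennreal (Gamma s * (2 * real n + (1 + \<beta>)) powr (- s) / 2) + ennreal (Gamma s * (2 * real n + (1 - \<beta>)) powr (- s) / 2))"
      by (rule *) (use \<beta> in auto)
    thus "nnint {0<..} (\<lambda>t. e (2 * real n + 2) t + (e (2 * real n + (1 + \<beta>)) t / 2 + e (2 * real n + (1 - \<beta>)) t / 2)) =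
      ennreal (Gamma s * ((2 * real n + 2) powr (- s) + (2 * real n + (1 + \<beta>)) powr (- s) / 2 + (2 * real n + (1 - \<beta>)) powr (- s) / 2))"
      using g by (simp add: ennreal_plus[symmetric] algebra_simps add_divide_distrib del: ennreal_plus)
  next
    show "summable (\<lambda>n. Gamma s * ((2 * real n + 2) powr (- s) + (2 * real n + (1 + \<beta>)) powr (- s) / 2 + (2 * real n + (1 - \<beta>)) powr (- s) / 2))"
      by (intro summable_mult dirichlet_real_summable s \<beta>)
    show "0 \<le> Gamma s * ((2 * real n + 2) powr (- s) + (2 * real n + (1 + \<beta>)) powr (- s) / 2 + (2 * real n + (1 - \<beta>)) powr (- s) / 2)" for n
      by (intro mult_nonneg_nonneg g add_nonneg_nonneg) auto
    show "0 \<le> e (2 * real n + 2) t + (e (2 * real n + (1 + \<beta>)) t / 2 + e (2 * real n + (1 - \<beta>)) t / 2)" for n t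
      by (simp add: e_def)
  qed measurable
  also have "(\<Sum>n. Gamma s * ((2 * real n + 2) powr (- s) + (2 * real n + (1 + \<beta>)) powr (- s) / 2 + (2 * real n + (1 - \<beta>)) powr (- s) / 2)) = Gamma s * dirichlet_real \<beta> s"
    unfolding dirichlet_real_def using s \<beta> by (intro suminf_mult dirichlet_real_summable)
  finally show ?thesis .
qed

lemma mellin_kern_reg_summable:
  assumes s: "-1 < s" "s < 0"
  shows "summable (\<lambda>n. coef \<beta> (Suc n) * ((pi * real (Suc n)) powr (s - 1) * pi / (2 * cos (pi * s / 2))))"
proof -
  have "summable (\<lambda>n. 2 * pi powr (s - 1) * pi / (2 * cos (pi * s / 2)) * real (Suc n) powr (- (1 - s)))"
    using s by (intro summable_mult summable_M) auto
  thus ?thesis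
  proof (rule summable_comparison_test')
    fix n
    have cpos: "cos (pi * s / 2) > 0" using s by (intro cos_half_pos) auto
    have "coef \<beta> (Suc n) * ((pi * real (Suc n)) powr (s - 1) * pi / (2 * cos (pi * s / 2))) \<le> 2 * ((pi * real (Suc n)) powr (s - 1) * pi / (2 * cos (pi * s / 2)))"
      using cpos by (intro mult_right_mono coef_le) auto
    thus "norm (coef \<beta> (Suc n) * ((pi * real (Suc n)) powr (s - 1) * pi / (2 * cos (pi * s / 2)))) \<le> 2 * pi powr (s - 1) * pi / (2 * cos (pi * s / 2)) * real (Suc n) powr (- (1 - s))"
      using cpos coef_nonneg[of \<beta> "Suc n"] by (simp add: powr_mult abs_mult mult_ac del: of_nat_Suc)
  qed
qed

text \<open>The counterpart of \<open>mellin_kern\<close> on the disjoint range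
  \<open>-1 < s < 0\<close>: partial fractions take the place of exponentials, and
  \<open>mellin_rational\<close> turns them into powers of \<open>pi * n\<close> with exponent
  \<open>s - 1\<close>, that is, into a Dirichlet series at \<open>1 - s\<close>.\<close>

lemma mellin_kern_reg:
  assumes s: "-1 < s" "s < 0" and \<beta>: "\<beta> \<in> {0..1}"
  shows "nnint {0<..} (\<lambda>t. t powr (s - 1) * kern_reg \<beta> t) =
    ennreal (\<Sum>n. coef \<beta> (Suc n) * ((pi * real (Suc n)) powr (s - 1) * pi / (2 * cos (pi * s / 2))))"
proof (rule nnint_sums[where f = "\<lambda>n t. coef \<beta> (Suc n) * (t powr s / (t\<^sup>2 + (pi * real (Suc n))\<^sup>2))"])
  have cpos: "cos (pi * s / 2) > 0" using s by (intro cos_half_pos) auto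
  fix n
  have p: "pi * real (Suc n) > 0" by simp
  have "nnint {0<..} (\<lambda>t. coef \<beta> (Suc n) * (t powr s / (t\<^sup>2 + (pi * real (Suc n))\<^sup>2))) =
     (\<integral>\<^sup>+t. ennreal (coef \<beta> (Suc n)) * (ennreal (t powr s / (t\<^sup>2 + (pi * real (Suc n))\<^sup>2)) * indicator {0<..} t) \<partial>lborel)"
    by (intro nn_integral_cong) (simp only: ennreal_mult'[OF coef_nonneg] mult.assoc)
  also have "\<dots> = ennreal (coef \<beta> (Suc n)) * nnint {0<..} (\<lambda>t. t powr s / (t\<^sup>2 + (pi * real (Suc n))\<^sup>2))"
    by (intro nn_integral_cmult) measurable
  also have "\<dots> = ennreal (coef \<beta> (Suc n) * ((pi * real (Suc n)) powr (s - 1) * pi / (2 * cos (pi * s / 2))))"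
  proof -
    have "nnint {0<..} (\<lambda>t. t powr s / (t\<^sup>2 + (pi * real (Suc n))\<^sup>2)) = ennreal ((pi * real (Suc n)) powr (s - 1) * pi / (2 * cos (pi * s / 2)))"
      using s by (intro mellin_rational p) auto
    thus ?thesis by (simp only: ennreal_mult'[OF coef_nonneg])
  qed
  finally show "nnint {0<..} (\<lambda>t. coef \<beta> (Suc n) * (t powr s / (t\<^sup>2 + (pi * real (Suc n))\<^sup>2))) = \<dots>" .
  show "0 \<le> coef \<beta> (Suc n) * ((pi * real (Suc n)) powr (s - 1) * pi / (2 * cos (pi * s / 2)))"
    using cpos by (intro mult_nonneg_nonneg coef_nonneg) auto
next
  fix t :: real assume t: "t \<in> {0<..}"
  have "t powr s = t powr (s - 1) * t" using t powr_mult_base[of t "s - 1"] by (simp add: mult.commute)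
  thus "(\<lambda>n. coef \<beta> (Suc n) * (t powr s / (t\<^sup>2 + (pi * real (Suc n))\<^sup>2))) sums (t powr (s - 1) * kern_reg \<beta> t)"
    using sums_mult[OF kern_reg_sums[OF _ \<beta>, of t], of "t powr (s - 1)"] t by (simp add: mult_ac del: of_nat_Suc)
  show "0 \<le> coef \<beta> (Suc n) * (t powr s / (t\<^sup>2 + (pi * real (Suc n))\<^sup>2))" for n
    by (intro mult_nonneg_nonneg coef_nonneg) simp
qed (measurable, intro mellin_kern_reg_summable s)

section \<open>Mellin integrals as holomorphic functions\<close>

definition mellin :: "real set \<Rightarrow> (real \<Rightarrow> real) \<Rightarrow> complex \<Rightarrow> complex" where
  "mellin S g s = (LINT t:S|lborel. of_real t powr (s - 1) * of_real (g t))"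

lemma norm_mellin_integrand: "t > 0 \<Longrightarrow> g t \<ge> 0 \<Longrightarrow> norm (complex_of_real t powr (s - 1) * of_real (g t)) = t powr (Re s - 1) * g t"
  by (simp add: norm_mult norm_powr_real_powr)

text \<open>Over the compact intervals the integral may be differentiated under the integral sign;
  these truncations converge locally uniformly to the integral over \<open>S\<close>.\<close>

lemma mellin_holomorphic:
  fixes g :: "real \<Rightarrow> real"
  assumes AB: "\<And>n. 0 < A n" "incseq (\<lambda>n. {A n..B n})" and S: "S = (\<Union>n. {A n..B n})"
    and g: "continuous_on {0<..} g" "\<And>t. t > 0 \<Longrightarrow> g t \<ge> 0"
    and int: "\<And>\<sigma>. \<alpha> < \<sigma> \<Longrightarrow> \<sigma> < \<omega> \<Longrightarrow> set_integrable lborel S (\<lambda>t. t powr (\<sigma> - 1) * g t)"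
  shows "mellin S g holomorphic_on {s. \<alpha> < Re s \<and> Re s < \<omega>}"
proof -
  define f where "f = (\<lambda>s t. complex_of_real t powr (s - 1) * of_real (g t))"
  define U where "U = {s. \<alpha> < Re s \<and> Re s < \<omega>}"
  have U': "U = {s. \<alpha> < Re s} \<inter> {s. Re s < \<omega>}" by (auto simp: U_def)
  have openU: "open U" unfolding U' by (intro open_Int open_halfspace_Re_gt open_halfspace_Re_lt)
  have convU: "convex U" unfolding U' by (intro convex_Int convex_halfspace_Re_gt convex_halfspace_Re_lt)
  have [measurable]: "S \<in> sets borel" unfolding S by measurable
  have Spos: "S \<subseteq> {0<..}" using less_le_trans[OF AB(1)] by (auto simp: S)
  have subS: "{A n..B n} \<subseteq> S" for n by (auto simp: S)
  have gcont: "continuous_on T g" if "T \<subseteq> {0<..}" for T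
    using g(1) that continuous_on_subset by blast
  have fcont: "continuous_on T (f s)" if "T \<subseteq> {0<..}" for T s
    unfolding f_def by (intro continuous_on_mult continuous_on_powr_pos continuous_on_of_real gcont continuous_on_id continuous_on_const)
      (use that in auto)
  have fint: "set_integrable lborel T (f s)" if "s \<in> U" "T \<subseteq> S" "T \<in> sets borel" for s T
  proof -
    have "set_integrable lborel S (f s)"
    proof (rule set_integrable_bound[OF int])
      show "set_borel_measurable lborel S (f s)"
        using borel_measurable_continuous_on_indicator[OF _ fcont[OF Spos]]
        by (simp add: set_borel_measurable_def)
      show "AE t in lborel. t \<in> S \<longrightarrow> norm (f s t) \<le> norm (t powr (Re s - 1) * g t)"
        using Spos g(2) by (auto simp: f_def norm_mellin_integrand subset_iff)
    qed (use that in \<open>auto simp: U_def\<close>)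
    thus ?thesis by (rule set_integrable_subset) (use that in auto)
  qed
  have 1: "(\<lambda>s. LINT t:{A n..B n}|lborel. f s t) holomorphic_on U" for n
  proof -
    have pos: "t > 0" if "t \<in> cbox (A n) (B n)" for t using that AB(1)[of n] by auto
    have "(\<lambda>s. integral (cbox (A n) (B n)) (f s)) holomorphic_on U"
    proof (rule leibniz_rule_holomorphic[OF _ _ _ convU])
      show "((\<lambda>s. f s t) has_field_derivative of_real t powr (s - 1) * of_real (ln t) * of_real (g t)) (at s within U)"
        if "t \<in> cbox (A n) (B n)" for s t
      proof -
        have t: "t > 0" by (rule pos[OF that])
        have "((\<lambda>s. complex_of_real t powr (s - 1)) has_field_derivative (Ln (of_real t) * of_real t powr (s - 1)) * 1) (at s within U)"
          by (rule DERIV_chain2[OF has_field_derivative_powr_right]) (use t in \<open>auto intro!: derivative_eq_intros\<close>)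
        hence "((\<lambda>s. complex_of_real t powr (s - 1)) has_field_derivative (of_real t powr (s - 1) * of_real (ln t))) (at s within U)"
          by (rule DERIV_cong) (simp add: Ln_of_real t)
        from DERIV_cmult_right[OF this, of "of_real (g t)"] show ?thesis unfolding f_def .
      qed
      show "f s integrable_on cbox (A n) (B n)" for s
      proof (rule integrable_continuous, rule fcont)
        show "cbox (A n) (B n) \<subseteq> {0<..}" using pos by blast
      qed
      have g': "continuous_on (U \<times> cbox (A n) (B n)) (\<lambda>p. g (snd p))"
        by (rule continuous_on_compose2[OF g(1) continuous_on_snd[OF continuous_on_id]]) (use pos in auto)
      show "continuous_on (U \<times> cbox (A n) (B n)) (\<lambda>(s,t). of_real t powr (s - 1) * of_real (ln t) * of_real (g t))"
        unfolding split_beta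
        by (intro continuous_on_mult continuous_on_powr_pos continuous_on_of_real g' continuous_on_ln
            continuous_on_fst continuous_on_snd continuous_on_id continuous_on_diff continuous_on_const)
           (use pos in force)+
    qed
    moreover have "(LINT t:{A n..B n}|lborel. f s t) = integral (cbox (A n) (B n)) (f s)" if "s \<in> U" for s
      using set_borel_integral_eq_integral(2)[OF fint[OF that subS]] by simp
    ultimately show ?thesis by (subst holomorphic_cong[OF refl]) auto
  qed
  have "(\<lambda>s. LINT t:S|lborel. f s t) holomorphic_on U"
  proof (rule holomorphic_uniform_sequence[OF openU 1])
    fix x assume x: "x \<in> U"
    define d where "d = min (Re x - \<alpha>) (\<omega> - Re x) / 2"
    have d: "d > 0" "\<alpha> < Re x - d" "Re x + d < \<omega>" using x by (auto simp: d_def U_def min_def field_simps)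
    \<comment> \<open>A majorant for the whole disc: for \<open>t \<ge> 1\<close> the power with the
      largest real part on the disc dominates, for \<open>t < 1\<close> the one with the smallest,
      and their sum covers both cases.\<close>
    define h where "h = (\<lambda>t. t powr (Re x - d - 1) * g t + t powr (Re x + d - 1) * g t)"
    have hint: "set_integrable lborel S h"
      unfolding h_def by (intro set_integral_add int) (use d in auto)
    have Re_bd: "Re x - d \<le> Re y" "Re y \<le> Re x + d" if "y \<in> cball x d" for y
      using abs_Re_le_cmod[of "x - y"] that by (auto simp: dist_norm)
    have cb: "cball x d \<subseteq> U" using Re_bd d by (force simp: U_def)
    have fh: "norm (f y t) \<le> h t" if "y \<in> cball x d" "t \<in> S" for y t
    proof -
      have t: "t > 0" using Spos that by auto
      have "t powr (Re y - 1) \<le> t powr (Re x - d - 1) + t powr (Re x + d - 1)"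
      proof (cases "t \<ge> 1")
        case True
        hence "t powr (Re y - 1) \<le> t powr (Re x + d - 1)" using Re_bd[OF that(1)] by (intro powr_mono) auto
        thus ?thesis by (simp add: add_increasing)
      next
        case False
        hence "t powr (Re y - 1) \<le> t powr (Re x - d - 1)" using Re_bd[OF that(1)] t by (intro powr_mono') auto
        thus ?thesis by (simp add: add_increasing2)
      qed
      hence "t powr (Re y - 1) * g t \<le> (t powr (Re x - d - 1) + t powr (Re x + d - 1)) * g t"
        using g(2)[OF t] by (rule mult_right_mono)
      thus ?thesis unfolding f_def norm_mellin_integrand[where g = g, OF t g(2)[OF t]] h_def distrib_right .
    qed
    define r where "r = (\<lambda>n. (LINT t:S|lborel. h t) - (LINT t:{A n..B n}|lborel. h t))"
    have "(\<lambda>n. LINT t:{A n..B n}|lborel. h t) \<longlonglongrightarrow> (LINT t:S|lborel. h t)"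
      unfolding S by (rule set_integral_cont_up) (use hint AB(2) S in auto)
    hence r: "r \<longlonglongrightarrow> 0" unfolding r_def by (auto intro!: tendsto_eq_intros)
    have bd: "norm ((LINT t:{A n..B n}|lborel. f y t) - (LINT t:S|lborel. f y t)) \<le> r n" if y: "y \<in> cball x d" for n y
    proof -
      have SU: "S = {A n..B n} \<union> (S - {A n..B n})" using subS[of n] by blast
      have yU: "y \<in> U" using y cb by auto
      have split: "(LINT t:S|lborel. p t) = (LINT t:{A n..B n}|lborel. p t) + (LINT t:S - {A n..B n}|lborel. p t)"
        if "set_integrable lborel S p" for p :: "real \<Rightarrow> 'b::{banach,second_countable_topology}"
        by (subst SU, rule set_integral_Un) (auto intro!: set_integrable_subset[OF that] subS simp: )
      have "norm ((LINT t:{A n..B n}|lborel. f y t) - (LINT t:S|lborel. f y t)) = norm (LINT t:S - {A n..B n}|lborel. f y t)"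
        using split[OF fint[OF yU order_refl]] by simp
      also have "\<dots> \<le> (LINT t:S - {A n..B n}|lborel. norm (f y t))"
        unfolding set_lebesgue_integral_def by (rule order_trans[OF integral_norm_bound]) simp
      also have "\<dots> \<le> (LINT t:S - {A n..B n}|lborel. h t)"
      proof (rule set_integral_mono)
        have "set_integrable lborel (S - {A n..B n}) (f y)" by (rule fint[OF yU]) auto
        thus "set_integrable lborel (S - {A n..B n}) (\<lambda>t. norm (f y t))" by (rule set_integrable_norm)
        show "set_integrable lborel (S - {A n..B n}) h" by (rule set_integrable_subset[OF hint]) auto
      qed (use fh[OF y] in auto)
      also have "\<dots> = r n" using split[OF hint] by (simp add: r_def)
      finally show ?thesis .
    qed
    have "uniform_limit (cball x d) (\<lambda>n s. LINT t:{A n..B n}|lborel. f s t) (\<lambda>s. LINT t:S|lborel. f s t) sequentially"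
    proof (rule uniform_limitI)
      fix e :: real assume "e > 0"
      hence "eventually (\<lambda>n. r n < e) sequentially" using order_tendstoD(2)[OF r] by simp
      thus "\<forall>\<^sub>F n in sequentially. \<forall>y\<in>cball x d. dist (LINT t:{A n..B n}|lborel. f y t) (LINT t:S|lborel. f y t) < e"
        unfolding dist_norm by eventually_elim (blast intro: le_less_trans[OF bd])
    qed
    thus "\<exists>d>0. cball x d \<subseteq> U \<and> uniform_limit (cball x d) (\<lambda>n s. LINT t:{A n..B n}|lborel. f s t) (\<lambda>s. LINT t:S|lborel. f s t) sequentially"
      using d(1) cb by blast
  qed
  thus ?thesis by (simp add: mellin_def[abs_def] f_def U_def)
qed

lemma set_integrableI_nnint:
  fixes f :: "real \<Rightarrow> real"
  assumes [measurable]: "S \<in> sets borel" "f \<in> borel_measurable borel"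
    and "\<And>t. t \<in> S \<Longrightarrow> f t \<ge> 0" "nnint S f < \<infinity>"
  shows "set_integrable lborel S f"
  unfolding set_integrable_def
proof (rule integrableI_bounded)
  have "ennreal (norm (indicator S t *\<^sub>R f t)) = ennreal (f t) * indicator S t" for t
    using assms(3)[of t] by (cases "t \<in> S") auto
  thus "(\<integral>\<^sup>+t. ennreal (norm (indicator S t *\<^sub>R f t)) \<partial>lborel) < \<infinity>" using assms(4) by simp
qed measurable

lemma ennreal_sums_eqD:
  assumes "ennreal p + ennreal q = ennreal a + (ennreal b + ennreal c)" "p \<ge> 0" "q \<ge> 0" "a \<ge> 0" "b \<ge> 0" "c \<ge> 0"
  shows "p + q = a + (b + c)"
proof -
  have "ennreal (p + q) = ennreal (a + (b + c))" using assms by (simp only: ennreal_plus add_nonneg_nonneg)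
  thus ?thesis using assms by (subst (asm) ennreal_inj) auto
qed

lemma nnint_LINT:
  assumes "set_integrable lborel S f" "\<And>t. t \<in> S \<Longrightarrow> f t \<ge> 0"
  shows "nnint S f = ennreal (LINT t:S|lborel. f t)"
proof -
  have "nnint S f = (\<integral>\<^sup>+t. ennreal (indicator S t *\<^sub>R f t) \<partial>lborel)"
    by (intro nn_integral_cong) (auto simp: indicator_def)
  also have "\<dots> = ennreal (LINT t:S|lborel. f t)"
    unfolding set_lebesgue_integral_def
    by (rule nn_integral_eq_integral) (use assms in \<open>auto simp: set_integrable_def indicator_def\<close>)
  finally show ?thesis .
qed

lemma mellin_of_real:
  assumes "S \<subseteq> {0<..}"
  shows "mellin S g (of_real s) = of_real (LINT t:S|lborel. t powr (s - 1) * g t)"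
proof -
  have "mellin S g (of_real s) = (LINT t:S|lborel. complex_of_real (t powr (s - 1) * g t))"
    unfolding mellin_def set_lebesgue_integral_def
    by (intro Bochner_Integration.integral_cong) (use assms in \<open>auto simp: indicator_def powr_of_real[symmetric]\<close>)
  thus ?thesis by (simp only: set_integral_complex_of_real)
qed

lemma nnint_split:
  assumes "f \<in> borel_measurable borel"
  shows "nnint {0<..} f = nnint {0<..<1} f + nnint {1..} (f :: real \<Rightarrow> real)"
proof -
  have "nnint {0<..} f = (\<integral>\<^sup>+t. ennreal (f t) * indicator {0<..<1} t + ennreal (f t) * indicator {1..} t \<partial>lborel)"
    by (intro nn_integral_cong) (auto simp: indicator_def)
  also have "\<dots> = nnint {0<..<1} f + nnint {1..} f"
    by (intro nn_integral_add) (use assms in measurable)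
  finally show ?thesis .
qed

lemma nnint_powr_0_1: "p > -1 \<Longrightarrow> nnint {0<..<1} (\<lambda>t. c * t powr p) = ennreal (c / (p + 1))" if "c \<ge> 0"
proof (rule nnint_has_integral)
  assume p: "p > -1"
  have "((\<lambda>t. t powr p) has_integral 1 / (p + 1)) {0<..<1}"
    using has_integral_powr_from_0[OF p, of 1] by (simp add: has_integral_Icc_iff_Ioo)
  from has_integral_mult_right[OF this, of c] show "((\<lambda>t. c * t powr p) has_integral c / (p + 1)) {0<..<1}" by simp
qed (use that in auto)

lemma nnint_powr_1_inf: "p < -1 \<Longrightarrow> nnint {1..} (\<lambda>t. c * t powr p) = ennreal (- c / (p + 1))" if "c \<ge> 0"
proof (rule nnint_has_integral)
  assume p: "p < -1"
  have "((\<lambda>t. t powr p) has_integral - 1 / (p + 1)) {1..}"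
    using has_integral_powr_to_inf[OF p, of 1] by simp
  from has_integral_mult_right[OF this, of c] show "((\<lambda>t. c * t powr p) has_integral - c / (p + 1)) {1..}" by simp
qed (use that in auto)

section \<open>The Mellin integral cut at \<open>t = 1\<close>\<close>

context
  fixes \<beta> :: real
  assumes \<beta>: "0 \<le> \<beta>" "\<beta> < 1"
begin

lemma \<beta>': "\<beta> \<in> {0..1}" using \<beta> by auto

lemma integrable_kern_reg_01:
  assumes "\<sigma> > -1"
  shows "set_integrable lborel {0<..<1} (\<lambda>t. t powr (\<sigma> - 1) * kern_reg \<beta> t)"
proof (rule set_integrable_bound)
  have "((\<lambda>t. t powr \<sigma>) has_integral 1 / (\<sigma> + 1)) {0<..<1}"
    using has_integral_powr_from_0[OF assms, of 1] by (simp add: has_integral_Icc_iff_Ioo)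
  from has_integral_mult_right[OF this, of 2] have "((\<lambda>t. 2 * t powr \<sigma>) has_integral 2 / (\<sigma> + 1)) {0<..<1}" by simp
  hence "nnint {0<..<1} (\<lambda>t. 2 * t powr \<sigma>) = ennreal (2 / (\<sigma> + 1))" by (intro nnint_has_integral) auto
  hence "nnint {0<..<1} (\<lambda>t. 2 * t powr \<sigma>) < \<infinity>" by simp
  thus "set_integrable lborel {0<..<1} (\<lambda>t. 2 * t powr \<sigma>)"
    by (intro set_integrableI_nnint) auto
  show "set_borel_measurable lborel {0<..<1} (\<lambda>t. t powr (\<sigma> - 1) * kern_reg \<beta> t)"
    unfolding set_borel_measurable_def by measurable
  show "AE t in lborel. t \<in> {0<..<1} \<longrightarrow> norm (t powr (\<sigma> - 1) * kern_reg \<beta> t) \<le> norm (2 * t powr \<sigma>)"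
  proof (intro AE_I2 impI)
    fix t :: real assume t: "t \<in> {0<..<1}"
    have "t powr (\<sigma> - 1) * kern_reg \<beta> t \<le> t powr (\<sigma> - 1) * (2 * t)"
      using t kern_reg_le[OF _ \<beta>'] by (intro mult_left_mono) auto
    also have "\<dots> = 2 * t powr \<sigma>" using t powr_mult_base[of t "\<sigma> - 1"] by (simp add: mult_ac)
    finally show "norm (t powr (\<sigma> - 1) * kern_reg \<beta> t) \<le> norm (2 * t powr \<sigma>)"
      using kern_reg_nonneg[OF _ \<beta>'] t by (simp add: abs_mult)
  qed
qed

text \<open>On \<open>t \<ge> 1\<close> the integrand increases with the exponent, so finiteness at
  \<open>max 2 \<sigma>\<close>, known from \<open>mellin_kern\<close>, is enough.\<close>

lemma integrable_kern_inf: "set_integrable lborel {1..} (\<lambda>t. t powr (\<sigma> - 1) * kern \<beta> t)"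
proof (rule set_integrable_bound)
  define s where "s = max 2 \<sigma>"
  have "nnint {0<..} (\<lambda>t. t powr (s - 1) * kern \<beta> t) < \<infinity>"
    using mellin_kern[OF _ \<beta>, of s] by (simp add: s_def)
  hence "nnint {1..} (\<lambda>t. t powr (s - 1) * kern \<beta> t) < \<infinity>"
    by (subst (asm) nnint_split) auto
  thus "set_integrable lborel {1..} (\<lambda>t. t powr (s - 1) * kern \<beta> t)"
    using kern_nonneg by (intro set_integrableI_nnint) auto
  show "set_borel_measurable lborel {1..} (\<lambda>t. t powr (\<sigma> - 1) * kern \<beta> t)"
    unfolding set_borel_measurable_def by measurable
  show "AE t in lborel. t \<in> {1..} \<longrightarrow> norm (t powr (\<sigma> - 1) * kern \<beta> t) \<le> norm (t powr (s - 1) * kern \<beta> t)"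
  proof (intro AE_I2 impI)
    fix t :: real assume t: "t \<in> {1..}"
    have "t powr (\<sigma> - 1) * kern \<beta> t \<le> t powr (s - 1) * kern \<beta> t"
      using t kern_nonneg[of t \<beta>] by (intro mult_right_mono powr_mono) (auto simp: s_def)
    thus "norm (t powr (\<sigma> - 1) * kern \<beta> t) \<le> norm (t powr (s - 1) * kern \<beta> t)"
      using kern_nonneg[of t \<beta>] t by (simp add: abs_mult)
  qed
qed

lemma holomorphic_mellin_kern_reg: "mellin {0<..<1} (kern_reg \<beta>) holomorphic_on {s. -1 < Re s \<and> Re s < 2}"
proof (rule mellin_holomorphic[where A = "\<lambda>n. 1 / (real n + 2)" and B = "\<lambda>n. 1 - 1 / (real n + 2)"])
  show "incseq (\<lambda>n. {1 / (real n + 2)..1 - 1 / (real n + 2)})"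
  proof (rule incseq_SucI)
    fix n
    have "1 / (real (Suc n) + 2) \<le> 1 / (real n + 2)" by (intro divide_left_mono) auto
    thus "{1 / (real n + 2)..1 - 1 / (real n + 2)} \<subseteq> {1 / (real (Suc n) + 2)..1 - 1 / (real (Suc n) + 2)}" by auto
  qed
  show "{0<..<1} = (\<Union>n. {1 / (real n + 2)..1 - 1 / (real n + 2)})"
  proof (intro equalityI subsetI)
    fix t :: real assume t: "t \<in> {0<..<1}"
    define m where "m = min t (1 - t)"
    have "m > 0" using t by (auto simp: m_def)
    then obtain n where "inverse (real (Suc n)) < m" using reals_Archimedean by blast
    moreover have "1 / (real n + 2) \<le> inverse (real (Suc n))" by (simp add: field_simps)
    ultimately have "1 / (real n + 2) \<le> t" "t \<le> 1 - 1 / (real n + 2)" by (auto simp: m_def)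
    thus "t \<in> (\<Union>n. {1 / (real n + 2)..1 - 1 / (real n + 2)})" by auto
  next
    fix t :: real assume "t \<in> (\<Union>n. {1 / (real n + 2)..1 - 1 / (real n + 2)})"
    then obtain n where "1 / (real n + 2) \<le> t" "t \<le> 1 - 1 / (real n + 2)" by auto
    moreover have "1 / (real n + 2) > 0" by simp
    ultimately show "t \<in> {0<..<1}" unfolding greaterThanLessThan_iff by linarith
  qed
qed (auto intro!: continuous_on_kern_reg kern_reg_nonneg \<beta>' integrable_kern_reg_01)

lemma holomorphic_mellin_kern: "mellin {1..} (kern \<beta>) holomorphic_on {s. -1 < Re s \<and> Re s < 2}"
proof (rule mellin_holomorphic[where A = "\<lambda>n. 1" and B = "\<lambda>n. 1 + real n"])
  show "{1..} = (\<Union>n. {1..1 + real n})"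
  proof (intro equalityI subsetI)
    fix t :: real assume t: "t \<in> {1..}"
    obtain n where "t \<le> real n" using real_arch_simple by blast
    hence "t \<in> {1..1 + real n}" using t by simp
    thus "t \<in> (\<Union>n. {1..1 + real n})" by blast
  qed auto
qed (auto intro!: continuous_on_kern kern_nonneg integrable_kern_inf simp: incseq_def)

definition mell_a where "mell_a s = (LINT t:{0<..<1}|lborel. t powr (s - 1) * kern_reg \<beta> t)"
definition mell_b where "mell_b s = (LINT t:{1..}|lborel. t powr (s - 1) * kern \<beta> t)"

lemma mell_a: "s > -1 \<Longrightarrow> nnint {0<..<1} (\<lambda>t. t powr (s - 1) * kern_reg \<beta> t) = ennreal (mell_a s)"
  unfolding mell_a_def by (intro nnint_LINT integrable_kern_reg_01) (auto intro!: mult_nonneg_nonneg kern_reg_nonneg \<beta>')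

lemma mell_b: "nnint {1..} (\<lambda>t. t powr (s - 1) * kern \<beta> t) = ennreal (mell_b s)"
  unfolding mell_b_def by (intro nnint_LINT integrable_kern_inf) (auto intro!: mult_nonneg_nonneg kern_nonneg)

lemma mell_nonneg: "mell_a s \<ge> 0" "mell_b s \<ge> 0"
proof -
  have "0 \<le> indicator {0<..<1} t *\<^sub>R (t powr (s - 1) * kern_reg \<beta> t)" for t
    using kern_reg_nonneg[OF _ \<beta>', of t] by (cases "t \<in> {0<..<1}") auto
  thus "mell_a s \<ge> 0" unfolding mell_a_def set_lebesgue_integral_def by (intro Bochner_Integration.integral_nonneg)
  have "0 \<le> indicator {1..} t *\<^sub>R (t powr (s - 1) * kern \<beta> t)" for t
    using kern_nonneg[of t \<beta>] by (cases "t \<in> {1..}") auto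
  thus "mell_b s \<ge> 0" unfolding mell_b_def set_lebesgue_integral_def by (intro Bochner_Integration.integral_nonneg)
qed

text \<open>The identity between \<open>kern\<close> and \<open>kern_reg\<close>, arranged with
  nonnegative terms on both sides because extended nonnegative integrals cannot be subtracted
  freely.\<close>

lemma kern_balance:
  assumes "T \<in> sets borel" "T \<subseteq> {0<..}"
  shows "nnint T (\<lambda>t. t powr (s - 1) * kern \<beta> t) + nnint T (\<lambda>t. 1 / 2 * t powr (s - 1)) =
         nnint T (\<lambda>t. t powr (s - 1) * kern_reg \<beta> t) + nnint T (\<lambda>t. 1 * t powr (s - 2))"
proof -
  have "nnint T (\<lambda>t. t powr (s - 1) * kern \<beta> t) + nnint T (\<lambda>t. 1 / 2 * t powr (s - 1)) =
     nnint T (\<lambda>t. t powr (s - 1) * kern \<beta> t + 1 / 2 * t powr (s - 1))"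
    by (rule nnint_add[symmetric]) (use assms in \<open>auto intro!: mult_nonneg_nonneg kern_nonneg\<close>)
  also have "\<dots> = nnint T (\<lambda>t. t powr (s - 1) * kern_reg \<beta> t + 1 * t powr (s - 2))"
  proof (rule nnint_cong)
    fix t assume "t \<in> T"
    hence t: "t > 0" using assms by auto
    have "t powr (s - 1) * (1 / t) = t powr (s - 2)" using t powr_mult_base[of t "s - 2"] by (simp add: field_simps)
    thus "t powr (s - 1) * kern \<beta> t + 1 / 2 * t powr (s - 1) = t powr (s - 1) * kern_reg \<beta> t + 1 * t powr (s - 2)"
      by (simp add: kern_reg_def algebra_simps)
  qed
  also have "\<dots> = nnint T (\<lambda>t. t powr (s - 1) * kern_reg \<beta> t) + nnint T (\<lambda>t. 1 * t powr (s - 2))"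
    by (rule nnint_add) (use assms in \<open>auto intro!: mult_nonneg_nonneg kern_reg_nonneg \<beta>'\<close>)
  finally show ?thesis .
qed

lemma mell_large:
  assumes s: "s > 1"
  shows "Gamma s * dirichlet_real \<beta> s = mell_a s + mell_b s + 1 / (s - 1) - 1 / (2 * s)"
proof -
  have nn: "Gamma s * dirichlet_real \<beta> s \<ge> 0"
    unfolding dirichlet_real_def
    using s Gamma_real_pos[of s] by (intro mult_nonneg_nonneg suminf_nonneg dirichlet_real_summable \<beta> add_nonneg_nonneg) auto
  have "ennreal (Gamma s * dirichlet_real \<beta> s) + ennreal (1 / (2 * s)) =
     nnint {1..} (\<lambda>t. t powr (s - 1) * kern \<beta> t) + (nnint {0<..<1} (\<lambda>t. t powr (s - 1) * kern \<beta> t) + nnint {0<..<1} (\<lambda>t. 1 / 2 * t powr (s - 1)))"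
    unfolding mellin_kern[OF s \<beta>, symmetric] using nnint_powr_0_1[of "1/2" "s - 1"] s
    by (subst nnint_split) (auto simp: add_ac)
  also have "\<dots> = ennreal (mell_b s) + (ennreal (mell_a s) + ennreal (1 / (s - 1)))"
    using s nnint_powr_0_1[of 1 "s - 2"] by (subst kern_balance) (auto simp: mell_a mell_b)
  finally have "Gamma s * dirichlet_real \<beta> s + 1 / (2 * s) = mell_b s + (mell_a s + 1 / (s - 1))"
    by (rule ennreal_sums_eqD) (use s nn mell_nonneg in auto)
  thus ?thesis by simp
qed

text \<open>The right-hand side is the one of \<open>mell_large\<close>. There
  \<open>1 / t - 1 / 2\<close> is integrated over (0,1) and added; here it is integrated over the
  half-line from 1 and subtracted, and both give \<open>1 / (s - 1) - 1 / (2 * s)\<close>. So a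
  single meromorphic expression represents \<open>\<Gamma>(s) E(s)\<close> on the right and the dual
  series on the left.\<close>

lemma mell_small:
  assumes s: "-1 < s" "s < 0"
  shows "(\<Sum>n. coef \<beta> (Suc n) * ((pi * real (Suc n)) powr (s - 1) * pi / (2 * cos (pi * s / 2)))) = mell_a s + mell_b s + 1 / (s - 1) - 1 / (2 * s)"
    (is "?R = _")
proof -
  have nn: "?R \<ge> 0"
    using cos_half_pos[of s] s by (intro suminf_nonneg mellin_kern_reg_summable mult_nonneg_nonneg coef_nonneg) auto
  have "ennreal ?R + ennreal (1 / (1 - s)) =
     ennreal (mell_a s) + (nnint {1..} (\<lambda>t. t powr (s - 1) * kern_reg \<beta> t) + nnint {1..} (\<lambda>t. 1 * t powr (s - 2)))"
    unfolding mellin_kern_reg[OF s \<beta>', symmetric] using nnint_powr_1_inf[of 1 "s - 2"] s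
    by (subst nnint_split) (auto simp: add_ac mell_a minus_divide_right)
  also have "\<dots> = ennreal (mell_a s) + (ennreal (mell_b s) + ennreal (- 1 / (2 * s)))"
    using s nnint_powr_1_inf[of "1/2" "s - 1"] by (subst kern_balance[symmetric]) (auto simp: mell_b)
  finally have "?R + 1 / (1 - s) = mell_a s + (mell_b s + - 1 / (2 * s))"
    by (rule ennreal_sums_eqD) (use s nn mell_nonneg in \<open>auto intro: divide_nonpos_neg\<close>)
  moreover have "1 / (1 - s) = - (1 / (s - 1))" using s by (simp add: field_simps)
  ultimately show ?thesis by simp
qed

end

section \<open>The functional equation\<close>

text \<open>The bridge from the identities for real \<open>s\<close>, proved with nonnegative
  integrals, to complex domains.\<close>

lemma holomorphic_eq_on_real_segment:
  assumes "f holomorphic_on S" "g holomorphic_on S" "open S" "connected S" "a < b"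
    and sub: "of_real ` {a<..<b} \<subseteq> S" and eq: "\<And>x. a < x \<Longrightarrow> x < b \<Longrightarrow> f (of_real x) = g (of_real x)"
    and "z \<in> S"
  shows "f z = g z"
proof -
  define \<xi> where "\<xi> = (a + b) / 2"
  have \<xi>: "a < \<xi>" "\<xi> < b" using \<open>a < b\<close> by (auto simp: \<xi>_def)
  have "complex_of_real \<xi> islimpt of_real ` {a<..<b}"
    unfolding islimpt_approachable
  proof (intro allI impI)
    fix e :: real assume e: "e > 0"
    define x where "x = \<xi> + min (e / 2) ((b - \<xi>) / 2)"
    have x: "\<xi> < x" "x < b" "x - \<xi> < e" using e \<xi> by (auto simp: x_def min_def field_simps)
    have "dist (complex_of_real x) (of_real \<xi>) = \<bar>x - \<xi>\<bar>" by (simp only: dist_norm of_real_diff[symmetric] norm_of_real)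
    hence "dist (complex_of_real x) (of_real \<xi>) < e" using x by simp
    thus "\<exists>x'\<in>complex_of_real ` {a<..<b}. x' \<noteq> of_real \<xi> \<and> dist x' (of_real \<xi>) < e"
      using x \<xi> by (intro bexI[of _ "of_real x"]) auto
  qed
  hence "f z - g z = 0"
    by (intro analytic_continuation[of "\<lambda>z. f z - g z" S "of_real ` {a<..<b}" "of_real \<xi>" z])
       (use assms \<xi> in \<open>auto intro: holomorphic_on_diff\<close>)
  thus ?thesis by simp
qed

text \<open>The entire function \<open>(s - 1) E(s)\<close>, parametrised by \<open>\<beta>\<close>:
  in terms of \<open>\<beta>\<close> the two Hurwitz parameters are \<open>(1 + \<beta>) / 2\<close>
  and \<open>(1 - \<beta>) / 2\<close>, and \<open>2 powr (-s)\<close> is a common factor.\<close>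

definition EZ :: "real \<Rightarrow> complex \<Rightarrow> complex" where
  "EZ \<beta> s = 2 powr (- s) * (hurwitz_Z 1 s + (hurwitz_Z ((1 + \<beta>) / 2) s + hurwitz_Z ((1 - \<beta>) / 2) s) / 2)"

definition Fser :: "real \<Rightarrow> complex \<Rightarrow> complex" where
  "Fser \<beta> w = (\<Sum>n. of_real (coef \<beta> (Suc n)) * of_nat (Suc n) powr (- w))"

lemma holomorphic_EZ:
  assumes "0 \<le> \<beta>" "\<beta> < 1"
  shows "EZ \<beta> holomorphic_on A"
  unfolding EZ_def[abs_def] by (intro holomorphic_intros holomorphic_hurwitz_Z) (use assms in auto)

lemma EZ_real:
  assumes "0 \<le> \<beta>" "\<beta> < 1" "s > 1"
  shows "EZ \<beta> (of_real s) = of_real ((s - 1) * dirichlet_real \<beta> s)"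
proof -
  have h: "(\<lambda>n. complex_of_real ((2 * real n + 2 * a) powr (- s))) sums (2 powr (- of_real s) * hseries a (of_real s))"
    if "a > 0" for a
  proof -
    have "(\<lambda>n. 2 powr (- of_real s) * (of_nat n + complex_of_real a) powr (- of_real s)) sums (2 powr (- of_real s) * hseries a (of_real s))"
      unfolding hseries_def using that assms by (intro sums_mult summable_sums summable_hterm) auto
    moreover have "2 powr (- of_real s) * (of_nat n + complex_of_real a) powr (- of_real s) = of_real ((2 * real n + 2 * a) powr (- s))" for n
    proof -
      have "2 powr (- complex_of_real s) = of_real (2 powr (- s))"
        using powr_of_real[of 2 "- s"] by simp
      moreover have "(of_nat n + complex_of_real a) powr (- of_real s) = of_real ((real n + a) powr (- s))"
        using powr_of_real[of "real n + a" "- s"] that by simp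
      moreover have "(2 * real n + 2 * a) powr (- s) = 2 powr (- s) * (real n + a) powr (- s)"
        using that by (simp add: powr_mult[symmetric] algebra_simps)
      ultimately show ?thesis by (simp only: of_real_mult)
    qed
    ultimately show ?thesis by (simp only:)
  qed
  have "(\<lambda>n. complex_of_real ((2 * real n + 2 * 1) powr (- s)) + (of_real ((2 * real n + 2 * ((1 + \<beta>) / 2)) powr (- s)) + of_real ((2 * real n + 2 * ((1 - \<beta>) / 2)) powr (- s))) / 2)
     sums (2 powr (- of_real s) * hseries 1 (of_real s) + (2 powr (- of_real s) * hseries ((1 + \<beta>) / 2) (of_real s) + 2 powr (- of_real s) * hseries ((1 - \<beta>) / 2) (of_real s)) / 2)"
    by (intro sums_add sums_divide h) (use assms in auto)
  moreover have "(\<lambda>n. complex_of_real ((2 * real n + 2 * 1) powr (- s)) + (of_real ((2 * real n + 2 * ((1 + \<beta>) / 2)) powr (- s)) + of_real ((2 * real n + 2 * ((1 - \<beta>) / 2)) powr (- s))) / 2)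
     = (\<lambda>n. complex_of_real ((2 * real n + 2) powr (- s) + (2 * real n + (1 + \<beta>)) powr (- s) / 2 + (2 * real n + (1 - \<beta>)) powr (- s) / 2))"
  proof -
    have "2 * ((1 + \<beta>) / 2) = 1 + \<beta>" "2 * ((1 - \<beta>) / 2) = 1 - \<beta>" "2 * (1::real) = 2" by simp_all
    thus ?thesis by (simp only: of_real_add of_real_divide of_real_numeral add_divide_distrib add.assoc)
  qed
  moreover have "(\<lambda>n. complex_of_real ((2 * real n + 2) powr (- s) + (2 * real n + (1 + \<beta>)) powr (- s) / 2 + (2 * real n + (1 - \<beta>)) powr (- s) / 2)) sums of_real (dirichlet_real \<beta> s)"
    unfolding dirichlet_real_def by (intro sums_of_real summable_sums dirichlet_real_summable assms)
  ultimately have eq: "2 powr (- of_real s) * hseries 1 (of_real s) + (2 powr (- of_real s) * hseries ((1 + \<beta>) / 2) (of_real s) + 2 powr (- of_real s) * hseries ((1 - \<beta>) / 2) (of_real s)) / 2 = complex_of_real (dirichlet_real \<beta> s)"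
    by (simp only: sums_unique2)
  have Z: "hurwitz_Z a (of_real s) = (of_real s - 1) * hseries a (of_real s)" if "a > 0" for a
    using hurwitz_Z_series[OF that] assms by simp
  have "EZ \<beta> (of_real s) = (of_real s - 1) * (2 powr (- of_real s) * hseries 1 (of_real s) + (2 powr (- of_real s) * hseries ((1 + \<beta>) / 2) (of_real s) + 2 powr (- of_real s) * hseries ((1 - \<beta>) / 2) (of_real s)) / 2)"
    unfolding EZ_def using assms by (simp add: Z algebra_simps)
  thus ?thesis unfolding eq by simp
qed

text \<open>Multiplied by \<open>(s - 1) * rGamma s\<close>, the identity \<open>mell_large\<close>
  loses its poles: \<open>s - 1\<close> cancels the one at 1, and
  \<open>rGamma s / s = rGamma (s + 1)\<close> the one at 0. The resulting form can be continued
  from (1,2) across the whole strip.\<close>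

lemma EZ_mellin:
  assumes \<beta>: "0 \<le> \<beta>" "\<beta> < 1" and s: "-1 < Re s" "Re s < 2"
  shows "EZ \<beta> s = rGamma s * ((s - 1) * (mellin {0<..<1} (kern_reg \<beta>) s + mellin {1..} (kern \<beta>) s) + 1) - (s - 1) * rGamma (s + 1) / 2"
proof -
  define U where "U = {s. -1 < Re s \<and> Re s < 2}"
  have U': "U = {s. -1 < Re s} \<inter> {s. Re s < 2}" by (auto simp: U_def)
  show ?thesis
  proof (rule holomorphic_eq_on_real_segment[where S = U and a = 1 and b = 2 and z = s and f = "EZ \<beta>"])
    show "open U" unfolding U' by (intro open_Int open_halfspace_Re_gt open_halfspace_Re_lt)
    show "connected U" unfolding U' by (intro convex_connected convex_Int convex_halfspace_Re_gt convex_halfspace_Re_lt)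
    show "(\<lambda>s. rGamma s * ((s - 1) * (mellin {0<..<1} (kern_reg \<beta>) s + mellin {1..} (kern \<beta>) s) + 1) - (s - 1) * rGamma (s + 1) / 2) holomorphic_on U"
      by (intro holomorphic_intros) (use holomorphic_mellin_kern_reg[OF \<beta>] holomorphic_mellin_kern[OF \<beta>] in \<open>simp_all add: U_def\<close>)
    fix x :: real assume x: "1 < x" "x < 2"
    have m: "mellin {0<..<1} (kern_reg \<beta>) (of_real x) = of_real (mell_a \<beta> x)"
       "mellin {1..} (kern \<beta>) (of_real x) = of_real (mell_b \<beta> x)"
      unfolding mell_a_def[OF \<beta>] mell_b_def[OF \<beta>] by (rule mellin_of_real; force)+
    have r: "rGamma (of_real x + 1) = complex_of_real (rGamma (x + 1))" "rGamma (of_real x) = complex_of_real (rGamma x)"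
      using rGamma_complex_of_real[of "x + 1"] rGamma_complex_of_real[of x] by simp_all
    have "(x - 1) * dirichlet_real \<beta> x = rGamma x * ((x - 1) * (mell_a \<beta> x + mell_b \<beta> x) + 1) - (x - 1) * rGamma (x + 1) / 2"
    proof -
      have g: "Gamma x > 0" using x by simp
      have rg: "rGamma x = inverse (Gamma x)" by (simp add: Gamma_def)
      have rg1: "rGamma (x + 1) = rGamma x / x" using rGamma_plus1[of x] x by (simp add: field_simps)
      have "dirichlet_real \<beta> x = rGamma x * (mell_a \<beta> x + mell_b \<beta> x + 1 / (x - 1) - 1 / (2 * x))"
        using mell_large[OF \<beta> x(1)] g unfolding rg by (simp add: field_simps)
      hence "(x - 1) * dirichlet_real \<beta> x = rGamma x * ((x - 1) * (mell_a \<beta> x + mell_b \<beta> x + 1 / (x - 1) - 1 / (2 * x)))" by simp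
      also have "(x - 1) * (mell_a \<beta> x + mell_b \<beta> x + 1 / (x - 1) - 1 / (2 * x)) = (x - 1) * (mell_a \<beta> x + mell_b \<beta> x) + 1 - (x - 1) / (2 * x)"
        using x by (simp add: field_simps)
      finally show ?thesis unfolding rg1 using x by (simp add: field_simps)
    qed
    thus "EZ \<beta> (of_real x) = rGamma (of_real x) * ((of_real x - 1) * (mellin {0<..<1} (kern_reg \<beta>) (of_real x) + mellin {1..} (kern \<beta>) (of_real x)) + 1) - (of_real x - 1) * rGamma (of_real x + 1) / 2"
      unfolding EZ_real[OF \<beta> x(1)] m r by (simp only: of_real_mult of_real_add of_real_diff of_real_1 of_real_divide of_real_numeral)
  qed (use s holomorphic_EZ[OF \<beta>] in \<open>auto simp: U_def\<close>)
qed

lemma EZ_functional_real: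
  assumes \<beta>: "0 \<le> \<beta>" "\<beta> < 1" and s: "-1 < s" "s < 0"
  shows "EZ \<beta> (of_real s) = of_real ((s - 1) * Gamma (1 - s) * sin (pi * s / 2) * (\<Sum>n. coef \<beta> (Suc n) * (pi * real (Suc n)) powr (s - 1)))"
proof -
  define R where "R = (\<Sum>n. coef \<beta> (Suc n) * (pi * real (Suc n)) powr (s - 1))"
  define c where "c = cos (pi * s / 2)"
  have c: "c > 0" unfolding c_def using s by (intro cos_half_pos) auto
  have m: "mellin {0<..<1} (kern_reg \<beta>) (of_real s) = of_real (mell_a \<beta> s)"
     "mellin {1..} (kern \<beta>) (of_real s) = of_real (mell_b \<beta> s)"
    unfolding mell_a_def[OF \<beta>] mell_b_def[OF \<beta>] by (rule mellin_of_real; force)+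
  have r: "rGamma (of_real s + 1) = complex_of_real (rGamma (s + 1))" "rGamma (of_real s) = complex_of_real (rGamma s)"
    using rGamma_complex_of_real[of "s + 1"] rGamma_complex_of_real[of s] by simp_all
  have rg1: "rGamma (s + 1) = rGamma s / s" using rGamma_plus1[of s] s by (simp add: field_simps)
  have sm: "summable (\<lambda>n. coef \<beta> (Suc n) * (pi * real (Suc n)) powr (s - 1))"
  proof -
    have "summable (\<lambda>n. 2 * c / pi * (coef \<beta> (Suc n) * ((pi * real (Suc n)) powr (s - 1) * pi / (2 * cos (pi * s / 2)))))"
      by (intro summable_mult mellin_kern_reg_summable s)
    moreover have "2 * c / pi * (coef \<beta> (Suc n) * ((pi * real (Suc n)) powr (s - 1) * pi / (2 * cos (pi * s / 2)))) = coef \<beta> (Suc n) * (pi * real (Suc n)) powr (s - 1)" for n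
      unfolding c_def[symmetric] using c by (simp add: field_simps)
    ultimately show ?thesis by (simp only:)
  qed
  have "(\<Sum>n. coef \<beta> (Suc n) * ((pi * real (Suc n)) powr (s - 1) * pi / (2 * cos (pi * s / 2)))) = (\<Sum>n. pi / (2 * c) * (coef \<beta> (Suc n) * (pi * real (Suc n)) powr (s - 1)))"
    by (simp add: c_def mult_ac)
  also have "\<dots> = pi / (2 * c) * R" unfolding R_def by (rule suminf_mult[OF sm])
  finally have R: "mell_a \<beta> s + mell_b \<beta> s + 1 / (s - 1) - 1 / (2 * s) = pi / (2 * c) * R"
    using mell_small[OF \<beta> s] by simp
  have "rGamma s * ((s - 1) * (mell_a \<beta> s + mell_b \<beta> s) + 1) - (s - 1) * rGamma (s + 1) / 2 =
     rGamma s * (s - 1) * (mell_a \<beta> s + mell_b \<beta> s + 1 / (s - 1) - 1 / (2 * s))"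
    unfolding rg1 using s by (simp add: field_simps)
  also have "\<dots> = rGamma s * (s - 1) * (pi / (2 * c) * R)" unfolding R ..
  also have "rGamma s * (s - 1) * (pi / (2 * c) * R) = (s - 1) * Gamma (1 - s) * sin (pi * s / 2) * R"
  proof -
    \<comment> \<open>Reflection and the double-angle formula; the cosine \<open>c\<close> contained
      in \<open>sin (pi * s)\<close> cancels the one from \<open>mellin_rational\<close> and leaves
      the sine of the functional equation.\<close>
    have rgs: "rGamma s = Gamma (1 - s) * (2 * sin (pi * s / 2) * c) / pi"
    proof -
    have "complex_of_real (rGamma s * rGamma (1 - s)) = rGamma (of_real s) * rGamma (1 - of_real s)"
      using rGamma_complex_of_real[of "1 - s"] rGamma_complex_of_real[of s] by simp
    also have "\<dots> = of_real (sin (pi * s) / pi)"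
      by (simp only: rGamma_reflection_complex of_real_divide of_real_mult[symmetric] sin_of_real)
    finally have "rGamma s * rGamma (1 - s) = sin (pi * s) / pi" by (simp only: of_real_eq_iff)
    moreover have "sin (pi * s) = 2 * sin (pi * s / 2) * c" using sin_double[of "pi * s / 2"] by (simp add: c_def)
    moreover have "Gamma (1 - s) > 0" using s by simp
    moreover have "rGamma (1 - s) = inverse (Gamma (1 - s))" by (simp add: Gamma_def)
    ultimately show ?thesis by (simp add: field_simps)
  qed
    show ?thesis unfolding rgs using c by (simp add: field_simps)
  qed
  finally have "rGamma s * ((s - 1) * (mell_a \<beta> s + mell_b \<beta> s) + 1) - (s - 1) * rGamma (s + 1) / 2 = (s - 1) * Gamma (1 - s) * sin (pi * s / 2) * R" .
  moreover have "EZ \<beta> (of_real s) = of_real (rGamma s * ((s - 1) * (mell_a \<beta> s + mell_b \<beta> s) + 1) - (s - 1) * rGamma (s + 1) / 2)"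
    using EZ_mellin[OF \<beta>, of "of_real s"] s unfolding m r
    by (simp add: )
  ultimately show ?thesis by (simp only: R_def)
qed

lemma norm_Fterm: "norm (complex_of_real (coef \<beta> (Suc n)) * of_nat (Suc n) powr (- w)) = coef \<beta> (Suc n) * real (Suc n) powr (- Re w)"
  using norm_hterm[of 0 "Suc n" w] coef_nonneg[of \<beta> "Suc n"] by (simp add: norm_mult del: of_nat_Suc)

lemma norm_Fterm_le:
  assumes "Re w \<ge> c"
  shows "norm (complex_of_real (coef \<beta> (Suc n)) * of_nat (Suc n) powr (- w)) \<le> 2 * real (Suc n) powr (- c)"
  unfolding norm_Fterm using assms by (intro mult_mono coef_le powr_mono) auto

lemma summable_Fser:
  assumes "Re w > 1"
  shows "summable (\<lambda>n. complex_of_real (coef \<beta> (Suc n)) * of_nat (Suc n) powr (- w))"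
  by (rule summable_comparison_test'[OF summable_mult[OF summable_M[OF assms], of 2]])
     (rule norm_Fterm_le[OF order_refl])

lemma holomorphic_Fser: "Fser \<beta> holomorphic_on {w. Re w > 1}"
  unfolding Fser_def[abs_def]
proof (rule holomorphic_on_suminf[OF open_halfspace_Re_gt])
  show "(\<lambda>w. of_real (coef \<beta> (Suc n)) * of_nat (Suc n) powr (- w)) holomorphic_on {w. 1 < Re w}" for n
    by (intro holomorphic_intros) (simp del: of_nat_Suc)
  fix x assume x: "x \<in> {s. 1 < Re s}"
  define d where "d = (Re x - 1) / 2"
  have d: "d > 0" "1 + d = Re x - d" using x by (auto simp: d_def field_simps)
  have *: "1 + d \<le> Re y" if "y \<in> cball x d" for y
    using abs_Re_le_cmod[of "x - y"] that d by (auto simp: dist_norm)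
  show "\<exists>d>0. cball x d \<subseteq> {s. 1 < Re s} \<and>
       (\<exists>M. summable M \<and> (\<forall>n. \<forall>y\<in>cball x d. norm (complex_of_real (coef \<beta> (Suc n)) * of_nat (Suc n) powr (- y)) \<le> M n))"
  proof (intro exI[of _ d] conjI exI[of _ "\<lambda>n. 2 * real (Suc n) powr (- (1+d))"] allI ballI)
    show "cball x d \<subseteq> {s. 1 < Re s}" using * d by (smt (verit) mem_Collect_eq subsetI)
    show "norm (complex_of_real (coef \<beta> (Suc n)) * of_nat (Suc n) powr (- y)) \<le> 2 * real (Suc n) powr (- (1+d))"
      if "y \<in> cball x d" for n y
      by (rule norm_Fterm_le[OF *[OF that]])
    show "summable (\<lambda>n. 2 * real (Suc n) powr (- (1+d)))" by (intro summable_mult summable_M) (use d in simp)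
  qed (use d in simp)
qed

lemma Fser_real:
  assumes "s < 0"
  shows "of_real pi powr (of_real s - 1) * Fser \<beta> (1 - of_real s) = of_real (\<Sum>n. coef \<beta> (Suc n) * (pi * real (Suc n)) powr (s - 1))"
proof -
  have "(\<lambda>n. of_real pi powr (of_real s - 1) * (complex_of_real (coef \<beta> (Suc n)) * of_nat (Suc n) powr (- (1 - of_real s)))) sums (of_real pi powr (of_real s - 1) * Fser \<beta> (1 - of_real s))"
    unfolding Fser_def using assms by (intro sums_mult summable_sums summable_Fser) auto
  moreover have "of_real pi powr (of_real s - 1) * (complex_of_real (coef \<beta> (Suc n)) * of_nat (Suc n) powr (- (1 - of_real s))) = of_real (coef \<beta> (Suc n) * (pi * real (Suc n)) powr (s - 1))" for n
  proof -
    have "complex_of_real pi powr (of_real s - 1) = of_real (pi powr (s - 1))" using powr_of_real[of pi "s - 1"] by simp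
    moreover have "of_nat (Suc n) powr (- (1 - of_real s)) = complex_of_real (real (Suc n) powr (s - 1))"
      using powr_of_real[of "real (Suc n)" "s - 1"] by simp
    moreover have "(pi * real (Suc n)) powr (s - 1) = pi powr (s - 1) * real (Suc n) powr (s - 1)"
      by (rule powr_mult)
    ultimately show ?thesis by (simp only: of_real_mult mult.left_commute)
  qed
  ultimately have *: "(\<lambda>n. complex_of_real (coef \<beta> (Suc n) * (pi * real (Suc n)) powr (s - 1))) sums (of_real pi powr (of_real s - 1) * Fser \<beta> (1 - of_real s))"
    by (simp only:)
  have "summable (\<lambda>n. coef \<beta> (Suc n) * (pi * real (Suc n)) powr (s - 1))"
    using sums_summable[OF *] by (simp only: summable_of_real_iff)
  from sums_of_real[OF summable_sums[OF this]] show ?thesis by (rule sums_unique2[OF *])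
qed

theorem EZ_functional:
  assumes \<beta>: "0 \<le> \<beta>" "\<beta> < 1" and s: "Re s < 0"
  shows "EZ \<beta> s = (s - 1) * Gamma (1 - s) * sin (of_real pi * s / 2) * (of_real pi powr (s - 1) * Fser \<beta> (1 - s))"
proof (rule holomorphic_eq_on_real_segment[where S = "{s. Re s < 0}" and a = "-1" and b = 0 and z = s and f = "EZ \<beta>"])
  show "(\<lambda>s. (s - 1) * Gamma (1 - s) * sin (of_real pi * s / 2) * (of_real pi powr (s - 1) * Fser \<beta> (1 - s))) holomorphic_on {s. Re s < 0}"
  proof (intro holomorphic_intros)
    show "1 - z \<notin> \<int>\<^sub>\<le>\<^sub>0" if "z \<in> {s. Re s < 0}" for z
      using that by (auto elim!: nonpos_Ints_cases simp: complex_eq_iff)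
    have "(Fser \<beta> \<circ> (\<lambda>s. 1 - s)) holomorphic_on {s. Re s < 0}"
      by (rule holomorphic_on_compose_gen[OF _ holomorphic_Fser]) (auto intro!: holomorphic_intros)
    thus "(\<lambda>s. Fser \<beta> (1 - s)) holomorphic_on {s. Re s < 0}" by (simp add: o_def)
  qed auto
  fix x :: real assume x: "-1 < x" "x < 0"
  have "EZ \<beta> (of_real x) = of_real ((x - 1) * Gamma (1 - x) * sin (pi * x / 2)) * (of_real pi powr (of_real x - 1) * Fser \<beta> (1 - of_real x))"
    unfolding EZ_functional_real[OF \<beta> x] Fser_real[OF x(2)] by (simp only: of_real_mult)
  moreover have "Gamma (1 - complex_of_real x) = of_real (Gamma (1 - x))"
    using Gamma_complex_of_real[of "1 - x"] by simp
  moreover have "sin (of_real pi * complex_of_real x / 2) = of_real (sin (pi * x / 2))"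
    using sin_of_real[of "pi * x / 2", where 'a = complex] by simp
  ultimately show "EZ \<beta> (of_real x) = (of_real x - 1) * Gamma (1 - of_real x) * sin (of_real pi * of_real x / 2) * (of_real pi powr (of_real x - 1) * Fser \<beta> (1 - of_real x))"
    by (simp only: of_real_mult of_real_diff of_real_1)
qed (use s in \<open>auto intro!: holomorphic_EZ \<beta> open_halfspace_Re_lt convex_connected convex_halfspace_Re_lt\<close>)

section \<open>Zeros to the left of the imaginary axis\<close>

lemma connected_punctured: "connected (- {1::complex})"
  by (rule connected_punctured_universe) simp

lemma continuation_from_half_plane:
  assumes Z: "Z holomorphic_on UNIV" and "\<And>s. Re s > 1 \<Longrightarrow> Z s = (s - 1) * f s" and "s \<noteq> 1"
  shows "analytic_continuation f {s. Re s > 1} (- {1}) s = Z s / (s - 1)"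
proof (rule analytic_continuation_eq[where h = "\<lambda>s. Z s / (s - 1)"])
  show "(\<lambda>s. Z s / (s - 1)) holomorphic_on - {1}"
    by (intro holomorphic_intros holomorphic_on_subset[OF Z]) auto
  show "{s. Re s > 1} \<noteq> {}" by (auto intro!: exI[of _ 2])
  show "Z s / (s - 1) = f s" if "s \<in> {s. Re s > 1}" for s
    using assms(2)[of s] that by auto
qed (use assms(3) connected_punctured in \<open>auto simp: open_halfspace_Re_gt\<close>)

lemma zeta_eq: "s \<noteq> 1 \<Longrightarrow> zeta s = hurwitz_Z 1 s / (s - 1)"
  unfolding zeta_def
  by (rule continuation_from_half_plane) (auto simp: holomorphic_hurwitz_Z hurwitz_Z_series hseries_def add_ac)

lemma hurwitz_zeta_eq: "a > 0 \<Longrightarrow> s \<noteq> 1 \<Longrightarrow> hurwitz_zeta a s = hurwitz_Z a s / (s - 1)"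
  unfolding hurwitz_zeta_def
  by (rule continuation_from_half_plane) (auto simp: holomorphic_hurwitz_Z hurwitz_Z_series hseries_def)

text \<open>The solution \<open>\<beta>\<close> of
  \<open>1 / (1 + \<Delta>) = (1 + \<beta>) / 2\<close> for
  \<open>\<Delta> = 1 - \<epsilon>\<close>.\<close>

definition shift :: "real \<Rightarrow> real" where "shift \<epsilon> = \<epsilon> / (2 - \<epsilon>)"

lemma shift_bounds: "0 \<le> \<epsilon> \<Longrightarrow> \<epsilon> < 1 \<Longrightarrow> 0 \<le> shift \<epsilon> \<and> shift \<epsilon> < 1"
  "0 < \<epsilon> \<Longrightarrow> \<epsilon> < 1 \<Longrightarrow> 0 < shift \<epsilon>" "0 < \<epsilon> \<Longrightarrow> \<epsilon> < 1 \<Longrightarrow> shift \<epsilon> < \<epsilon>"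
  by (auto simp: shift_def field_simps)

lemma E_eq:
  assumes "0 \<le> \<epsilon>" "\<epsilon> < 1" "s \<noteq> 1"
  shows "E (1 - \<epsilon>) s = EZ (shift \<epsilon>) s / (s - 1)"
  unfolding E_def
proof (rule continuation_from_half_plane[OF _ _ assms(3)])
  note b = shift_bounds(1)[OF assms(1,2)]
  show "EZ (shift \<epsilon>) holomorphic_on UNIV" using b by (intro holomorphic_EZ) auto
  fix s assume s: "Re s > 1"
  hence s1: "s \<noteq> 1" by auto
  have e: "1 / (1 + (1 - \<epsilon>)) = (1 + shift \<epsilon>) / 2" "(1 - \<epsilon>) / (1 + (1 - \<epsilon>)) = (1 - shift \<epsilon>) / 2"
    using assms by (auto simp: shift_def field_simps)
  have p: "1 / 2 powr s = (2 powr (- s) :: complex)" "1 / 2 powr (s + 1) = (2 powr (- s) / 2 :: complex)"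
  proof -
    have m: "2 powr (- s) = inverse (2 powr s :: complex)" by (rule powr_minus)
    show "1 / 2 powr s = (2 powr (- s) :: complex)" unfolding m divide_inverse by (rule mult_1)
    show "1 / 2 powr (s + 1) = (2 powr (- s) / 2 :: complex)" unfolding m powr_add by (simp add: field_simps)
  qed
  have p': "(1 + shift \<epsilon>) / 2 > 0" "(1 - shift \<epsilon>) / 2 > 0" using b by auto
  show "EZ (shift \<epsilon>) s = (s - 1) * (1 / 2 powr s * zeta s + 1 / 2 powr (s + 1) * (hurwitz_zeta (1 / (1 + (1 - \<epsilon>))) s + hurwitz_zeta ((1 - \<epsilon>) / (1 + (1 - \<epsilon>))) s))"
    unfolding e p zeta_eq[OF s1] hurwitz_zeta_eq[OF p'(1) s1] hurwitz_zeta_eq[OF p'(2) s1] EZ_def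
  proof -
    have "q * (x + (y + z) / 2) = d * (q * (x / d) + q / 2 * (y / d + z / d))" if "d \<noteq> 0" for q x y z d :: complex
      using that by (simp add: field_simps)
    thus "2 powr (- s) * (hurwitz_Z 1 s + (hurwitz_Z ((1 + shift \<epsilon>) / 2) s + hurwitz_Z ((1 - shift \<epsilon>) / 2) s) / 2) =
      (s - 1) * (2 powr (- s) * (hurwitz_Z 1 s / (s - 1)) + 2 powr (- s) / 2 * (hurwitz_Z ((1 + shift \<epsilon>) / 2) s / (s - 1) + hurwitz_Z ((1 - shift \<epsilon>) / 2) s / (s - 1)))"
      using s1 by simp
  qed
qed

lemma EZ_1: "0 \<le> \<beta> \<Longrightarrow> \<beta> < 1 \<Longrightarrow> EZ \<beta> 1 = 1"
  by (simp add: EZ_def hurwitz_Z_1 powr_minus)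

text \<open>Passing to the entire function adds no zero at the excluded point 1, where
  \<open>EZ\<close> has the value 1.\<close>

lemma E_zeros_eq: "0 \<le> \<epsilon> \<Longrightarrow> \<epsilon> < 1 \<Longrightarrow> E_zeros (1 - \<epsilon>) = {s. EZ (shift \<epsilon>) s = 0}"
proof (rule set_eqI)
  fix s assume \<epsilon>: "0 \<le> \<epsilon>" "\<epsilon> < 1"
  show "s \<in> E_zeros (1 - \<epsilon>) \<longleftrightarrow> s \<in> {s. EZ (shift \<epsilon>) s = 0}"
    using E_eq[OF \<epsilon>, of s] EZ_1[of "shift \<epsilon>"] shift_bounds(1)[OF \<epsilon>] by (cases "s = 1") (simp_all add: E_zeros_def)
qed

lemma zeta_zeros_eq: "zeta_zeros = {s. hurwitz_Z 1 s = 0}"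
proof (rule set_eqI)
  fix s show "s \<in> zeta_zeros \<longleftrightarrow> s \<in> {s. hurwitz_Z 1 s = 0}"
    using zeta_eq[of s] hurwitz_Z_1[of 1] by (cases "s = 1") (simp_all add: zeta_zeros_def)
qed

lemma dirichlet_real_0:
  assumes "s > 1"
  shows "(\<lambda>n. real (Suc n) powr (- s)) sums dirichlet_real 0 s"
proof -
  have s: "(\<lambda>n. real (Suc n) powr (- s)) sums (\<Sum>n. real (Suc n) powr (- s))"
    by (intro summable_sums summable_M assms)
  have "(\<lambda>n. \<Sum>i\<in>{n * 2..<n * 2 + 2}. real (Suc i) powr (- s)) sums (\<Sum>n. real (Suc n) powr (- s))"
    by (rule sums_group[OF s]) simp
  moreover have "(\<Sum>i\<in>{n * 2..<n * 2 + 2}. real (Suc i) powr (- s)) = (2 * real n + 2) powr (- s) + (2 * real n + (1 + 0)) powr (- s) / 2 + (2 * real n + (1 - 0)) powr (- s) / 2" for n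
  proof -
    have "{n * 2..<n * 2 + 2} = {2 * n, Suc (2 * n)}" by auto
    thus ?thesis by (simp add: add_ac)
  qed
  ultimately have "(\<lambda>n. (2 * real n + 2) powr (- s) + (2 * real n + (1 + 0)) powr (- s) / 2 + (2 * real n + (1 - 0)) powr (- s) / 2) sums (\<Sum>n. real (Suc n) powr (- s))"
    by (simp only:)
  hence "(\<Sum>n. real (Suc n) powr (- s)) = dirichlet_real 0 s"
    unfolding dirichlet_real_def by (rule sums_unique)
  with s show ?thesis by (simp only:)
qed

text \<open>For \<open>\<beta> = 0\<close> the two series over odd bases coincide and, with weight
  1/2 each, fill the gaps between the even bases. The case \<open>\<beta> = 0\<close> thus is zeta
  itself, and whatever holds for \<open>EZ \<beta>\<close> with \<open>0 \<le> \<beta>\<close> also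
  covers zeta.\<close>

lemma EZ_0: "EZ 0 s = hurwitz_Z 1 s"
proof (rule holomorphic_eq_on_real_segment[where S = UNIV and a = 1 and b = 2 and z = s and f = "EZ 0"])
  fix x :: real assume x: "1 < x" "x < 2"
  have "(\<lambda>n. complex_of_real (real (Suc n) powr (- x))) sums of_real (dirichlet_real 0 x)"
    by (intro sums_of_real dirichlet_real_0 x)
  moreover have "complex_of_real (real (Suc n) powr (- x)) = (of_nat n + of_real 1) powr (- of_real x)" for n
    using powr_of_real[of "real (Suc n)" "- x"] by (simp add: add_ac)
  ultimately have "(\<lambda>n. (of_nat n + of_real 1) powr (- of_real x)) sums complex_of_real (dirichlet_real 0 x)"
    by (simp only:)
  hence "hseries 1 (of_real x) = of_real (dirichlet_real 0 x)"
    unfolding hseries_def by (rule sums_unique[symmetric])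
  thus "EZ 0 (of_real x) = hurwitz_Z 1 (of_real x)"
    using EZ_real[of 0 x] hurwitz_Z_series[of 1 "of_real x"] x by simp
qed (auto intro!: holomorphic_EZ holomorphic_hurwitz_Z)

text \<open>A finite sieve in place of an Euler product: removing the multiples of a prime
  \<open>p\<close> multiplies the sum by \<open>1 - p powr (-s)\<close>, of norm at most 2, and
  after finitely many primes only 1 and a tail of norm below 1/2 remain. The bound is uniform in
  \<open>Im s\<close>, as the comparison on vertical strips demands.\<close>

lemma hseries_1_lower_bound:
  assumes "a > 0"
  obtains \<delta> where "\<delta> > 0" "\<And>s. Re s \<ge> 1 + a \<Longrightarrow> norm (hseries 1 s) \<ge> \<delta>"
proof -
  define chi :: "nat \<Rightarrow> nat \<Rightarrow> complex" where "chi = (\<lambda>k n. if \<exists>p. prime p \<and> p \<le> k \<and> p dvd n then 0 else 1 :: complex)"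
  \<comment> \<open>The index 0 is harmless since \<open>0 powr (-s) = 0\<close>.\<close>
  define T where "T = (\<lambda>k s. \<Sum>n. chi k n * of_nat n powr (- s))"
  have nrm: "norm (of_nat n powr (- s) :: complex) = real n powr (- Re s)" for n s
    using norm_hterm[of 0 n s] by simp
  have sm0: "summable (\<lambda>n. real n powr (- Re s))" if "Re s > 1" for s
    using that by (simp add: summable_real_powr_iff)
  have chile: "norm (chi k n) \<le> 1" for k n by (simp add: chi_def)
  have tle: "norm (chi k n * of_nat n powr (- s)) \<le> real n powr (- Re s)" for k n s
    using mult_right_mono[OF chile[of k n], of "real n powr (- Re s)"] by (simp add: norm_mult nrm)
  have sm: "summable (\<lambda>n. chi k n * of_nat n powr (- s))" if "Re s > 1" for k s
    by (rule summable_comparison_test'[OF sm0[OF that]]) (rule tle)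
  have step: "norm (T (Suc k) s) \<le> 2 * norm (T k s)" if s: "Re s > 1" for k s
  proof (cases "prime (Suc k)")
    case False
    hence "chi (Suc k) = chi k" by (auto simp: chi_def le_Suc_eq fun_eq_iff)
    thus ?thesis by (simp add: T_def)
  next
    case True
    define p where "p = Suc k"
    have p: "prime p" using True by (simp add: p_def)
    define h where "h = (\<lambda>n. if p dvd n then chi k n * of_nat n powr (- s) else 0)"
    have mono: "strict_mono (\<lambda>m. p * m)" using prime_gt_0_nat[OF p] by (simp add: strict_mono_def)
    \<comment> \<open>The prime \<open>p\<close> exceeds \<open>k\<close>, so a factor
      \<open>p\<close> changes nothing about the prime divisors up to \<open>k\<close>.\<close>
    have chip: "chi k (p * m) = chi k m" for m
    proof -
      have "q dvd p * m \<longleftrightarrow> q dvd m" if "prime q" "q \<le> k" for q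
      proof
        assume "q dvd p * m"
        hence "q dvd p \<or> q dvd m" using that(1) prime_dvd_mult_iff by blast
        moreover have "\<not> q dvd p" using primes_dvd_imp_eq[OF that(1) p] that(2) by (auto simp: p_def)
        ultimately show "q dvd m" by blast
      qed simp
      thus ?thesis by (auto simp: chi_def)
    qed
    have "h (p * m) = of_nat p powr (- s) * (chi k m * of_nat m powr (- s))" for m
    proof -
      have "(of_nat (p * m) :: complex) powr (- s) = of_nat p powr (- s) * of_nat m powr (- s)"
        using powr_times_real[of "of_nat p" "of_nat m" "- s"] by simp
      thus ?thesis by (simp add: h_def chip)
    qed
    moreover have "(\<lambda>m. of_nat p powr (- s) * (chi k m * of_nat m powr (- s))) sums (of_nat p powr (- s) * T k s)"
      unfolding T_def by (intro sums_mult summable_sums sm s)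
    ultimately have "(\<lambda>m. h (p * m)) sums (of_nat p powr (- s) * T k s)" by (simp only:)
    hence h: "h sums (of_nat p powr (- s) * T k s)"
      by (subst (asm) sums_mono_reindex[OF mono]) (auto simp: h_def)
    have "(\<lambda>n. chi k n * of_nat n powr (- s) - h n) sums (T k s - of_nat p powr (- s) * T k s)"
      unfolding T_def by (intro sums_diff h[unfolded T_def] summable_sums sm s)
    moreover have "chi k n * of_nat n powr (- s) - h n = chi (Suc k) n * of_nat n powr (- s)" for n
    proof -
      have "chi (Suc k) n = (if p dvd n then 0 else chi k n)"
        using p by (auto simp: chi_def p_def le_Suc_eq)
      thus ?thesis by (simp add: h_def)
    qed
    ultimately have "(\<lambda>n. chi (Suc k) n * of_nat n powr (- s)) sums (T k s - of_nat p powr (- s) * T k s)" by (simp only:)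
    hence "T (Suc k) s = T k s - of_nat p powr (- s) * T k s"
      unfolding T_def by (rule sums_unique[symmetric])
    also have "\<dots> = (1 - of_nat p powr (- s)) * T k s" by (simp add: algebra_simps)
    finally have "norm (T (Suc k) s) = norm (1 - of_nat p powr (- s)) * norm (T k s)" by (simp only: norm_mult)
    also have "norm (1 - of_nat p powr (- s)) \<le> 2"
    proof -
      have "real p powr (- Re s) \<le> real p powr 0" using s prime_gt_0_nat[OF p] by (intro powr_mono) auto
      hence "norm (of_nat p powr (- s) :: complex) \<le> 1" using prime_gt_0_nat[OF p] by (simp add: nrm)
      thus ?thesis using norm_triangle_ineq4[of 1 "of_nat p powr (- s) :: complex"] by simp
    qed
    finally show ?thesis by (simp add: mult_right_mono)
  qed
  have pow: "norm (T k s) \<le> 2 ^ k * norm (T 0 s)" if "Re s > 1" for k s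
  proof (induction k)
    case (Suc k)
    thus ?case using step[OF that, of k] by simp
  qed simp
  have T0: "T 0 s = hseries 1 s" if "Re s > 1" for s
  proof -
    have "chi 0 n = 1" for n by (auto simp: chi_def dest: prime_gt_0_nat)
    hence "T 0 s = (\<Sum>n. of_nat n powr (- s))" by (simp add: T_def)
    also have "\<dots> = (\<Sum>n. of_nat (Suc n) powr (- s))"
      using suminf_split_head[OF sm[OF that, of 0]] \<open>\<And>n. chi 0 n = 1\<close> by simp
    finally show ?thesis by (simp add: hseries_def add_ac)
  qed
  have sma: "summable (\<lambda>n. real n powr (- (1 + a)))" using assms by (simp add: summable_real_powr_iff)
  obtain K where K: "\<And>n. n \<ge> K \<Longrightarrow> norm (\<Sum>i. real (i + n) powr (- (1 + a))) < 1 / 2"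
    using suminf_exist_split[OF _ sma, of "1/2"] by auto
  \<comment> \<open>Every \<open>n\<close> with \<open>2 \<le> n < k\<close> has a prime factor
    below \<open>k\<close> and is sieved out, while the tail from \<open>k\<close> on is below 1/2
    by the choice of \<open>K\<close>.\<close>
  define k where "k = K + 2"
  have main: "norm (T k s) \<ge> 1 / 2" if s: "Re s \<ge> 1 + a" for s
  proof -
    have s1: "Re s > 1" using s assms by simp
    have z: "chi k n * of_nat n powr (- s) = (if n = 1 then 1 else 0)" if "n < k" for n
    proof -
      consider "n = 0" | "n = 1" | "n \<ge> 2" by linarith
      thus ?thesis
      proof cases
        case 2
        have "\<not> (\<exists>p::nat. prime p \<and> p dvd 1)" by auto
        thus ?thesis using 2 by (auto simp: chi_def)
      next
        case 3
        then obtain p where "prime p" "p dvd n" using prime_factor_nat[of n] by auto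
        moreover have "p \<le> k" using dvd_imp_le[OF \<open>p dvd n\<close>] 3 that by simp
        ultimately have "chi k n = 0" by (auto simp: chi_def)
        thus ?thesis using 3 by simp
      qed auto
    qed
    have "T k s = (\<Sum>n. chi k (n + k) * of_nat (n + k) powr (- s)) + (\<Sum>n<k. chi k n * of_nat n powr (- s))"
      unfolding T_def by (rule suminf_split_initial_segment[OF sm[OF s1]])
    also have "(\<Sum>n<k. chi k n * of_nat n powr (- s)) = (\<Sum>n<k. if n = 1 then 1 else 0)"
      by (intro sum.cong refl z) simp
    also have "\<dots> = 1" by (simp add: k_def)
    finally have T: "T k s = (\<Sum>n. chi k (n + k) * of_nat (n + k) powr (- s)) + 1" .
    have "norm (\<Sum>n. chi k (n + k) * of_nat (n + k) powr (- s)) \<le> (\<Sum>n. real (n + k) powr (- (1 + a)))"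
    proof (rule norm_suminf_le)
      show "summable (\<lambda>n. real (n + k) powr (- (1 + a)))" using sma by (rule summable_ignore_initial_segment)
      show "norm (chi k (n + k) * of_nat (n + k) powr (- s)) \<le> real (n + k) powr (- (1 + a))" for n
        by (rule order_trans[OF tle]) (use s in \<open>intro powr_mono, auto simp: k_def\<close>)
    qed
    also have "\<dots> < 1 / 2" using K[of k] by (simp add: k_def)
    finally have "norm (T k s - 1) < 1 / 2" using T by simp
    thus ?thesis using norm_triangle_ineq2[of 1 "1 - T k s"] by (simp add: norm_minus_commute)
  qed
  show ?thesis
  proof (rule that[of "1 / 2 / 2 ^ k"])
    fix s assume s: "Re s \<ge> 1 + a"
    hence s1: "Re s > 1" using assms by simp
    have "1 / 2 \<le> 2 ^ k * norm (hseries 1 s)" using main[OF s] pow[OF s1, of k] T0[OF s1] by simp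
    thus "1 / 2 / 2 ^ k \<le> norm (hseries 1 s)" by (simp add: field_simps)
  qed simp
qed

text \<open>For \<open>\<beta> = 0\<close> the coefficients are 2 at even \<open>n\<close> and 0 at
  odd \<open>n\<close>; in the indexing from 0 the even \<open>n\<close> sit at the odd
  positions.\<close>

lemma Fser_0:
  assumes "Re w > 1"
  shows "Fser 0 w = 2 * 2 powr (- w) * hseries 1 w"
proof -
  have "(\<lambda>n. 2 * 2 powr (- w) * (of_nat n + of_real 1) powr (- w)) sums (2 * 2 powr (- w) * hseries 1 w)"
    unfolding hseries_def by (intro sums_mult summable_sums summable_hterm assms) auto
  moreover have "2 * 2 powr (- w) * (of_nat n + of_real 1) powr (- w) = (\<lambda>n. of_real (coef 0 (Suc n)) * of_nat (Suc n) powr (- w)) (Suc (2 * n))" for n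
  proof -
    have "(of_nat (Suc (Suc (2 * n))) :: complex) powr (- w) = 2 powr (- w) * (of_nat n + 1) powr (- w)"
      using powr_times_real[of 2 "of_nat n + 1" "- w"] by (simp add: algebra_simps)
    thus ?thesis by (simp add: coef_def del: of_nat_Suc)
  qed
  ultimately have *: "(\<lambda>n. (\<lambda>n. of_real (coef 0 (Suc n)) * of_nat (Suc n) powr (- w)) (Suc (2 * n))) sums (2 * 2 powr (- w) * hseries 1 w)"
    by (simp only:)
  have z: "of_real (coef 0 (Suc n)) * of_nat (Suc n) powr (- w) = 0" if "n \<notin> range (\<lambda>n. Suc (2 * n))" for n
  proof -
    have "even n" using that by (metis oddE rangeI Suc_eq_plus1)
    thus ?thesis by (simp add: coef_def)
  qed
  have "strict_mono (\<lambda>n::nat. Suc (2 * n))" by (auto simp: strict_mono_def)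
  from sums_mono_reindex[OF this, of "\<lambda>n. of_real (coef 0 (Suc n)) * of_nat (Suc n) powr (- w)"] z *
  have "(\<lambda>n. of_real (coef 0 (Suc n)) * of_nat (Suc n) powr (- w)) sums (2 * 2 powr (- w) * hseries 1 w)"
    by blast
  thus ?thesis unfolding Fser_def by (rule sums_unique[symmetric])
qed

lemma sin_zero_real: "sin (of_real pi * s / 2) = 0 \<Longrightarrow> Im s = 0"
proof -
  assume "sin (of_real pi * s / 2) = 0"
  then obtain n :: int where "of_real pi * s / 2 = of_real (real_of_int n * pi)" by (auto simp: sin_eq_0)
  hence "Im (of_real pi * s / 2) = 0" by simp
  thus "Im s = 0" by simp
qed

lemma EZ_left_zero_iff:
  assumes "0 \<le> \<beta>" "\<beta> < 1" "Re s < 0"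
  shows "EZ \<beta> s = 0 \<longleftrightarrow> sin (of_real pi * s / 2) = 0 \<or> Fser \<beta> (1 - s) = 0"
proof -
  have "Gamma (1 - s) \<noteq> 0"
    using assms(3) by (subst Gamma_eq_zero_iff) (auto elim!: nonpos_Ints_cases simp: complex_eq_iff)
  moreover have "s \<noteq> 1" using assms(3) by auto
  ultimately show ?thesis unfolding EZ_functional[OF assms] by auto
qed

lemma Fser_0_nonzero: "Re w > 1 \<Longrightarrow> Fser 0 w \<noteq> 0"
proof -
  assume w: "Re w > 1"
  then obtain \<delta> where "\<delta> > 0" "\<And>s. Re s \<ge> 1 + (Re w - 1) \<Longrightarrow> norm (hseries 1 s) \<ge> \<delta>"
    using hseries_1_lower_bound[of "Re w - 1"] by auto
  hence "hseries 1 w \<noteq> 0" by fastforce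
  thus ?thesis unfolding Fser_0[OF w] by simp
qed

text \<open>At \<open>\<beta> = 0\<close> the dual series has no zero, so only the sine is left. The
  sine does not depend on \<open>\<beta>\<close>, hence the trivial zeros are common to all
  \<open>EZ \<beta>\<close>.\<close>

lemma zeta_zeros_left:
  assumes "Re s < 0"
  shows "s \<in> zeta_zeros \<longleftrightarrow> sin (of_real pi * s / 2) = 0"
  using EZ_left_zero_iff[of 0 s] Fser_0_nonzero[of "1 - s"] assms by (simp add: zeta_zeros_eq EZ_0)

text \<open>\<open>Fser \<beta>\<close> differs from \<open>Fser 0\<close> by at most
  \<open>h \<beta>\<close>, which tends to 0 and does not involve \<open>Im w\<close>, whereas
  \<open>Fser 0\<close> is bounded below on the strip. The upper limit \<open>c\<close> is essential
  for that bound, since \<open>Fser 0\<close> decays like \<open>2 powr (-w)\<close>.\<close>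

lemma Fser_nonzero_middle:
  assumes "a > 0"
  obtains b where "b > 0" "b \<le> 1" "\<And>\<beta> w. 0 \<le> \<beta> \<Longrightarrow> \<beta> < b \<Longrightarrow> 1 + a \<le> Re w \<Longrightarrow> Re w \<le> c \<Longrightarrow> Fser \<beta> w \<noteq> 0"
proof -
  obtain \<delta> where \<delta>: "\<delta> > 0" "\<And>s. Re s \<ge> 1 + a \<Longrightarrow> norm (hseries 1 s) \<ge> \<delta>"
    using hseries_1_lower_bound[OF assms] by blast
  define m where "m = 2 * 2 powr (- c) * \<delta>"
  have m: "m > 0" using \<delta> by (simp add: m_def)
  define h where "h = (\<lambda>\<beta>. \<Sum>n. \<bar>coef \<beta> (Suc n) - coef 0 (Suc n)\<bar> * real (Suc n) powr (- (1 + a)))"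
  have smM: "summable (\<lambda>n. 2 * real (Suc n) powr (- (1 + a)))" by (intro summable_mult summable_M) (use assms in simp)
  have hle: "norm (\<bar>coef \<beta> (Suc n) - coef 0 (Suc n)\<bar> * real (Suc n) powr (- (1 + a))) \<le> 2 * real (Suc n) powr (- (1 + a))" for \<beta> n
  proof -
    have "\<bar>coef \<beta> (Suc n) - coef 0 (Suc n)\<bar> \<le> 2"
      using coef_le[of \<beta> "Suc n"] coef_le[of 0 "Suc n"] coef_nonneg[of \<beta> "Suc n"] coef_nonneg[of 0 "Suc n"] by linarith
    thus ?thesis by (simp add: abs_mult mult_right_mono del: of_nat_Suc)
  qed
  have "continuous_on UNIV h"
    unfolding h_def
    by (rule continuous_on_suminf[OF _ hle smM]) (unfold coef_def, intro continuous_intros)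
  hence "isCont h 0" by (simp add: continuous_on_eq_continuous_at)
  hence "h \<midarrow>0\<rightarrow> h 0" by (simp add: isCont_def)
  moreover have "h 0 = 0" by (simp add: h_def)
  ultimately obtain b where b: "b > 0" "\<And>\<beta>. \<beta> \<noteq> 0 \<Longrightarrow> norm (\<beta> - 0) < b \<Longrightarrow> norm (h \<beta> - 0) < m"
    using LIM_D[of h 0 0 m] m by auto
  have hb: "h \<beta> < m" if "0 \<le> \<beta>" "\<beta> < b" for \<beta>
    using b(2)[of \<beta>] that m \<open>h 0 = 0\<close> by (cases "\<beta> = 0") (auto simp: abs_less_iff)
  show ?thesis
  proof (rule that[of "min b 1"])
    fix \<beta> w assume *: "0 \<le> \<beta>" "\<beta> < min b 1" "1 + a \<le> Re w" "Re w \<le> c"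
    have w: "Re w > 1" using * assms by simp
    have "norm (Fser \<beta> w - Fser 0 w) = norm (\<Sum>n. of_real (coef \<beta> (Suc n) - coef 0 (Suc n)) * of_nat (Suc n) powr (- w))"
      unfolding Fser_def suminf_diff[OF summable_Fser[OF w] summable_Fser[OF w]] by (simp add: algebra_simps)
    also have "\<dots> \<le> h \<beta>"
      unfolding h_def
    proof (rule norm_suminf_le)
      show "summable (\<lambda>n. \<bar>coef \<beta> (Suc n) - coef 0 (Suc n)\<bar> * real (Suc n) powr (- (1 + a)))"
        by (rule summable_comparison_test'[OF smM]) (rule hle)
      show "norm (of_real (coef \<beta> (Suc n) - coef 0 (Suc n)) * of_nat (Suc n) powr (- w)) \<le> \<bar>coef \<beta> (Suc n) - coef 0 (Suc n)\<bar> * real (Suc n) powr (- (1 + a))" for n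
      proof -
        have "norm (of_nat (Suc n) powr (- w) :: complex) = real (Suc n) powr (- Re w)"
          using norm_hterm[of 0 "Suc n" w] by simp
        also have "\<dots> \<le> real (Suc n) powr (- (1 + a))" using * by (intro powr_mono) auto
        finally show ?thesis unfolding norm_mult norm_of_real by (intro mult_left_mono) auto
      qed
    qed
    also have "\<dots> < m" using * by (intro hb) auto
    also have "m \<le> norm (Fser 0 w)"
    proof -
      have "norm (2 powr (- w) :: complex) = 2 powr (- Re w)" using norm_powr_real_powr[of 2 "- w"] by simp
      moreover have "2 powr (- c) \<le> 2 powr (- Re w)" using * by (intro powr_mono) auto
      ultimately have "2 powr (- c) * \<delta> \<le> norm (2 powr (- w) :: complex) * norm (hseries 1 w)"
        using \<delta> * by (intro mult_mono) auto
      thus ?thesis unfolding Fser_0[OF w] by (simp add: m_def norm_mult)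
    qed
    finally show "Fser \<beta> w \<noteq> 0" by auto
  qed (use b in auto)
qed

section \<open>Zeros of the dual series far to the right\<close>

text \<open>The tail of a Dirichlet series with leading term 1; both the odd and the even half of
  \<open>Fser\<close> are brought to the form \<open>1 + psum p w\<close>.\<close>

definition psum :: "(nat \<Rightarrow> real) \<Rightarrow> complex \<Rightarrow> complex" where
  "psum p w = (\<Sum>n. of_real (p (n + 2)) * of_nat (n + 2) powr (- w))"

lemma inverse_squares_tail:
  shows summable_inverse_squares_2: "summable (\<lambda>n. real (n + 2) powr (-2))"
    and suminf_inverse_squares_2: "(\<Sum>n. real (n + 2) powr (-2)) \<le> 3"
    and summable_inverse_squares_4: "summable (\<lambda>n. real (n + 4) powr (-2))"
    and suminf_inverse_squares_4: "(\<Sum>n. real (n + 4) powr (-2)) \<le> 3"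
proof -
  have p: "real m powr (-2) = 1 / (real m)\<^sup>2" if "m > 0" for m
    using that powr_minus[of "real m" 2] by (simp add: inverse_eq_divide)
  have s1: "(\<lambda>n. real (Suc n) powr (-2)) sums (pi\<^sup>2 / 6)"
    using inverse_squares_sums by (simp add: p add_ac del: of_nat_Suc)
  have pi6: "pi\<^sup>2 / 6 \<le> 3"
  proof -
    have "pi\<^sup>2 \<le> 4\<^sup>2" using pi_less_4 pi_gt_zero by (intro power_mono) auto
    thus ?thesis by simp
  qed
  have s: "summable (\<lambda>n. real (Suc n) powr (-2))" using s1 by (simp add: sums_iff)
  have *: "summable (\<lambda>n. real (n + Suc k) powr (-2)) \<and> (\<Sum>n. real (n + Suc k) powr (-2)) \<le> 3" for k
  proof -
    have 1: "summable (\<lambda>n. real (Suc (n + k)) powr (-2))" by (rule summable_ignore_initial_segment[OF s])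
    have "(\<Sum>n. real (Suc n) powr (-2)) = (\<Sum>n. real (Suc (n + k)) powr (-2)) + (\<Sum>n<k. real (Suc n) powr (-2))"
      by (rule suminf_split_initial_segment[OF s])
    moreover have "(\<Sum>n<k. real (Suc n) powr (-2)) \<ge> 0" by (intro sum_nonneg) auto
    ultimately have "(\<Sum>n. real (Suc (n + k)) powr (-2)) \<le> 3" using s1 pi6 by (simp add: sums_iff)
    thus ?thesis using 1 by simp
  qed
  show "summable (\<lambda>n. real (n + 2) powr (-2))" "(\<Sum>n. real (n + 2) powr (-2)) \<le> 3"
     "summable (\<lambda>n. real (n + 4) powr (-2))" "(\<Sum>n. real (n + 4) powr (-2)) \<le> 3"
    using *[of 1] *[of 3] by (simp_all add: numeral_eq_Suc)
qed

lemma norm_nat_powr: "norm (of_nat n powr (- w) :: complex) = real n powr (- Re w)"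
  using norm_hterm[of 0 n w] by simp

lemma powr_tail_le:
  assumes "c \<le> 0" "m \<ge> k" "k > 0"
  shows "real m powr (c - 2) \<le> real k powr c * real m powr (-2)"
proof -
  have "real m powr (c - 2) = real m powr c * real m powr (-2)" by (simp flip: powr_add)
  also have "\<dots> \<le> real k powr c * real m powr (-2)"
    using assms by (intro mult_right_mono powr_mono2') auto
  finally show ?thesis .
qed

text \<open>The exponent \<open>2 - Re w\<close> is written as \<open>(4 - Re w) - 2\<close> in
  order to reserve a factor \<open>m powr (-2)\<close> for convergence; the rest decreases in
  \<open>m\<close> once \<open>Re w \<ge> 4\<close>.\<close>

lemma psum_term_le:
  assumes "\<bar>p m\<bar> \<le> (real m)\<^sup>2" "m > 0"
  shows "norm (complex_of_real (p m) * of_nat m powr (- w)) \<le> real m powr ((4 - Re w) - 2)"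
proof -
  have "norm (complex_of_real (p m) * of_nat m powr (- w)) \<le> (real m)\<^sup>2 * real m powr (- Re w)"
    unfolding norm_mult norm_nat_powr using assms by (intro mult_right_mono) auto
  also have "\<dots> = real m powr 2 * real m powr (- Re w)" using assms by (simp add: powr_numeral)
  also have "\<dots> = real m powr ((4 - Re w) - 2)" unfolding powr_add[symmetric] by (simp add: add.commute)
  finally show ?thesis .
qed

lemma psum_term_le':
  assumes "\<bar>p m\<bar> \<le> (real m)\<^sup>2" "m \<ge> k" "k > 0" "Re w \<ge> 4"
  shows "norm (complex_of_real (p m) * of_nat m powr (- w)) \<le> real k powr (4 - Re w) * real m powr (-2)"
  by (rule order_trans[OF psum_term_le powr_tail_le]) (use assms in auto)

lemma summable_psum:
  assumes "\<And>n. \<bar>p n\<bar> \<le> (real n)\<^sup>2" "Re w \<ge> 4"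
  shows "summable (\<lambda>n. complex_of_real (p (n + 2)) * of_nat (n + 2) powr (- w))"
  by (rule summable_comparison_test'[OF summable_mult[OF summable_inverse_squares_2, of "real 2 powr (4 - Re w)"]])
     (intro psum_term_le' assms, auto)

lemma norm_psum_le:
  assumes "\<And>n. \<bar>p n\<bar> \<le> (real n)\<^sup>2" "Re w \<ge> 4"
  shows "norm (psum p w) \<le> 48 * 2 powr (- Re w)"
proof -
  have "norm (psum p w) \<le> (\<Sum>n. real 2 powr (4 - Re w) * real (n + 2) powr (-2))"
    unfolding psum_def
    by (rule norm_suminf_le[OF _ summable_mult[OF summable_inverse_squares_2]]) (intro psum_term_le' assms, auto)
  also have "\<dots> = real 2 powr (4 - Re w) * (\<Sum>n. real (n + 2) powr (-2))"
    by (rule suminf_mult[OF summable_inverse_squares_2])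
  also have "\<dots> \<le> real 2 powr (4 - Re w) * 3" by (intro mult_left_mono suminf_inverse_squares_2) auto
  also have "real 2 powr (4 - Re w) = 16 * 2 powr (- Re w)"
    using powr_add[of 2 4 "- Re w"] by (simp add: powr_numeral)
  finally show ?thesis by simp
qed

text \<open>The remainder starts at \<open>n = 4\<close>, hence the constant
  \<open>768 = 4^4 * 3\<close>, where 3 bounds the sum of inverse squares; likewise
  \<open>48 = 2^4 * 3\<close> in \<open>norm_psum_le\<close>.\<close>

lemma psum_expand:
  assumes "\<And>n. \<bar>p n\<bar> \<le> (real n)\<^sup>2" "Re w \<ge> 4"
  shows "norm (psum p w - (of_real (p 2) * 2 powr (- w) + of_real (p 3) * 3 powr (- w))) \<le> 768 * 4 powr (- Re w)"
proof -
  have "psum p w = (\<Sum>n. complex_of_real (p (n + 2 + 2)) * of_nat (n + 2 + 2) powr (- w)) + (\<Sum>n<2. complex_of_real (p (n + 2)) * of_nat (n + 2) powr (- w))"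
    unfolding psum_def by (rule suminf_split_initial_segment[OF summable_psum[OF assms]])
  also have "(\<Sum>n<2. complex_of_real (p (n + 2)) * of_nat (n + 2) powr (- w)) = of_real (p 2) * 2 powr (- w) + of_real (p 3) * 3 powr (- w)"
    by (simp add: numeral_2_eq_2 numeral_3_eq_3)
  also have "(\<Sum>n. complex_of_real (p (n + 2 + 2)) * of_nat (n + 2 + 2) powr (- w)) = (\<Sum>n. complex_of_real (p (n + 4)) * of_nat (n + 4) powr (- w))"
  proof -
    have "n + 2 + 2 = n + 4" for n :: nat by simp
    thus ?thesis by (simp only:)
  qed
  finally have "psum p w - (of_real (p 2) * 2 powr (- w) + of_real (p 3) * 3 powr (- w)) = (\<Sum>n. complex_of_real (p (n + 4)) * of_nat (n + 4) powr (- w))"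
    by (simp only: add_diff_cancel_right')
  also have "norm \<dots> \<le> (\<Sum>n. real 4 powr (4 - Re w) * real (n + 4) powr (-2))"
    by (rule norm_suminf_le[OF _ summable_mult[OF summable_inverse_squares_4]]) (intro psum_term_le' assms, auto)
  also have "\<dots> = real 4 powr (4 - Re w) * (\<Sum>n. real (n + 4) powr (-2))"
    by (rule suminf_mult[OF summable_inverse_squares_4])
  also have "\<dots> \<le> real 4 powr (4 - Re w) * 3" by (intro mult_left_mono suminf_inverse_squares_4) auto
  also have "real 4 powr (4 - Re w) = 256 * 4 powr (- Re w)"
    using powr_add[of 4 4 "- Re w"] by (simp add: powr_numeral)
  finally show ?thesis by simp
qed

text \<open>The mean value inequality on a half-plane; the derivative brings in \<open>ln n\<close>,
  which is paid for by one power of \<open>n\<close>.\<close>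

lemma nat_powr_lipschitz:
  assumes "n > 0" "Re w \<ge> c" "Re z \<ge> c"
  shows "norm (of_nat n powr (- w) - of_nat n powr (- z) :: complex) \<le> real n powr (1 - c) * norm (w - z)"
proof (rule field_differentiable_bound[where S = "{w. Re w \<ge> c}" and f' = "\<lambda>w. - (of_real (ln (real n)) * of_nat n powr (- w))"])
  show "convex {w. c \<le> Re w}" by (rule convex_halfspace_Re_ge)
  show "((\<lambda>w. of_nat n powr (- w)) has_field_derivative - (of_real (ln (real n)) * of_nat n powr (- w))) (at w within {w. c \<le> Re w})" for w :: complex
  proof -
    have "((\<lambda>w. of_nat n powr (- w)) has_field_derivative (Ln (of_nat n) * of_nat n powr (- w)) * (-1)) (at w within {w. c \<le> Re w})"
      by (rule DERIV_chain2[OF has_field_derivative_powr_right]) (use assms in \<open>auto intro!: derivative_eq_intros\<close>)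
    moreover have "Ln (of_nat n) = of_real (ln (real n))" using Ln_of_real[of "real n"] assms by simp
    ultimately show ?thesis by simp
  qed
  show "norm (- (complex_of_real (ln (real n)) * of_nat n powr (- w))) \<le> real n powr (1 - c)" if "w \<in> {w. c \<le> Re w}" for w
  proof -
    have "norm (- (complex_of_real (ln (real n)) * of_nat n powr (- w))) = ln (real n) * real n powr (- Re w)"
      unfolding norm_minus_cancel norm_mult norm_nat_powr using assms by simp
    also have "\<dots> \<le> real n powr 1 * real n powr (- c)"
      using that assms ln_le_minus_one[of "real n"] by (intro mult_mono powr_mono) auto
    also have "\<dots> = real n powr (1 - c)" unfolding powr_add[symmetric] by simp
    finally show ?thesis .
  qed
qed (use assms in auto)

text \<open>For real part at least 15 the coefficient and the Lipschitz factor combine to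
  \<open>n^2 * n powr (1 - 15) = n powr (-12)\<close>. Keeping \<open>n powr (-2)\<close> for
  convergence leaves at most \<open>2 powr (-10)\<close>, and the inverse squares sum to at most
  3.\<close>

lemma psum_lipschitz:
  assumes p: "\<And>n. \<bar>p n\<bar> \<le> (real n)\<^sup>2" and w: "Re w \<ge> 15" "Re z \<ge> 15"
  shows "norm (psum p w - psum p z) \<le> 3 / 1024 * norm (w - z)"
proof -
  have "psum p w - psum p z = (\<Sum>n. complex_of_real (p (n + 2)) * of_nat (n + 2) powr (- w) - complex_of_real (p (n + 2)) * of_nat (n + 2) powr (- z))"
    unfolding psum_def by (rule suminf_diff; rule summable_psum[OF p]) (use w in auto)
  also have "norm \<dots> \<le> (\<Sum>n. (1 / 1024 * norm (w - z)) * real (n + 2) powr (-2))"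
  proof (rule norm_suminf_le[OF _ summable_mult[OF summable_inverse_squares_2]])
    fix n
    have "norm (complex_of_real (p (n + 2)) * of_nat (n + 2) powr (- w) - complex_of_real (p (n + 2)) * of_nat (n + 2) powr (- z))
       = \<bar>p (n + 2)\<bar> * norm (of_nat (n + 2) powr (- w) - of_nat (n + 2) powr (- z) :: complex)"
      unfolding right_diff_distrib[symmetric] norm_mult norm_of_real ..
    also have "\<dots> \<le> (real (n + 2))\<^sup>2 * (real (n + 2) powr (1 - 15) * norm (w - z))"
      by (intro mult_mono p nat_powr_lipschitz w) auto
    also have "\<dots> = real (n + 2) powr (-10 - 2) * norm (w - z)"
    proof -
      have "(real (n + 2))\<^sup>2 = real (n + 2) powr 2" by (simp add: powr_numeral)
      thus ?thesis by (simp only: mult.assoc[symmetric] powr_add[symmetric]) simp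
    qed
    also have "\<dots> \<le> (real 2 powr (-10) * real (n + 2) powr (-2)) * norm (w - z)"
      by (intro mult_right_mono powr_tail_le) auto
    also have "real 2 powr (-10) = 1 / 1024" using powr_minus[of "2::real" 10] by simp
    finally show "norm (complex_of_real (p (n + 2)) * of_nat (n + 2) powr (- w) - complex_of_real (p (n + 2)) * of_nat (n + 2) powr (- z))
       \<le> (1 / 1024 * norm (w - z)) * real (n + 2) powr (-2)" by (simp add: mult_ac)
  qed
  also have "\<dots> = (1 / 1024 * norm (w - z)) * (\<Sum>n. real (n + 2) powr (-2))"
    by (rule suminf_mult[OF summable_inverse_squares_2])
  also have "\<dots> \<le> (1 / 1024 * norm (w - z)) * 3" by (intro mult_left_mono suminf_inverse_squares_2) auto
  finally show ?thesis by simp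
qed

lemma continuous_on_psum:
  assumes "\<And>n. continuous_on S (\<lambda>x. p x n)" "\<And>x n. x \<in> S \<Longrightarrow> \<bar>p x n\<bar> \<le> (real n)\<^sup>2" "Re w \<ge> 4"
  shows "continuous_on S (\<lambda>x. psum (p x) w)"
  unfolding psum_def
proof (rule continuous_on_suminf[OF _ _ summable_mult[OF summable_inverse_squares_2, of "real 2 powr (4 - Re w)"]])
  show "continuous_on S (\<lambda>x. complex_of_real (p x (n + 2)) * of_nat (n + 2) powr (- w))" for n
    by (intro continuous_on_mult continuous_on_of_real continuous_on_const assms(1))
  show "norm (complex_of_real (p x (n + 2)) * of_nat (n + 2) powr (- w)) \<le> real 2 powr (4 - Re w) * real (n + 2) powr (-2)" if "x \<in> S" for n x
    by (rule psum_term_le'[OF assms(2)[OF that] _ _ assms(3)]) auto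
qed

section \<open>The dual series split by the parity of \<open>n\<close>\<close>

lemma abs_sin_mult_le: "\<bar>sin (real n * x)\<bar> \<le> real n * \<bar>sin x\<bar>"
proof (induction n)
  case (Suc n)
  have "\<bar>sin (real (Suc n) * x)\<bar> = \<bar>sin (real n * x) * cos x + cos (real n * x) * sin x\<bar>"
  proof -
    have "real (Suc n) * x = real n * x + x" by (simp add: algebra_simps)
    thus ?thesis by (simp only: sin_add)
  qed
  also have "\<dots> \<le> \<bar>sin (real n * x)\<bar> * \<bar>cos x\<bar> + \<bar>cos (real n * x)\<bar> * \<bar>sin x\<bar>"
    by (metis abs_mult abs_triangle_ineq)
  also have "\<dots> \<le> \<bar>sin (real n * x)\<bar> * 1 + 1 * \<bar>sin x\<bar>"
    by (intro add_mono mult_mono) auto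
  also have "\<dots> \<le> real (Suc n) * \<bar>sin x\<bar>" using Suc by (simp add: algebra_simps)
  finally show ?case .
qed simp

text \<open>By the half-angle formula this is the square of \<open>abs_sin_mult_le\<close>. It
  bounds the odd coefficients after division by \<open>c1 \<beta>\<close> uniformly in
  \<open>\<beta>\<close>, although \<open>c1 \<beta>\<close> tends to 0.\<close>

lemma one_minus_cos_le: "1 - cos (real n * x) \<le> (real n)\<^sup>2 * (1 - cos x)"
proof -
  have h: "1 - cos (y::real) = 2 * (sin (y / 2))\<^sup>2" for y
    using cos_double_sin[of "y / 2"] by simp
  have "(sin (real n * (x / 2)))\<^sup>2 \<le> (real n * \<bar>sin (x / 2)\<bar>)\<^sup>2"
    using abs_sin_mult_le[of n "x / 2"] by (subst power2_abs[symmetric]) (intro power_mono, auto)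
  thus ?thesis by (simp add: h power_mult_distrib)
qed

text \<open>\<open>c1\<close> and \<open>c2\<close> are the coefficients of \<open>Fser\<close> at
  \<open>n = 1\<close> and \<open>n = 2\<close>; \<open>odd_coef\<close> normalises the odd
  coefficients by \<open>c1\<close>, and \<open>even_coef\<close> those at \<open>2 * n\<close> by
  \<open>c2\<close>. The cut-off at 2 in \<open>even_coef\<close> makes the bound \<open>n^2\<close>
  valid at \<open>n = 0\<close> too.\<close>

definition c1 :: "real \<Rightarrow> real" where "c1 \<beta> = 1 - cos (pi * \<beta>)"
definition c2 :: "real \<Rightarrow> real" where "c2 \<beta> = 1 + cos (2 * pi * \<beta>)"
definition odd_coef :: "real \<Rightarrow> nat \<Rightarrow> real" where
  "odd_coef \<beta> n = (if odd n then (1 - cos (real n * (pi * \<beta>))) / c1 \<beta> else 0)"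
definition even_coef :: "real \<Rightarrow> nat \<Rightarrow> real" where
  "even_coef \<beta> n = (if n \<ge> 2 then (1 + cos (2 * pi * real n * \<beta>)) / c2 \<beta> else 0)"

lemma c1_pos: "0 < \<beta> \<Longrightarrow> \<beta> < 1 \<Longrightarrow> c1 \<beta> > 0"
proof -
  assume b: "0 < \<beta>" "\<beta> < 1"
  have "cos (pi * \<beta>) < cos 0" using b by (intro cos_monotone_0_pi) (auto simp: mult_le_cancel_left1)
  thus ?thesis by (simp add: c1_def)
qed

lemma c2_ge: "0 < \<beta> \<Longrightarrow> \<beta> \<le> 1 / 4 \<Longrightarrow> c2 \<beta> \<ge> 1"
proof -
  assume b: "0 < \<beta>" "\<beta> \<le> 1 / 4"
  have "pi * (2 * \<beta>) \<le> pi * (1 / 2)" using b by (intro mult_left_mono) auto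
  hence "cos (2 * pi * \<beta>) \<ge> 0" using b by (intro cos_ge_zero) (auto simp: mult_ac intro: order_trans[of _ 0])
  thus ?thesis by (simp add: c2_def)
qed

lemma odd_coef_bound: 
  assumes "0 < \<beta>" "\<beta> < 1"
  shows "\<bar>odd_coef \<beta> n\<bar> \<le> (real n)\<^sup>2"
proof -
  have "0 \<le> (1 - cos (real n * (pi * \<beta>))) / c1 \<beta>" using c1_pos[OF assms] by simp
  moreover have "(1 - cos (real n * (pi * \<beta>))) / c1 \<beta> \<le> (real n)\<^sup>2"
    using one_minus_cos_le[of n "pi * \<beta>"] c1_pos[OF assms] by (simp add: c1_def pos_divide_le_eq)
  ultimately show ?thesis by (simp add: odd_coef_def)
qed

lemma even_coef_bound: 
  assumes "0 < \<beta>" "\<beta> \<le> 1 / 4"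
  shows "\<bar>even_coef \<beta> n\<bar> \<le> (real n)\<^sup>2"
proof (cases "n \<ge> 2")
  case True
  have "(1 + cos (2 * pi * real n * \<beta>)) / c2 \<beta> \<le> 2 / 1"
    using c2_ge[OF assms] by (intro frac_le) auto
  moreover have "2\<^sup>2 \<le> (real n)\<^sup>2" using True by (intro power_mono) auto
  moreover have "0 \<le> (1 + cos (2 * pi * real n * \<beta>)) / c2 \<beta>"
    using c2_ge[OF assms] cos_ge_minus_one[of "2 * pi * real n * \<beta>"] by (intro divide_nonneg_nonneg) linarith+
  ultimately show ?thesis using True by (simp add: even_coef_def)
qed (simp add: even_coef_def)

lemma Fser_split:
  assumes \<beta>: "0 < \<beta>" "\<beta> \<le> 1 / 4" and w: "Re w \<ge> 4"
  shows "Fser \<beta> w = of_real (c1 \<beta>) * (1 + psum (odd_coef \<beta>) w) + of_real (c2 \<beta>) * 2 powr (- w) * (1 + psum (even_coef \<beta>) w)"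
proof -
  note c1 = c1_pos[OF \<beta>(1)] and c2 = c2_ge[OF \<beta>]
  define fo where "fo = (\<lambda>n. if odd n then complex_of_real (coef \<beta> n) * of_nat n powr (- w) else 0)"
  define fe where "fe = (\<lambda>n. if even n then complex_of_real (coef \<beta> n) * of_nat n powr (- w) else 0)"
  have "(\<lambda>n. of_real (c1 \<beta>) * (complex_of_real (odd_coef \<beta> (n + 2)) * of_nat (n + 2) powr (- w))) sums (of_real (c1 \<beta>) * psum (odd_coef \<beta>) w)"
    unfolding psum_def by (intro sums_mult summable_sums summable_psum odd_coef_bound w) (use \<beta> in auto)
  moreover have "of_real (c1 \<beta>) * (complex_of_real (odd_coef \<beta> (n + 2)) * of_nat (n + 2) powr (- w)) = fo (n + 2)" for n
  proof -
    have "c1 \<beta> * odd_coef \<beta> (n + 2) = (if odd (n + 2) then coef \<beta> (n + 2) else 0)"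
      using c1 \<beta> by (simp add: odd_coef_def coef_def mult_ac)
    thus ?thesis unfolding mult.assoc[symmetric] of_real_mult[symmetric] by (simp add: fo_def)
  qed
  ultimately have "(\<lambda>n. fo (n + 2)) sums (of_real (c1 \<beta>) * psum (odd_coef \<beta>) w)" by (simp only:)
  hence "fo sums (of_real (c1 \<beta>) * psum (odd_coef \<beta>) w + (\<Sum>i<2. fo i))"
    by (simp only: sums_iff_shift)
  moreover have "(\<Sum>i<2. fo i) = of_real (c1 \<beta>)"
    by (simp add: fo_def numeral_2_eq_2 coef_def c1_def)
  ultimately have fo: "fo sums (of_real (c1 \<beta>) * (1 + psum (odd_coef \<beta>) w))"
    by (simp add: algebra_simps)
  have pw: "(of_nat (2 * m) :: complex) powr (- w) = 2 powr (- w) * of_nat m powr (- w)" for m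
    using powr_times_real[of 2 "of_nat m" "- w"] by simp
  have "(\<lambda>n. of_real (c2 \<beta>) * 2 powr (- w) * (complex_of_real (even_coef \<beta> (n + 2)) * of_nat (n + 2) powr (- w))) sums (of_real (c2 \<beta>) * 2 powr (- w) * psum (even_coef \<beta>) w)"
    unfolding psum_def by (intro sums_mult summable_sums summable_psum even_coef_bound w) (use \<beta> in auto)
  moreover have "of_real (c2 \<beta>) * 2 powr (- w) * (complex_of_real (even_coef \<beta> (n + 2)) * of_nat (n + 2) powr (- w)) = fe (2 * (n + 2))" for n
  proof -
    have "c2 \<beta> * even_coef \<beta> (n + 2) = coef \<beta> (2 * (n + 2))"
      using c2 by (simp add: even_coef_def coef_def mult_ac)
    hence "complex_of_real (coef \<beta> (2 * (n + 2))) = of_real (c2 \<beta>) * of_real (even_coef \<beta> (n + 2))"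
      by (simp only: of_real_mult[symmetric])
    moreover have "fe (2 * (n + 2)) = of_real (coef \<beta> (2 * (n + 2))) * of_nat (2 * (n + 2)) powr (- w)"
      unfolding fe_def by simp
    ultimately show ?thesis by (simp only: pw mult.assoc mult.left_commute)
  qed
  ultimately have "(\<lambda>n. fe (2 * (n + 2))) sums (of_real (c2 \<beta>) * 2 powr (- w) * psum (even_coef \<beta>) w)" by (simp only:)
  hence "(\<lambda>n. fe (2 * n)) sums (of_real (c2 \<beta>) * 2 powr (- w) * psum (even_coef \<beta>) w + (\<Sum>i<2. fe (2 * i)))"
    by (subst (asm) sums_iff_shift[of "\<lambda>n. fe (2 * n)"]) simp
  moreover have "(\<Sum>i<2. fe (2 * i)) = of_real (c2 \<beta>) * 2 powr (- w)"
    by (simp add: fe_def numeral_2_eq_2 coef_def c2_def mult_ac)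
  moreover have "(\<lambda>n. fe (2 * n)) sums c \<longleftrightarrow> fe sums c" for c
  proof (rule sums_mono_reindex)
    show "strict_mono (\<lambda>n::nat. 2 * n)" by (auto simp: strict_mono_def)
    fix n assume "n \<notin> range (\<lambda>n::nat. 2 * n)"
    hence "odd n" by (metis evenE rangeI)
    thus "fe n = 0" by (simp add: fe_def)
  qed
  ultimately have fe: "fe sums (of_real (c2 \<beta>) * 2 powr (- w) * (1 + psum (even_coef \<beta>) w))"
    by (simp add: algebra_simps)
  have "(\<lambda>n. fo n + fe n) sums (of_real (c1 \<beta>) * (1 + psum (odd_coef \<beta>) w) + of_real (c2 \<beta>) * 2 powr (- w) * (1 + psum (even_coef \<beta>) w))"
    by (rule sums_add[OF fo fe])
  moreover have "fo n + fe n = complex_of_real (coef \<beta> n) * of_nat n powr (- w)" for n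
    by (simp add: fo_def fe_def)
  ultimately have "(\<lambda>n. complex_of_real (coef \<beta> n) * of_nat n powr (- w)) sums (of_real (c1 \<beta>) * (1 + psum (odd_coef \<beta>) w) + of_real (c2 \<beta>) * 2 powr (- w) * (1 + psum (even_coef \<beta>) w))"
    by (simp only:)
  hence "(\<lambda>n. complex_of_real (coef \<beta> (Suc n)) * of_nat (Suc n) powr (- w)) sums (of_real (c1 \<beta>) * (1 + psum (odd_coef \<beta>) w) + of_real (c2 \<beta>) * 2 powr (- w) * (1 + psum (even_coef \<beta>) w))"
    by (subst sums_Suc_iff) simp
  thus ?thesis unfolding Fser_def by (rule sums_unique[symmetric])
qed

section \<open>The fixed point equation on \<open>Re w \<ge> 15\<close>\<close>

definition ratio :: "real \<Rightarrow> real" where "ratio \<beta> = c1 \<beta> / c2 \<beta>"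

definition Lfun :: "real \<Rightarrow> complex \<Rightarrow> complex" where
  "Lfun \<beta> w = Ln (1 + psum (odd_coef \<beta>) w) - Ln (1 + psum (even_coef \<beta>) w)"

text \<open>The logarithm of \<open>2 powr (-w) = - ratio \<beta> * (1 + A) / (1 + B)\<close>,
  solved for \<open>w\<close>. The minus sign contributes odd multiples of \<open>pi * \<i>\<close>;
  this is where the odd lattice originates.\<close>

definition Gmap :: "real \<Rightarrow> int \<Rightarrow> complex \<Rightarrow> complex" where
  "Gmap \<beta> k w = - (of_real (ln (ratio \<beta>)) + of_real (of_int (2 * k + 1) * pi) * \<i> + Lfun \<beta> w) / of_real (ln 2)"

text \<open>Since \<open>15 * ln 2 \<le> 10.5\<close> and \<open>Lfun\<close> is at most 1/100, the
  bound -12 makes every \<open>Gmap \<beta> k\<close> map the half-plane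
  \<open>Re w \<ge> 15\<close> into itself; \<open>\<beta> \<le> 1 / 4\<close> keeps
  \<open>c2 \<beta> \<ge> 1\<close>.\<close>

definition admissible :: "real \<Rightarrow> bool" where
  "admissible \<beta> \<longleftrightarrow> 0 < \<beta> \<and> \<beta> \<le> 1 / 4 \<and> ln (ratio \<beta>) \<le> -12"

lemma ratio_pos: "0 < \<beta> \<Longrightarrow> \<beta> \<le> 1 / 4 \<Longrightarrow> ratio \<beta> > 0"
  using c1_pos[of \<beta>] c2_ge[of \<beta>] by (simp add: ratio_def)

lemma eventually_admissible: "\<forall>\<^sub>F \<beta> in at_right 0. admissible \<beta>"
proof -
  have "(ratio \<longlongrightarrow> 0) (at_right 0)"
    unfolding ratio_def[abs_def] c1_def c2_def by (auto intro!: tendsto_eq_intros)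
  hence "\<forall>\<^sub>F \<beta> in at_right 0. ratio \<beta> < exp (-12)" by (rule order_tendstoD) simp
  moreover have "\<forall>\<^sub>F \<beta>::real in at_right 0. 0 < \<beta> \<and> \<beta> < 1 / 4"
    using eventually_at_right_real[of 0 "1/4"] by simp
  ultimately show ?thesis
  proof eventually_elim
    case (elim \<beta>)
    have "ln (ratio \<beta>) \<le> ln (exp (-12))" using elim ratio_pos[of \<beta>] by (intro ln_mono) auto
    thus ?case using elim by (simp add: admissible_def)
  qed
qed

lemma ln2_bounds: "ln (2::real) \<le> 7 / 10" "ln (2::real) \<ge> 1 / 2"
  using ln2_le_25_over_36 ln2_ge_two_thirds by linarith+

lemma two_powr_neg_le: "15 \<le> x \<Longrightarrow> (2::real) powr (- x) \<le> 1 / 32768"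
proof -
  assume "15 \<le> x"
  hence "(2::real) powr (- x) \<le> 2 powr (- 15)" by (intro powr_mono) auto
  also have "(2::real) powr (- 15) = 1 / 32768" using powr_minus[of "2::real" 15] by simp
  finally show ?thesis .
qed

lemma Ln_lipschitz:
  assumes "norm x \<le> 1 / 2" "norm y \<le> 1 / 2"
  shows "norm (Ln (1 + x) - Ln (1 + y)) \<le> 2 * norm (x - y)"
proof (rule field_differentiable_bound[where S = "cball 0 (1 / 2)" and f' = "\<lambda>z. inverse (1 + z)"])
  fix z :: complex assume z: "z \<in> cball 0 (1 / 2)"
  have Rz: "Re (1 + z) \<ge> 1 / 2" using abs_Re_le_cmod[of z] z by auto
  hence nz: "1 + z \<notin> \<real>\<^sub>\<le>\<^sub>0" by (auto simp: complex_nonpos_Reals_iff)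
  show "((\<lambda>z. Ln (1 + z)) has_field_derivative inverse (1 + z)) (at z within cball 0 (1 / 2))"
    using nz by (auto intro!: derivative_eq_intros simp: inverse_eq_divide)
  have "1 / 2 \<le> norm (1 + z)" using Rz complex_Re_le_cmod[of "1 + z"] by linarith
  thus "norm (inverse (1 + z)) \<le> 2" unfolding norm_inverse using le_imp_inverse_le[of "1/2" "norm (1 + z)"] by simp
qed (use assms in auto)

context
  fixes \<beta> :: real
  assumes adm: "admissible \<beta>"
begin

lemma adm_bounds: "0 < \<beta>" "\<beta> \<le> 1 / 4" "\<beta> < 1" using adm by (auto simp: admissible_def)

lemma psum_small:
  assumes "Re w \<ge> 15"
  shows "norm (psum (odd_coef \<beta>) w) \<le> 48 * 2 powr (- Re w)" "norm (psum (even_coef \<beta>) w) \<le> 48 * 2 powr (- Re w)"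
    "norm (psum (odd_coef \<beta>) w) \<le> 1 / 512" "norm (psum (even_coef \<beta>) w) \<le> 1 / 512"
proof -
  show 1: "norm (psum (odd_coef \<beta>) w) \<le> 48 * 2 powr (- Re w)" "norm (psum (even_coef \<beta>) w) \<le> 48 * 2 powr (- Re w)"
    using assms adm_bounds by (auto intro!: norm_psum_le odd_coef_bound even_coef_bound)
  show "norm (psum (odd_coef \<beta>) w) \<le> 1 / 512" "norm (psum (even_coef \<beta>) w) \<le> 1 / 512"
    using 1 two_powr_neg_le[OF assms] by linarith+
qed

lemma Lfun_small:
  assumes "Re w \<ge> 15"
  shows "norm (Lfun \<beta> w) \<le> 192 * 2 powr (- Re w)" "norm (Lfun \<beta> w) \<le> 1 / 100"
proof -
  have "norm (Lfun \<beta> w) \<le> norm (Ln (1 + psum (odd_coef \<beta>) w)) + norm (Ln (1 + psum (even_coef \<beta>) w))"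
    unfolding Lfun_def by (rule norm_triangle_ineq4)
  also have "\<dots> \<le> 2 * norm (psum (odd_coef \<beta>) w) + 2 * norm (psum (even_coef \<beta>) w)"
    using psum_small[OF assms] by (intro add_mono norm_Ln_le) auto
  finally show "norm (Lfun \<beta> w) \<le> 192 * 2 powr (- Re w)" "norm (Lfun \<beta> w) \<le> 1 / 100"
    using psum_small[OF assms] by linarith+
qed

lemma Lfun_lipschitz:
  assumes "Re w \<ge> 15" "Re z \<ge> 15"
  shows "norm (Lfun \<beta> w - Lfun \<beta> z) \<le> 1 / 4 * norm (w - z)"
proof -
  have "Lfun \<beta> w - Lfun \<beta> z = (Ln (1 + psum (odd_coef \<beta>) w) - Ln (1 + psum (odd_coef \<beta>) z)) - (Ln (1 + psum (even_coef \<beta>) w) - Ln (1 + psum (even_coef \<beta>) z))"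
    by (simp add: Lfun_def)
  also have "norm \<dots> \<le> norm (Ln (1 + psum (odd_coef \<beta>) w) - Ln (1 + psum (odd_coef \<beta>) z)) + norm (Ln (1 + psum (even_coef \<beta>) w) - Ln (1 + psum (even_coef \<beta>) z))"
    by (rule norm_triangle_ineq4)
  also have "\<dots> \<le> 2 * norm (psum (odd_coef \<beta>) w - psum (odd_coef \<beta>) z) + 2 * norm (psum (even_coef \<beta>) w - psum (even_coef \<beta>) z)"
    using psum_small[OF assms(1)] psum_small[OF assms(2)] by (intro add_mono Ln_lipschitz) linarith+
  also have "\<dots> \<le> 2 * (3 / 1024 * norm (w - z)) + 2 * (3 / 1024 * norm (w - z))"
    using adm_bounds assms by (intro add_mono mult_left_mono psum_lipschitz odd_coef_bound even_coef_bound) auto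
  also have "\<dots> \<le> 1 / 4 * norm (w - z)" by simp
  finally show ?thesis .
qed

lemma Gmap_lipschitz:
  assumes "Re w \<ge> 15" "Re z \<ge> 15"
  shows "norm (Gmap \<beta> k w - Gmap \<beta> k z) \<le> 1 / 2 * norm (w - z)"
proof -
  have "Gmap \<beta> k w - Gmap \<beta> k z = - ((Lfun \<beta> w - Lfun \<beta> z) / of_real (ln 2))"
    unfolding Gmap_def by (simp add: diff_divide_distrib add_divide_distrib)
  hence "norm (Gmap \<beta> k w - Gmap \<beta> k z) = norm (Lfun \<beta> w - Lfun \<beta> z) / ln 2"
    by (simp add: norm_divide)
  also have "\<dots> \<le> (1 / 4 * norm (w - z)) / (1 / 2)"
    using ln2_bounds by (intro frac_le Lfun_lipschitz assms) auto
  finally show ?thesis by simp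
qed

lemma Re_Gmap: "Re (Gmap \<beta> k w) = - (ln (ratio \<beta>) + Re (Lfun \<beta> w)) / ln 2"
  and Im_Gmap: "Im (Gmap \<beta> k w) = - (of_int (2 * k + 1) * pi + Im (Lfun \<beta> w)) / ln 2"
  unfolding Gmap_def by (simp_all add: Re_divide_of_real Im_divide_of_real)

lemma Gmap_maps: "Re w \<ge> 15 \<Longrightarrow> Re (Gmap \<beta> k w) \<ge> 15"
proof -
  assume w: "Re w \<ge> 15"
  have "Re (Lfun \<beta> w) \<le> 1 / 100" using Lfun_small(2)[OF w] abs_Re_le_cmod[of "Lfun \<beta> w"] by linarith
  hence "15 * ln 2 \<le> - (ln (ratio \<beta>) + Re (Lfun \<beta> w))"
    using adm ln2_bounds by (auto simp: admissible_def)
  thus ?thesis unfolding Re_Gmap by (simp add: pos_le_divide_eq)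
qed

lemma wfix_ex1: "\<exists>!w. Re w \<ge> 15 \<and> Gmap \<beta> k w = w"
proof -
  have "\<exists>!w\<in>{w. Re w \<ge> 15}. Gmap \<beta> k w = w"
  proof (rule Banach_fix[where c = "1/2"])
    show "complete {w. Re w \<ge> 15}" by (simp add: complete_eq_closed closed_halfspace_Re_ge)
    show "{w. Re w \<ge> 15} \<noteq> {}" by (auto intro!: exI[of _ 15])
    show "dist (Gmap \<beta> k x) (Gmap \<beta> k y) \<le> 1 / 2 * dist x y" if "x \<in> {w. Re w \<ge> 15}" "y \<in> {w. Re w \<ge> 15}" for x y
      using Gmap_lipschitz[of x y k] that by (simp add: dist_norm)
  qed (use Gmap_maps in auto)
  thus ?thesis by simp
qed

text \<open>The integer \<open>k\<close> is the ambiguity of the complex logarithm. As all solutions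
  of the exponential equation are captured, uniqueness of the fixed points will show that the family
  of zeros is complete in this half-plane.\<close>

lemma Fser_zero_iff:
  assumes w: "Re w \<ge> 15"
  shows "Fser \<beta> w = 0 \<longleftrightarrow> (\<exists>k. Gmap \<beta> k w = w)"
proof -
  note b = adm_bounds
  define A where "A = psum (odd_coef \<beta>) w"
  define B where "B = psum (even_coef \<beta>) w"
  have AB: "norm A < 1" "norm B < 1" using psum_small[OF w] by (auto simp: A_def B_def)
  have nz1: "1 + z \<noteq> 0" if "norm z < 1" for z :: complex
  proof
    assume "1 + z = 0"
    hence "z = - 1" by (simp add: add_eq_0_iff)
    thus False using that by simp
  qed
  have nz: "1 + A \<noteq> 0" "1 + B \<noteq> 0" using nz1 AB by auto
  have r: "ratio \<beta> > 0" "c1 \<beta> > 0" "c2 \<beta> > 0" using ratio_pos c1_pos c2_ge b by (auto intro: less_le_trans[OF zero_less_one])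
  have two: "2 powr (- w) = exp (- w * of_real (ln 2))"
    using Ln_of_real[of 2] by (simp add: powr_def mult_ac)
  have L: "exp (Lfun \<beta> w) = (1 + A) / (1 + B)"
    unfolding Lfun_def exp_diff using nz by (simp add: A_def B_def)
  have eq: "exp (of_real (ln (ratio \<beta>)) + of_real pi * \<i> + Lfun \<beta> w) = - (of_real (ratio \<beta>) * ((1 + A) / (1 + B)))"
    unfolding exp_add L using r by (simp add: exp_of_real)
  have "Fser \<beta> w = 0 \<longleftrightarrow> of_real (c2 \<beta>) * 2 powr (- w) * (1 + B) = - (of_real (c1 \<beta>) * (1 + A))"
    using Fser_split[of \<beta> w] b w by (simp add: A_def B_def eq_neg_iff_add_eq_0 add.commute)
  also have "\<dots> \<longleftrightarrow> 2 powr (- w) = - (of_real (ratio \<beta>) * ((1 + A) / (1 + B)))"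
  proof -
    have "C2 * x * d = - (C1 * n) \<longleftrightarrow> x = - (C1 / C2 * (n / d))" if "C2 \<noteq> 0" "d \<noteq> 0" for C1 C2 x d n :: complex
    proof -
      have "- (C1 / C2 * (n / d)) = - (C1 * n) / (C2 * d)" by simp
      moreover have "x = - (C1 * n) / (C2 * d) \<longleftrightarrow> x * (C2 * d) = - (C1 * n)"
        using that by (simp only: eq_divide_eq) simp
      ultimately show ?thesis by (simp add: mult_ac)
    qed
    from this[of "of_real (c2 \<beta>)" "1 + B" "2 powr (- w)" "of_real (c1 \<beta>)" "1 + A"] show ?thesis
      using r nz by (simp add: ratio_def)
  qed
  also have "\<dots> \<longleftrightarrow> exp (- w * of_real (ln 2)) = exp (of_real (ln (ratio \<beta>)) + of_real pi * \<i> + Lfun \<beta> w)"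
    unfolding eq two ..
  also have "\<dots> \<longleftrightarrow> (\<exists>k::int. - w * of_real (ln 2) = of_real (ln (ratio \<beta>)) + of_real pi * \<i> + Lfun \<beta> w + (of_int (2 * k) * pi) * \<i>)"
    by (rule exp_eq)
  also have "\<dots> \<longleftrightarrow> (\<exists>k. Gmap \<beta> k w = w)"
  proof (intro ex_cong1)
    fix k :: int
    have nz2: "complex_of_real (ln 2) \<noteq> 0" by simp
    have "Gmap \<beta> k w = w \<longleftrightarrow> - (of_real (ln (ratio \<beta>)) + of_real (of_int (2 * k + 1) * pi) * \<i> + Lfun \<beta> w) = w * of_real (ln 2)"
      unfolding Gmap_def by (rule nonzero_divide_eq_eq[OF nz2])
    also have "\<dots> \<longleftrightarrow> - w * of_real (ln 2) = of_real (ln (ratio \<beta>)) + of_real pi * \<i> + Lfun \<beta> w + (of_int (2 * k) * pi) * \<i>"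
    proof -
      have "of_real (ln (ratio \<beta>)) + of_real pi * \<i> + Lfun \<beta> w + (of_int (2 * k) * pi) * \<i> = of_real (ln (ratio \<beta>)) + of_real (of_int (2 * k + 1) * pi) * \<i> + Lfun \<beta> w"
        by (simp add: algebra_simps)
      moreover have "- x = w * of_real (ln 2) \<longleftrightarrow> - w * of_real (ln 2) = x" for x
        using minus_equation_iff[of x "w * of_real (ln 2)"] by simp
      ultimately show ?thesis by (simp only:)
    qed
    finally show "- w * of_real (ln 2) = of_real (ln (ratio \<beta>)) + of_real pi * \<i> + Lfun \<beta> w + (of_int (2 * k) * pi) * \<i> \<longleftrightarrow> Gmap \<beta> k w = w" by simp
  qed
  finally show ?thesis .
qed

end

definition wfix :: "real \<Rightarrow> int \<Rightarrow> complex" where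
  "wfix \<beta> k = (THE w. Re w \<ge> 15 \<and> Gmap \<beta> k w = w)"

lemma wfix:
  assumes "admissible \<beta>"
  shows "Re (wfix \<beta> k) \<ge> 15" "Gmap \<beta> k (wfix \<beta> k) = wfix \<beta> k" "Re w \<ge> 15 \<Longrightarrow> Gmap \<beta> k w = w \<Longrightarrow> w = wfix \<beta> k"
proof -
  have "Re (wfix \<beta> k) \<ge> 15 \<and> Gmap \<beta> k (wfix \<beta> k) = wfix \<beta> k"
    unfolding wfix_def by (rule theI'[OF wfix_ex1[OF assms]])
  thus *: "Re (wfix \<beta> k) \<ge> 15" "Gmap \<beta> k (wfix \<beta> k) = wfix \<beta> k" by auto
  show "Re w \<ge> 15 \<Longrightarrow> Gmap \<beta> k w = w \<Longrightarrow> w = wfix \<beta> k"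
    using wfix_ex1[OF assms, of k] * by blast
qed

lemma Fser_zeros_wfix:
  assumes "admissible \<beta>" "Re w \<ge> 15"
  shows "Fser \<beta> w = 0 \<longleftrightarrow> (\<exists>k. w = wfix \<beta> k)"
  unfolding Fser_zero_iff[OF assms] using wfix[OF assms(1)] assms(2) by metis

lemma continuous_on_Gmap:
  assumes w: "Re w \<ge> 15" and S: "\<And>\<beta>. \<beta> \<in> S \<Longrightarrow> admissible \<beta>"
  shows "continuous_on S (\<lambda>\<beta>. Gmap \<beta> k w)"
proof -
  note b = adm_bounds[OF S]
  have c1: "continuous_on S c1" and c2: "continuous_on S c2"
    unfolding c1_def[abs_def] c2_def[abs_def] by (intro continuous_intros)+
  have c1p: "c1 \<beta> > 0" and c2p: "c2 \<beta> > 0" if "\<beta> \<in> S" for \<beta>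
    using c1_pos[OF b(1,3)] c2_ge[OF b(1,2)] that by (auto intro: less_le_trans[OF zero_less_one])
  have lnr: "continuous_on S (\<lambda>\<beta>. ln (ratio \<beta>))"
    unfolding ratio_def by (intro continuous_on_ln continuous_on_divide c1 c2) (use c1p c2p in \<open>fastforce\<close>)+
  have odd: "continuous_on S (\<lambda>\<beta>. odd_coef \<beta> n)" for n
  proof (cases "odd n")
    case True
    have "continuous_on S (\<lambda>\<beta>. (1 - cos (real n * (pi * \<beta>))) / c1 \<beta>)"
      by (intro continuous_intros c1) (use c1p in force)
    thus ?thesis using True by (simp add: odd_coef_def)
  qed (simp add: odd_coef_def)
  have even: "continuous_on S (\<lambda>\<beta>. even_coef \<beta> n)" for n
  proof (cases "n \<ge> 2")
    case True
    have "continuous_on S (\<lambda>\<beta>. (1 + cos (2 * pi * real n * \<beta>)) / c2 \<beta>)"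
      by (intro continuous_intros c2) (use c2p in force)
    thus ?thesis using True by (simp add: even_coef_def)
  qed (simp add: even_coef_def)
  have nneg: "1 + z \<notin> \<real>\<^sub>\<le>\<^sub>0" if "norm z \<le> 1 / 512" for z :: complex
    using abs_Re_le_cmod[of z] that by (auto simp: complex_nonpos_Reals_iff)
  have 1: "continuous_on S (\<lambda>\<beta>. Ln (1 + psum (odd_coef \<beta>) w))"
  proof (intro continuous_on_Ln' continuous_on_add continuous_on_const continuous_on_psum)
    show "1 + psum (odd_coef \<beta>) w \<notin> \<real>\<^sub>\<le>\<^sub>0" if "\<beta> \<in> S" for \<beta>
      by (rule nneg[OF psum_small(3)[OF S[OF that] w]])
    show "\<bar>odd_coef \<beta> n\<bar> \<le> (real n)\<^sup>2" if "\<beta> \<in> S" for \<beta> n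
      by (rule odd_coef_bound[OF b(1,3)[OF that]])
  qed (use w odd in auto)
  have 2: "continuous_on S (\<lambda>\<beta>. Ln (1 + psum (even_coef \<beta>) w))"
  proof (intro continuous_on_Ln' continuous_on_add continuous_on_const continuous_on_psum)
    show "1 + psum (even_coef \<beta>) w \<notin> \<real>\<^sub>\<le>\<^sub>0" if "\<beta> \<in> S" for \<beta>
      by (rule nneg[OF psum_small(4)[OF S[OF that] w]])
    show "\<bar>even_coef \<beta> n\<bar> \<le> (real n)\<^sup>2" if "\<beta> \<in> S" for \<beta> n
      by (rule even_coef_bound[OF b(1,2)[OF that]])
  qed (use w even in auto)
  show ?thesis
    unfolding Gmap_def Lfun_def
    by (intro continuous_on_divide continuous_on_minus continuous_on_add continuous_on_diff continuous_on_const
        continuous_on_of_real lnr 1 2) simp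
qed

text \<open>Perturbation of a contraction with factor 1/2: two fixed points differ by at most twice
  the distance of the two maps at one of them, so continuity of \<open>Gmap\<close> in
  \<open>\<beta>\<close> at a fixed argument carries over.\<close>

lemma continuous_on_wfix:
  assumes S: "\<And>\<beta>. \<beta> \<in> S \<Longrightarrow> admissible \<beta>"
  shows "continuous_on S (\<lambda>\<beta>. wfix \<beta> k)"
  unfolding continuous_on_iff
proof (intro ballI allI impI)
  fix \<beta>0 e :: real assume \<beta>0: "\<beta>0 \<in> S" and e: "e > 0"
  define w0 where "w0 = wfix \<beta>0 k"
  have w0: "Re w0 \<ge> 15" "Gmap \<beta>0 k w0 = w0" using wfix[OF S[OF \<beta>0]] by (auto simp: w0_def)
  obtain d where d: "d > 0" "\<And>\<beta>. \<beta> \<in> S \<Longrightarrow> dist \<beta> \<beta>0 < d \<Longrightarrow> dist (Gmap \<beta> k w0) (Gmap \<beta>0 k w0) < e / 2"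
    using continuous_on_Gmap[OF w0(1) S, of S k] \<beta>0 e unfolding continuous_on_iff by (metis half_gt_zero)
  show "\<exists>d>0. \<forall>\<beta>\<in>S. dist \<beta> \<beta>0 < d \<longrightarrow> dist (wfix \<beta> k) (wfix \<beta>0 k) < e"
  proof (intro exI[of _ d] conjI ballI impI d(1))
    fix \<beta> assume \<beta>: "\<beta> \<in> S" "dist \<beta> \<beta>0 < d"
    define w where "w = wfix \<beta> k"
    have w: "Re w \<ge> 15" "Gmap \<beta> k w = w" using wfix[OF S[OF \<beta>(1)]] by (auto simp: w_def)
    have "norm (w - w0) = norm ((Gmap \<beta> k w - Gmap \<beta> k w0) + (Gmap \<beta> k w0 - Gmap \<beta>0 k w0))"
      using w w0 by simp
    also have "\<dots> \<le> 1 / 2 * norm (w - w0) + norm (Gmap \<beta> k w0 - Gmap \<beta>0 k w0)"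
      by (rule norm_triangle_le) (intro add_mono Gmap_lipschitz S \<beta> w w0 order_refl)
    finally have "norm (w - w0) \<le> 2 * norm (Gmap \<beta> k w0 - Gmap \<beta>0 k w0)" by simp
    also have "\<dots> < e" using d(2)[OF \<beta>] by (simp add: dist_norm)
    finally show "dist (wfix \<beta> k) (wfix \<beta>0 k) < e" by (simp add: w_def w0_def dist_norm)
  qed
qed

section \<open>Asymptotic expansions\<close>

text \<open>\<open>c1 \<beta>\<close> is about \<open>(pi * \<beta>)^2 / 2\<close>,
  \<open>c2 \<beta>\<close> tends to 2, and \<open>shift \<epsilon>\<close> is about
  \<open>\<epsilon> / 2\<close>.\<close>

lemma ratio_asymp: "((\<lambda>\<epsilon>. ratio (shift \<epsilon>) / \<epsilon>\<^sup>2) \<longlongrightarrow> pi\<^sup>2 / 16) (at_right 0)"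
  unfolding ratio_def c1_def c2_def shift_def power2_eq_square[of pi] by real_asymp

lemma even_coef_2_asymp: "((\<lambda>\<epsilon>. (even_coef (shift \<epsilon>) 2 - 1) / \<epsilon>\<^sup>2) \<longlongrightarrow> - (3 * pi\<^sup>2 / 4)) (at_right 0)"
  unfolding even_coef_def c2_def shift_def power2_eq_square[of pi] by simp real_asymp

text \<open>The limits 9 here and 1 in \<open>even_coef_3_limit\<close> differ by 8, the coefficient
  of \<open>3 powr (-w)\<close> in \<open>Lfun\<close>.\<close>

lemma odd_coef_3_limit: "((\<lambda>\<epsilon>. odd_coef (shift \<epsilon>) 3) \<longlongrightarrow> 9) (at_right 0)"
  unfolding odd_coef_def c1_def shift_def by simp real_asymp

lemma even_coef_3_limit: "((\<lambda>\<epsilon>. even_coef (shift \<epsilon>) 3) \<longlongrightarrow> 1) (at_right 0)"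
  unfolding even_coef_def c2_def shift_def by simp real_asymp

lemma filterlim_shift: "filterlim shift (at_right 0) (at_right 0)"
  unfolding shift_def by real_asymp

text \<open>The expansion is done first in \<open>x = pi * \<beta>\<close>, where the coefficients
  are rational: \<open>7 / 6 = 11 / 12 + 1 / 4\<close>, from the logarithm and from the ratio.
  Inserting \<open>x = pi * \<epsilon> / (2 - \<epsilon>)\<close> then gives the pure powers from
  \<open>- 2 * ln (2 - \<epsilon>)\<close>, and the same coefficient \<open>7 * pi^2 / 24\<close>
  twice, because \<open>x^2\<close> is \<open>pi^2 / 4 * (\<epsilon>^2 + \<epsilon>^3)\<close> up to
  order 4.\<close>

lemma ln_ratio_expansion: "(\<lambda>\<epsilon>. ln (ratio (shift \<epsilon>)) + ratio (shift \<epsilon>) - (2 * ln \<epsilon> - 4 * ln 2 + 2 * ln pi + \<epsilon> + (1 / 4 + 7 * pi\<^sup>2 / 24) * \<epsilon>\<^sup>2 + (1 / 12 + 7 * pi\<^sup>2 / 24) * \<epsilon> ^ 3)) \<in> O[at_right 0](\<lambda>\<epsilon>. \<epsilon> ^ 4)"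
proof -
  define f where "f = (\<lambda>x::real. ln ((1 - cos x) / (1 + cos (2 * x))) + (1 - cos x) / (1 + cos (2 * x)) - (2 * ln x - 2 * ln 2 + 7 / 6 * x\<^sup>2))"
  define x where "x = (\<lambda>\<epsilon>::real. pi * shift \<epsilon>)"
  have "f \<in> O[at_right 0](\<lambda>x. x ^ 4)"
  proof -
    \<comment> \<open>The factor \<open>4 / x ^ 2\<close> makes the argument of the logarithm tend
      to 1, so that the singular part \<open>2 * ln x\<close> is split off before expanding.\<close>
    have "(\<lambda>x::real. (ln (4 * (1 - cos x) / (x ^ 2 * (1 + cos (2 * x)))) - 11 / 12 * x ^ 2) + ((1 - cos x) / (1 + cos (2 * x)) - 1 / 4 * x ^ 2)) \<in> O[at_right 0](\<lambda>x. x ^ 4)"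
      by (rule sum_in_bigo; real_asymp)
    moreover have "\<forall>\<^sub>F x::real in at_right 0. 0 < x \<and> x < pi / 4"
      using eventually_at_right_real[of 0 "pi / 4"] by simp
    hence "\<forall>\<^sub>F x in at_right 0. (ln (4 * (1 - cos x) / (x ^ 2 * (1 + cos (2 * x)))) - 11 / 12 * x ^ 2) + ((1 - cos x) / (1 + cos (2 * x)) - 1 / 4 * x ^ 2) = f x"
    proof eventually_elim
      case (elim x)
      have "cos x < cos 0" using elim pi_gt_zero by (intro cos_monotone_0_pi) linarith+
      hence n: "1 - cos x > 0" by simp
      have "cos (2 * x) > 0" using elim by (intro cos_gt_zero) auto
      hence d: "1 + cos (2 * x) > 0" by simp
      have "ln (4 * (1 - cos x) / (x ^ 2 * (1 + cos (2 * x)))) = ln 4 + ln ((1 - cos x) / (1 + cos (2 * x))) - 2 * ln x"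
      proof -
        have "ln (4 * n / (x ^ 2 * d)) = ln 4 + ln (n / d) - 2 * ln x" if "n > 0" "d > 0" for n d :: real
          using elim that by (simp add: ln_mult ln_div ln_realpow)
        from this[OF n d] show ?thesis .
      qed
      moreover have "ln (4::real) = 2 * ln 2" using ln_realpow[of 2 2] by simp
      ultimately show ?case unfolding f_def by linarith
    qed
    ultimately show ?thesis by (rule landau_o.big.in_cong[THEN iffD1, rotated])
  qed
  moreover have "filterlim x (at_right 0) (at_right 0)" unfolding x_def shift_def by real_asymp
  ultimately have "(\<lambda>\<epsilon>. f (x \<epsilon>)) \<in> O[at_right 0](\<lambda>\<epsilon>. x \<epsilon> ^ 4)"
    by (rule landau_o.big.compose)
  also have "(\<lambda>\<epsilon>. x \<epsilon> ^ 4) \<in> O[at_right 0](\<lambda>\<epsilon>. \<epsilon> ^ 4)"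
    unfolding x_def shift_def by real_asymp
  finally have 1: "(\<lambda>\<epsilon>. f (x \<epsilon>)) \<in> O[at_right 0](\<lambda>\<epsilon>. \<epsilon> ^ 4)" .
  have 2: "(\<lambda>\<epsilon>::real. - 2 * ln (2 - \<epsilon>) - (- 2 * ln 2 + \<epsilon> + 1 / 4 * \<epsilon>\<^sup>2 + 1 / 12 * \<epsilon> ^ 3)) \<in> O[at_right 0](\<lambda>\<epsilon>. \<epsilon> ^ 4)"
    by real_asymp
  have 3: "(\<lambda>\<epsilon>::real. 7 / 6 * (\<epsilon> / (2 - \<epsilon>))\<^sup>2 - 7 / 24 * (\<epsilon>\<^sup>2 + \<epsilon> ^ 3)) \<in> O[at_right 0](\<lambda>\<epsilon>. \<epsilon> ^ 4)"
    unfolding power_divide times_divide_eq_right by real_asymp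
  have "(\<lambda>\<epsilon>. f (x \<epsilon>) + (- 2 * ln (2 - \<epsilon>) - (- 2 * ln 2 + \<epsilon> + 1 / 4 * \<epsilon>\<^sup>2 + 1 / 12 * \<epsilon> ^ 3)) + pi\<^sup>2 * (7 / 6 * (\<epsilon> / (2 - \<epsilon>))\<^sup>2 - 7 / 24 * (\<epsilon>\<^sup>2 + \<epsilon> ^ 3))) \<in> O[at_right 0](\<lambda>\<epsilon>. \<epsilon> ^ 4)"
    by (intro sum_in_bigo 1 2 landau_o.big.cmult_in_iff[THEN iffD2] 3) simp_all
  moreover have "\<forall>\<^sub>F \<epsilon>::real in at_right 0. 0 < \<epsilon> \<and> \<epsilon> < 1"
    using eventually_at_right_real[of 0 1] by simp
  hence "\<forall>\<^sub>F \<epsilon> in at_right 0. f (x \<epsilon>) + (- 2 * ln (2 - \<epsilon>) - (- 2 * ln 2 + \<epsilon> + 1 / 4 * \<epsilon>\<^sup>2 + 1 / 12 * \<epsilon> ^ 3)) + pi\<^sup>2 * (7 / 6 * (\<epsilon> / (2 - \<epsilon>))\<^sup>2 - 7 / 24 * (\<epsilon>\<^sup>2 + \<epsilon> ^ 3))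
     = ln (ratio (shift \<epsilon>)) + ratio (shift \<epsilon>) - (2 * ln \<epsilon> - 4 * ln 2 + 2 * ln pi + \<epsilon> + (1 / 4 + 7 * pi\<^sup>2 / 24) * \<epsilon>\<^sup>2 + (1 / 12 + 7 * pi\<^sup>2 / 24) * \<epsilon> ^ 3)"
  proof eventually_elim
    case (elim \<epsilon>)
    have "ln (x \<epsilon>) = ln pi + ln \<epsilon> - ln (2 - \<epsilon>)"
      using elim by (simp add: x_def shift_def ln_mult ln_div)
    thus ?case
      by (simp add: f_def ratio_def c1_def c2_def x_def mult.assoc power_mult_distrib shift_def[symmetric]) (simp add: algebra_simps)
  qed
  ultimately show ?thesis by (rule landau_o.big.in_cong[THEN iffD1, rotated])
qed

lemma eventually_shift_admissible: "\<forall>\<^sub>F \<epsilon> in at_right 0. admissible (shift \<epsilon>)"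
  using eventually_admissible filterlim_shift by (rule eventually_compose_filterlim)

definition log23 :: real where "log23 = ln 3 / ln 2"

text \<open>The bound \<open>log23 < 2\<close> makes all errors of order
  \<open>\<epsilon> ^ 4\<close> negligible against
  \<open>\<epsilon> powr (2 * log23)\<close>.\<close>

lemma log23_bounds: "0 < log23" "1 < log23" "log23 < 2"
proof -
  have "ln (3::real) < ln 4" by simp
  also have "ln (4::real) = 2 * ln 2" using ln_realpow[of 2 2] by simp
  finally show "log23 < 2" by (simp add: log23_def pos_divide_less_eq)
  show "1 < log23" by (simp add: log23_def pos_less_divide_eq)
  thus "0 < log23" by simp
qed

lemma two_powr_log23: "2 powr log23 = 3"
  by (simp add: log23_def powr_def)

lemma exp_half_le: "exp (1 / 2 :: real) \<le> 2"
proof -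
  have "exp (1 / 2) \<le> exp (ln (2::real))" using ln2_bounds by (subst exp_le_cancel_iff) simp
  thus ?thesis by simp
qed

lemma norm_exp_minus_one_le:
  fixes z :: complex
  assumes "norm z \<le> 1 / 2"
  shows "norm (exp z - 1) \<le> 2 * norm z"
proof -
  have "norm (exp z - exp 0) \<le> 2 * norm (z - 0)"
  proof (rule field_differentiable_bound[where S = "cball 0 (1 / 2)" and f' = exp])
    fix y :: complex assume "y \<in> cball 0 (1 / 2)"
    hence "Re y \<le> 1 / 2" using complex_Re_le_cmod[of y] by simp
    hence "exp (Re y) \<le> exp (1 / 2)" by (simp only: exp_le_cancel_iff)
    thus "norm (exp y) \<le> 2" unfolding norm_exp_eq_Re using exp_half_le by (rule order_trans)
  qed (use assms in \<open>auto intro!: derivative_eq_intros\<close>)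
  thus ?thesis by simp
qed

section \<open>Expansion of \<open>Lfun\<close> at a fixed point\<close>

context
  fixes \<beta> :: real and k :: int and w L :: complex and r :: real
  assumes adm: "admissible \<beta>"
  defines "w \<equiv> wfix \<beta> k" and "L \<equiv> Lfun \<beta> w" and "r \<equiv> ratio \<beta>"
begin

lemma wfix_facts: "Re w \<ge> 15" "r > 0" "norm L \<le> 1 / 100"
  "- w * of_real (ln 2) = of_real (ln r) + of_real (of_int (2 * k + 1) * pi) * \<i> + L"
proof -
  show w: "Re w \<ge> 15" using wfix[OF adm] by (simp add: w_def)
  show "r > 0" using ratio_pos[OF adm_bounds(1,2)[OF adm]] by (simp add: r_def)
  show "norm L \<le> 1 / 100" unfolding L_def by (rule Lfun_small(2)[OF adm w])
  have nz: "complex_of_real (ln 2) \<noteq> 0" by simp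
  have "- (of_real (ln r) + of_real (of_int (2 * k + 1) * pi) * \<i> + L) / of_real (ln 2) = w"
    using wfix(2)[OF adm, of k] by (simp only: Gmap_def w_def L_def r_def)
  hence "- (of_real (ln r) + of_real (of_int (2 * k + 1) * pi) * \<i> + L) = w * of_real (ln 2)"
    by (rule nonzero_divide_eq_eq[OF nz, THEN iffD1])
  thus "- w * of_real (ln 2) = of_real (ln r) + of_real (of_int (2 * k + 1) * pi) * \<i> + L"
    using minus_equation_iff by fastforce
qed

lemma two_powr_wfix: "2 powr (- w) = - of_real r * exp L"
proof -
  have "2 powr (- w) = exp (- w * of_real (ln 2))"
    using Ln_of_real[of 2] by (simp add: powr_def mult_ac)
  also have "\<dots> = of_real r * exp (of_real (of_int (2 * k + 1) * pi) * \<i>) * exp L"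
    unfolding wfix_facts(4) exp_add exp_of_real using wfix_facts(2) by simp
  also have "exp (of_real (of_int (2 * k + 1) * pi) * \<i>) = cis (of_int (2 * k + 1) * pi)"
    by (simp add: cis_conv_exp mult.commute)
  also have "cis (of_int (2 * k + 1) * pi) = - 1"
  proof -
    have "of_int (2 * k + 1) * pi = 2 * pi * of_int k + pi" by (simp add: algebra_simps)
    hence "cis (of_int (2 * k + 1) * pi) = cis (2 * pi * of_int k) * cis pi" by (simp only: cis_mult)
    thus ?thesis by simp
  qed
  finally show ?thesis by simp
qed

text \<open>\<open>-w * ln 3\<close> is \<open>log23\<close> times \<open>-w * ln 2\<close>, to
  which the fixed point equation applies. In \<open>2 powr (-w)\<close> the imaginary part
  \<open>(2 * k + 1) * pi\<close> only gives the sign -1; multiplied by \<open>log23\<close> it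
  becomes a phase depending on \<open>k\<close>, and this is the oscillation.\<close>

lemma three_powr_wfix: "3 powr (- w) = of_real (r powr log23) * cis (log23 * of_int (2 * k + 1) * pi) * exp (of_real log23 * L)"
proof -
  have "3 powr (- w) = exp (of_real log23 * (- w * of_real (ln 2)))"
    using Ln_of_real[of 3] by (simp add: powr_def log23_def mult_ac)
  also have "\<dots> = exp (of_real (log23 * ln r) + \<i> * of_real (log23 * of_int (2 * k + 1) * pi) + of_real log23 * L)"
    unfolding wfix_facts(4) by (simp add: algebra_simps)
  also have "\<dots> = of_real (r powr log23) * cis (log23 * of_int (2 * k + 1) * pi) * exp (of_real log23 * L)"
    unfolding exp_add exp_of_real cis_conv_exp using wfix_facts(2) by (simp add: powr_def)
  finally show ?thesis .
qed

lemma two_powr_Re_wfix: "2 powr (- Re w) \<le> 2 * r"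
proof -
  have "2 powr (- Re w) = norm (2 powr (- w) :: complex)" using norm_nat_powr[of 2 w] by simp
  also have "\<dots> = r * exp (Re L)" unfolding two_powr_wfix using wfix_facts(2) by (simp add: norm_mult)
  also have "\<dots> \<le> r * 2"
  proof (intro mult_left_mono)
    have "Re L \<le> 1 / 100" using wfix_facts(3) complex_Re_le_cmod[of L] by linarith
    hence "exp (Re L) \<le> exp (1 / 2)" by simp
    also note exp_half_le
    finally show "exp (Re L) \<le> 2" .
  qed (use wfix_facts(2) in simp)
  finally show ?thesis by simp
qed

lemma norm_L_le: "norm L \<le> 384 * r"
  using Lfun_small(1)[OF adm wfix_facts(1)] two_powr_Re_wfix by (simp add: L_def)

lemma four_powr_Re_wfix: "4 powr (- Re w) \<le> 4 * r\<^sup>2"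
proof -
  have "4 powr (- Re w) = (2 powr (- Re w))\<^sup>2"
    using powr_mult[of 2 2 "- Re w"] by (simp add: power2_eq_square)
  also have "\<dots> \<le> (2 * r)\<^sup>2" using two_powr_Re_wfix by (intro power_mono) auto
  finally show ?thesis by (simp add: power_mult_distrib)
qed

text \<open>Both logarithms are linearised and both series cut after \<open>n = 3\<close>;
  \<open>odd_coef \<beta> 2\<close> is 0, so the term at 2 is due to the even half alone. The
  constant is \<open>2 * (18432 + 3072)\<close> with \<open>18432 = 2 * 96^2\<close> from the
  logarithm and \<open>3072 = 4 * 768\<close> from the tail.\<close>

lemma L_expand:
  "norm (L - (of_real (odd_coef \<beta> 3 - even_coef \<beta> 3) * 3 powr (- w) - of_real (even_coef \<beta> 2) * 2 powr (- w))) \<le> 43008 * r\<^sup>2"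
proof -
  define A where "A = psum (odd_coef \<beta>) w"
  define B where "B = psum (even_coef \<beta>) w"
  note b = adm_bounds[OF adm] and w15 = wfix_facts(1)
  have ln: "norm (Ln (1 + z) - z) \<le> 18432 * r\<^sup>2" if "norm z \<le> 48 * 2 powr (- Re w)" "norm z \<le> 1 / 512" for z
  proof -
    have "norm (Ln (1 + z) - z) \<le> (norm z)\<^sup>2 / (1 - norm z)" using that by (intro Ln_approx_linear) auto
    also have "\<dots> \<le> (96 * r)\<^sup>2 / (1 / 2)"
      using that two_powr_Re_wfix by (intro frac_le power_mono) auto
    finally show ?thesis by (simp add: power_mult_distrib)
  qed
  have A1: "norm (Ln (1 + A) - A) \<le> 18432 * r\<^sup>2" and B1: "norm (Ln (1 + B) - B) \<le> 18432 * r\<^sup>2"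
    unfolding A_def B_def by (intro ln psum_small[OF adm w15])+
  have "norm (A - (of_real (odd_coef \<beta> 2) * 2 powr (- w) + of_real (odd_coef \<beta> 3) * 3 powr (- w))) \<le> 768 * 4 powr (- Re w)"
    unfolding A_def using b w15 by (intro psum_expand odd_coef_bound) auto
  hence A2: "norm (A - of_real (odd_coef \<beta> 3) * 3 powr (- w)) \<le> 3072 * r\<^sup>2"
    using four_powr_Re_wfix by (simp add: odd_coef_def)
  have "norm (B - (of_real (even_coef \<beta> 2) * 2 powr (- w) + of_real (even_coef \<beta> 3) * 3 powr (- w))) \<le> 768 * 4 powr (- Re w)"
    unfolding B_def using b w15 by (intro psum_expand even_coef_bound) auto
  hence B2: "norm (B - (of_real (even_coef \<beta> 2) * 2 powr (- w) + of_real (even_coef \<beta> 3) * 3 powr (- w))) \<le> 3072 * r\<^sup>2"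
    using four_powr_Re_wfix by linarith
  have "L - (of_real (odd_coef \<beta> 3 - even_coef \<beta> 3) * 3 powr (- w) - of_real (even_coef \<beta> 2) * 2 powr (- w))
    = ((Ln (1 + A) - A) + (A - of_real (odd_coef \<beta> 3) * 3 powr (- w)))
      - ((Ln (1 + B) - B) + (B - (of_real (even_coef \<beta> 2) * 2 powr (- w) + of_real (even_coef \<beta> 3) * 3 powr (- w))))"
    by (simp add: L_def Lfun_def A_def B_def algebra_simps)
  also have "norm \<dots> \<le> (18432 * r\<^sup>2 + 3072 * r\<^sup>2) + (18432 * r\<^sup>2 + 3072 * r\<^sup>2)"
    by (intro order_trans[OF norm_triangle_ineq4] add_mono order_trans[OF norm_triangle_ineq] A1 A2 B1 B2)
  finally show ?thesis by simp
qed

text \<open>The fixed point equation enters a second time: \<open>- (2 powr (-w))\<close> equals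
  \<open>r * exp L\<close>, which is \<open>r\<close> up to a relative error of the size of
  \<open>L\<close>, itself at most \<open>384 * r\<close>. This produces the summand
  \<open>ratio\<close> that accompanies \<open>ln ratio\<close> in the expansion.\<close>

lemma two_term_bound:
  "norm (- of_real (even_coef \<beta> 2) * 2 powr (- w) - of_real r) \<le> r * (3072 * r + \<bar>even_coef \<beta> 2 - 1\<bar>)"
proof -
  have e4: "\<bar>even_coef \<beta> 2\<bar> \<le> 4" using even_coef_bound[OF adm_bounds(1,2)[OF adm], of 2] by simp
  have expL: "norm (exp L - 1) \<le> 2 * norm L"
    using wfix_facts(3) by (intro norm_exp_minus_one_le) simp
  have "- of_real (even_coef \<beta> 2) * 2 powr (- w) - of_real r = of_real r * (of_real (even_coef \<beta> 2) * (exp L - 1) + of_real (even_coef \<beta> 2 - 1))"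
    unfolding two_powr_wfix by (simp add: algebra_simps)
  also have "norm \<dots> = r * norm (of_real (even_coef \<beta> 2) * (exp L - 1) + of_real (even_coef \<beta> 2 - 1))"
    using wfix_facts(2) by (simp add: norm_mult)
  also have "\<dots> \<le> r * (3072 * r + \<bar>even_coef \<beta> 2 - 1\<bar>)"
  proof (intro mult_left_mono)
    have "norm (of_real (even_coef \<beta> 2) * (exp L - 1) + of_real (even_coef \<beta> 2 - 1)) \<le> \<bar>even_coef \<beta> 2\<bar> * norm (exp L - 1) + \<bar>even_coef \<beta> 2 - 1\<bar>"
      by (rule order_trans[OF norm_triangle_ineq]) (simp add: norm_mult del: of_real_diff)
    also have "\<bar>even_coef \<beta> 2\<bar> * norm (exp L - 1) \<le> 4 * (2 * (384 * r))"
      using e4 expL norm_L_le by (intro mult_mono) auto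
    finally show "norm (of_real (even_coef \<beta> 2) * (exp L - 1) + of_real (even_coef \<beta> 2 - 1)) \<le> 3072 * r + \<bar>even_coef \<beta> 2 - 1\<bar>"
      by simp
  qed (use wfix_facts(2) in simp)
  finally show ?thesis .
qed

end

section \<open>Expansions of the zeros in \<open>\<epsilon>\<close>\<close>

definition root_branch :: "int \<Rightarrow> real \<Rightarrow> complex" where
  "root_branch k \<epsilon> = 1 - wfix (shift \<epsilon>) k"

lemma Re_Im_root_branch:
  assumes "admissible (shift \<epsilon>)"
  shows "Re (root_branch k \<epsilon>) = 1 + (ln (ratio (shift \<epsilon>)) + Re (Lfun (shift \<epsilon>) (wfix (shift \<epsilon>) k))) / ln 2"
    and "Im (root_branch k \<epsilon>) = (of_int (2 * k + 1) * pi + Im (Lfun (shift \<epsilon>) (wfix (shift \<epsilon>) k))) / ln 2"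
proof -
  have "Re (wfix (shift \<epsilon>) k) = - (ln (ratio (shift \<epsilon>)) + Re (Lfun (shift \<epsilon>) (wfix (shift \<epsilon>) k))) / ln 2"
    using Re_Gmap[OF assms, of k "wfix (shift \<epsilon>) k"] by (simp only: wfix(2)[OF assms, of k])
  thus "Re (root_branch k \<epsilon>) = 1 + (ln (ratio (shift \<epsilon>)) + Re (Lfun (shift \<epsilon>) (wfix (shift \<epsilon>) k))) / ln 2"
    by (simp only: root_branch_def minus_complex.sel one_complex.sel minus_divide_left[symmetric] diff_minus_eq_add)
  have "Im (wfix (shift \<epsilon>) k) = - (of_int (2 * k + 1) * pi + Im (Lfun (shift \<epsilon>) (wfix (shift \<epsilon>) k))) / ln 2"
    using Im_Gmap[OF assms, of k "wfix (shift \<epsilon>) k"] by (simp only: wfix(2)[OF assms, of k])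
  thus "Im (root_branch k \<epsilon>) = (of_int (2 * k + 1) * pi + Im (Lfun (shift \<epsilon>) (wfix (shift \<epsilon>) k))) / ln 2"
    by (simp only: root_branch_def minus_complex.sel one_complex.sel minus_divide_left[symmetric] diff_minus_eq_add add_0)
qed

lemma tendsto_powr_0_at_right: "a > 0 \<Longrightarrow> ((\<lambda>\<epsilon>::real. \<epsilon> powr a) \<longlongrightarrow> 0) (at_right 0)"
proof -
  assume a: "a > 0"
  have "((\<lambda>\<epsilon>::real. \<epsilon> powr a) \<longlongrightarrow> 0 powr a) (at_right 0)"
    by (rule tendsto_powr') (use a in \<open>auto intro!: tendsto_intros simp: eventually_at_filter\<close>)
  thus ?thesis by simp
qed

lemma eventually_at_right_pos: "\<forall>\<^sub>F \<epsilon>::real in at_right 0. 0 < \<epsilon>"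
  by (simp add: eventually_at_filter)

text \<open>\<open>L - r\<close> has three parts: the truncation error, the defect of the term at 2,
  and the term at 3. The first two are O(\<open>\<epsilon> ^ 4\<close>) and vanish after division;
  the last has exactly the order of the divisor and supplies the limit.\<close>

lemma L_limit:
  fixes k :: int
  defines "L \<equiv> \<lambda>\<epsilon>. Lfun (shift \<epsilon>) (wfix (shift \<epsilon>) k)" and "r \<equiv> \<lambda>\<epsilon>. ratio (shift \<epsilon>)"
  shows "((\<lambda>\<epsilon>. (L \<epsilon> - of_real (r \<epsilon>)) / of_real (\<epsilon> powr (2 * log23))) \<longlongrightarrow>
      of_real (8 * (pi\<^sup>2 / 16) powr log23) * cis (log23 * of_int (2 * k + 1) * pi)) (at_right 0)"
proof -
  define w where "w = (\<lambda>\<epsilon>. wfix (shift \<epsilon>) k)"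
  define e where "e = (\<lambda>\<epsilon>::real. \<epsilon> powr (2 * log23))"
  define e2 where "e2 = (\<lambda>\<epsilon>. even_coef (shift \<epsilon>) 2)"
  define d where "d = (\<lambda>\<epsilon>. odd_coef (shift \<epsilon>) 3 - even_coef (shift \<epsilon>) 3)"
  define R where "R = (\<lambda>\<epsilon>. r \<epsilon> / \<epsilon>\<^sup>2)"
  have R: "(R \<longlongrightarrow> pi\<^sup>2 / 16) (at_right 0)" unfolding R_def r_def by (rule ratio_asymp)
  have r0: "(r \<longlongrightarrow> 0) (at_right 0)"
  proof -
    have "((\<lambda>\<epsilon>. R \<epsilon> * \<epsilon>\<^sup>2) \<longlongrightarrow> pi\<^sup>2 / 16 * 0\<^sup>2) (at_right 0)" by (intro tendsto_intros R)
    moreover have "\<forall>\<^sub>F \<epsilon> in at_right 0. R \<epsilon> * \<epsilon>\<^sup>2 = r \<epsilon>"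
      using eventually_at_right_pos by eventually_elim (simp add: R_def)
    ultimately show ?thesis by (simp add: filterlim_cong)
  qed
  have ev: "\<forall>\<^sub>F \<epsilon>::real in at_right 0. 0 < \<epsilon> \<and> admissible (shift \<epsilon>)"
    using eventually_at_right_pos eventually_shift_admissible by eventually_elim simp
  have p4: "((\<lambda>\<epsilon>::real. \<epsilon> powr (4 - 2 * log23)) \<longlongrightarrow> 0) (at_right 0)"
    using log23_bounds by (intro tendsto_powr_0_at_right) simp
  have esplit: "\<epsilon> ^ 4 / e \<epsilon> = \<epsilon> powr (4 - 2 * log23)" if "\<epsilon> > 0" for \<epsilon>
    using that powr_diff[of \<epsilon> 4 "2 * log23"] by (simp add: e_def powr_numeral)
  have r2: "((\<lambda>\<epsilon>. (r \<epsilon>)\<^sup>2 / e \<epsilon>) \<longlongrightarrow> 0) (at_right 0)"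
  proof -
    have "((\<lambda>\<epsilon>. (R \<epsilon>)\<^sup>2 * \<epsilon> powr (4 - 2 * log23)) \<longlongrightarrow> (pi\<^sup>2 / 16)\<^sup>2 * 0) (at_right 0)"
      by (intro tendsto_intros R p4)
    moreover have "\<forall>\<^sub>F \<epsilon> in at_right 0. (R \<epsilon>)\<^sup>2 * \<epsilon> powr (4 - 2 * log23) = (r \<epsilon>)\<^sup>2 / e \<epsilon>"
      using eventually_at_right_pos
    proof eventually_elim
      case (elim \<epsilon>)
      have "(R \<epsilon>)\<^sup>2 * \<epsilon> ^ 4 = (r \<epsilon>)\<^sup>2" using elim by (simp add: R_def power_divide flip: power_mult)
      thus ?case unfolding esplit[OF elim, symmetric] by simp
    qed
    ultimately show ?thesis by (simp add: filterlim_cong)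
  qed
  have re: "((\<lambda>\<epsilon>. r \<epsilon> * \<bar>e2 \<epsilon> - 1\<bar> / e \<epsilon>) \<longlongrightarrow> 0) (at_right 0)"
  proof -
    have "((\<lambda>\<epsilon>. R \<epsilon> * \<bar>(e2 \<epsilon> - 1) / \<epsilon>\<^sup>2\<bar> * \<epsilon> powr (4 - 2 * log23)) \<longlongrightarrow> pi\<^sup>2 / 16 * \<bar>- (3 * pi\<^sup>2 / 4)\<bar> * 0) (at_right 0)"
      unfolding e2_def by (intro tendsto_intros R p4 even_coef_2_asymp)
    moreover have "\<forall>\<^sub>F \<epsilon> in at_right 0. R \<epsilon> * \<bar>(e2 \<epsilon> - 1) / \<epsilon>\<^sup>2\<bar> * \<epsilon> powr (4 - 2 * log23) = r \<epsilon> * \<bar>e2 \<epsilon> - 1\<bar> / e \<epsilon>"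
      using eventually_at_right_pos
    proof eventually_elim
      case (elim \<epsilon>)
      have "R \<epsilon> * \<bar>(e2 \<epsilon> - 1) / \<epsilon>\<^sup>2\<bar> * \<epsilon> ^ 4 = r \<epsilon> * \<bar>e2 \<epsilon> - 1\<bar>"
        using elim by (simp add: R_def field_simps flip: power_add)
      thus ?case unfolding esplit[OF elim, symmetric] by simp
    qed
    ultimately show ?thesis by (simp add: filterlim_cong)
  qed
  have L0: "(L \<longlongrightarrow> 0) (at_right 0)"
  proof (rule Lim_null_comparison)
    show "\<forall>\<^sub>F \<epsilon> in at_right 0. norm (L \<epsilon>) \<le> 384 * r \<epsilon>"
      using ev by eventually_elim (use norm_L_le in \<open>simp add: L_def r_def\<close>)
    show "((\<lambda>\<epsilon>. 384 * r \<epsilon>) \<longlongrightarrow> 0) (at_right 0)" using tendsto_mult_left[OF r0, of 384] by simp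
  qed
  define M where "M = (\<lambda>\<epsilon>. of_real (d \<epsilon>) * 3 powr (- w \<epsilon>) - of_real (e2 \<epsilon>) * 2 powr (- w \<epsilon>))"
  have T1: "((\<lambda>\<epsilon>. (L \<epsilon> - M \<epsilon>) / of_real (e \<epsilon>)) \<longlongrightarrow> 0) (at_right 0)"
  proof (rule Lim_null_comparison)
    show "\<forall>\<^sub>F \<epsilon> in at_right 0. norm ((L \<epsilon> - M \<epsilon>) / of_real (e \<epsilon>)) \<le> 43008 * ((r \<epsilon>)\<^sup>2 / e \<epsilon>)"
      using ev
    proof eventually_elim
      case (elim \<epsilon>)
      have "norm (L \<epsilon> - M \<epsilon>) \<le> 43008 * (r \<epsilon>)\<^sup>2"
        using L_expand[of "shift \<epsilon>" k] elim unfolding L_def M_def d_def e2_def w_def r_def by blast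
      hence "norm (L \<epsilon> - M \<epsilon>) / e \<epsilon> \<le> 43008 * (r \<epsilon>)\<^sup>2 / e \<epsilon>" by (intro divide_right_mono) (auto simp: e_def)
      thus ?case by (simp add: norm_divide e_def)
    qed
    show "((\<lambda>\<epsilon>. 43008 * ((r \<epsilon>)\<^sup>2 / e \<epsilon>)) \<longlongrightarrow> 0) (at_right 0)" using tendsto_mult_left[OF r2, of 43008] by simp
  qed
  have T3: "((\<lambda>\<epsilon>. (- of_real (e2 \<epsilon>) * 2 powr (- w \<epsilon>) - of_real (r \<epsilon>)) / of_real (e \<epsilon>)) \<longlongrightarrow> 0) (at_right 0)"
  proof (rule Lim_null_comparison)
    show "\<forall>\<^sub>F \<epsilon> in at_right 0. norm ((- of_real (e2 \<epsilon>) * 2 powr (- w \<epsilon>) - of_real (r \<epsilon>)) / of_real (e \<epsilon>)) \<le> 3072 * ((r \<epsilon>)\<^sup>2 / e \<epsilon>) + r \<epsilon> * \<bar>e2 \<epsilon> - 1\<bar> / e \<epsilon>"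
      using ev
    proof eventually_elim
      case (elim \<epsilon>)
      have "norm (- of_real (e2 \<epsilon>) * 2 powr (- w \<epsilon>) - of_real (r \<epsilon>)) \<le> r \<epsilon> * (3072 * r \<epsilon> + \<bar>e2 \<epsilon> - 1\<bar>)"
        using two_term_bound[of "shift \<epsilon>" k] elim unfolding e2_def w_def r_def by blast
      hence "norm (- of_real (e2 \<epsilon>) * 2 powr (- w \<epsilon>) - of_real (r \<epsilon>)) / e \<epsilon> \<le> r \<epsilon> * (3072 * r \<epsilon> + \<bar>e2 \<epsilon> - 1\<bar>) / e \<epsilon>"
        by (intro divide_right_mono) (auto simp: e_def)
      also have "r \<epsilon> * (3072 * r \<epsilon> + \<bar>e2 \<epsilon> - 1\<bar>) / e \<epsilon> = 3072 * ((r \<epsilon>)\<^sup>2 / e \<epsilon>) + r \<epsilon> * \<bar>e2 \<epsilon> - 1\<bar> / e \<epsilon>"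
        by (simp add: distrib_left add_divide_distrib power2_eq_square)
      finally show ?case by (simp add: norm_divide e_def)
    qed
    show "((\<lambda>\<epsilon>. 3072 * ((r \<epsilon>)\<^sup>2 / e \<epsilon>) + r \<epsilon> * \<bar>e2 \<epsilon> - 1\<bar> / e \<epsilon>) \<longlongrightarrow> 0) (at_right 0)"
      using tendsto_add[OF tendsto_mult_left[OF r2, of 3072] re] by simp
  qed
  have T2: "((\<lambda>\<epsilon>. of_real (d \<epsilon>) * 3 powr (- w \<epsilon>) / of_real (e \<epsilon>)) \<longlongrightarrow> of_real (9 - 1) * (of_real ((pi\<^sup>2 / 16) powr log23) * cis (log23 * of_int (2 * k + 1) * pi) * exp (of_real log23 * 0))) (at_right 0)"
  proof -
    have "((\<lambda>\<epsilon>. complex_of_real (d \<epsilon>) * (of_real (R \<epsilon> powr log23) * cis (log23 * of_int (2 * k + 1) * pi) * exp (of_real log23 * L \<epsilon>))) \<longlongrightarrow> of_real (9 - 1) * (of_real ((pi\<^sup>2 / 16) powr log23) * cis (log23 * of_int (2 * k + 1) * pi) * exp (of_real log23 * 0))) (at_right 0)"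
      unfolding d_def by (intro tendsto_intros odd_coef_3_limit even_coef_3_limit R L0) simp
    moreover have "\<forall>\<^sub>F \<epsilon> in at_right 0. complex_of_real (d \<epsilon>) * (of_real (R \<epsilon> powr log23) * cis (log23 * of_int (2 * k + 1) * pi) * exp (of_real log23 * L \<epsilon>)) = of_real (d \<epsilon>) * 3 powr (- w \<epsilon>) / of_real (e \<epsilon>)"
      using ev
    proof eventually_elim
      case (elim \<epsilon>)
      have "e \<epsilon> = (\<epsilon>\<^sup>2) powr log23" using elim powr_powr[of \<epsilon> 2 log23] by (simp add: e_def powr_numeral)
      hence Rp: "R \<epsilon> powr log23 = r \<epsilon> powr log23 / e \<epsilon>"
        using elim wfix_facts(2)[of "shift \<epsilon>"] by (simp add: R_def r_def powr_divide)
      have "3 powr (- w \<epsilon>) = of_real (r \<epsilon> powr log23) * cis (log23 * of_int (2 * k + 1) * pi) * exp (of_real log23 * L \<epsilon>)"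
        using three_powr_wfix[of "shift \<epsilon>" k] elim by (simp only: r_def w_def L_def)
      thus ?case unfolding Rp by simp
    qed
    ultimately show ?thesis by (simp only: filterlim_cong)
  qed
  have "((\<lambda>\<epsilon>. (L \<epsilon> - M \<epsilon>) / of_real (e \<epsilon>) + of_real (d \<epsilon>) * 3 powr (- w \<epsilon>) / of_real (e \<epsilon>) + (- of_real (e2 \<epsilon>) * 2 powr (- w \<epsilon>) - of_real (r \<epsilon>)) / of_real (e \<epsilon>)) \<longlongrightarrow>
     0 + of_real (9 - 1) * (of_real ((pi\<^sup>2 / 16) powr log23) * cis (log23 * of_int (2 * k + 1) * pi) * exp (of_real log23 * 0)) + 0) (at_right 0)"
    by (intro tendsto_add T1 T2 T3)
  moreover have "(L \<epsilon> - M \<epsilon>) / of_real (e \<epsilon>) + of_real (d \<epsilon>) * 3 powr (- w \<epsilon>) / of_real (e \<epsilon>) + (- of_real (e2 \<epsilon>) * 2 powr (- w \<epsilon>) - of_real (r \<epsilon>)) / of_real (e \<epsilon>) = (L \<epsilon> - of_real (r \<epsilon>)) / of_real (e \<epsilon>)" for \<epsilon>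
    unfolding M_def add_divide_distrib[symmetric] by simp
  ultimately show ?thesis by (simp add: e_def mult.assoc)
qed

text \<open>Halving the base divides the power by \<open>2 powr log23 = 3\<close>, hence the factor
  8/3.\<close>

lemma kappa_eq: "8 * (pi\<^sup>2 / 16) powr log23 = 8 / 3 * (pi\<^sup>2 / 8) powr log23"
proof -
  have "(pi\<^sup>2 / 8 / 2) powr log23 = (pi\<^sup>2 / 8) powr log23 / 2 powr log23" by (rule powr_divide)
  thus ?thesis by (simp add: two_powr_log23)
qed

lemma smallo_of_limit:
  fixes f :: "real \<Rightarrow> real"
  assumes "((\<lambda>\<epsilon>. f \<epsilon> / \<epsilon> powr p) \<longlongrightarrow> c) (at_right 0)"
  shows "(\<lambda>\<epsilon>. f \<epsilon> - c * \<epsilon> powr p) \<in> o[at_right 0](\<lambda>\<epsilon>. \<epsilon> powr p)"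
proof (rule smalloI_tendsto)
  have "((\<lambda>\<epsilon>. f \<epsilon> / \<epsilon> powr p - c) \<longlongrightarrow> c - c) (at_right 0)" by (intro tendsto_intros assms)
  moreover have "\<forall>\<^sub>F \<epsilon> in at_right 0. f \<epsilon> / \<epsilon> powr p - c = (f \<epsilon> - c * \<epsilon> powr p) / \<epsilon> powr p"
    using eventually_at_right_pos by eventually_elim (simp add: diff_divide_distrib)
  ultimately show "((\<lambda>\<epsilon>. (f \<epsilon> - c * \<epsilon> powr p) / \<epsilon> powr p) \<longlongrightarrow> 0) (at_right 0)" by (simp add: filterlim_cong)
  show "\<forall>\<^sub>F \<epsilon> in at_right 0. \<epsilon> powr p \<noteq> 0" using eventually_at_right_pos by eventually_elim simp
qed

lemma L_smallo:
  fixes k :: int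
  shows "(\<lambda>\<epsilon>. Re (Lfun (shift \<epsilon>) (wfix (shift \<epsilon>) k)) - ratio (shift \<epsilon>) - 8 / 3 * (pi\<^sup>2 / 8) powr log23 * cos (log23 * of_int (2 * k + 1) * pi) * \<epsilon> powr (2 * log23)) \<in> o[at_right 0](\<lambda>\<epsilon>. \<epsilon> powr (2 * log23))"
    and "(\<lambda>\<epsilon>. Im (Lfun (shift \<epsilon>) (wfix (shift \<epsilon>) k)) - 8 / 3 * (pi\<^sup>2 / 8) powr log23 * sin (log23 * of_int (2 * k + 1) * pi) * \<epsilon> powr (2 * log23)) \<in> o[at_right 0](\<lambda>\<epsilon>. \<epsilon> powr (2 * log23))"
proof -
  have R: "Re (of_real (8 * (pi\<^sup>2 / 16) powr log23) * cis t) = 8 / 3 * (pi\<^sup>2 / 8) powr log23 * cos t"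
    and I: "Im (of_real (8 * (pi\<^sup>2 / 16) powr log23) * cis t) = 8 / 3 * (pi\<^sup>2 / 8) powr log23 * sin t" for t
    unfolding kappa_eq by simp_all
  show "(\<lambda>\<epsilon>. Re (Lfun (shift \<epsilon>) (wfix (shift \<epsilon>) k)) - ratio (shift \<epsilon>) - 8 / 3 * (pi\<^sup>2 / 8) powr log23 * cos (log23 * of_int (2 * k + 1) * pi) * \<epsilon> powr (2 * log23)) \<in> o[at_right 0](\<lambda>\<epsilon>. \<epsilon> powr (2 * log23))"
    using tendsto_Re[OF L_limit[of k]] unfolding R Re_divide_of_real by (intro smallo_of_limit) simp
  show "(\<lambda>\<epsilon>. Im (Lfun (shift \<epsilon>) (wfix (shift \<epsilon>) k)) - 8 / 3 * (pi\<^sup>2 / 8) powr log23 * sin (log23 * of_int (2 * k + 1) * pi) * \<epsilon> powr (2 * log23)) \<in> o[at_right 0](\<lambda>\<epsilon>. \<epsilon> powr (2 * log23))"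
    using tendsto_Im[OF L_limit[of k]] unfolding I Im_divide_of_real by (intro smallo_of_limit) simp
qed

lemma root_branch_Re_expansion:
  "(\<lambda>\<epsilon>. Re (root_branch k \<epsilon>) -
            (2 / ln 2 * ln \<epsilon> + (- 3 + 2 / ln 2 * ln pi)
             + 1 / ln 2 * \<epsilon>
             + 1 / ln 2 * (1 / 4 + 7 * pi\<^sup>2 / 24) * \<epsilon>\<^sup>2
             + 1 / ln 2 * (1 / 12 + 7 * pi\<^sup>2 / 24) * \<epsilon> ^ 3
             + 8 / (3 * ln 2) * (pi\<^sup>2 / 8) powr (ln 3 / ln 2)
                 * cos (ln 3 / ln 2 * of_int (2 * k + 1) * pi)
                 * \<epsilon> powr (2 * (ln 3 / ln 2))))
         \<in> o[at_right 0](\<lambda>\<epsilon>. \<epsilon> powr (2 * (ln 3 / ln 2)))"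
  unfolding log23_def[symmetric]
proof -
  have "(\<lambda>\<epsilon>::real. \<epsilon> ^ 4) \<in> o[at_right 0](\<lambda>\<epsilon>. \<epsilon> powr (2 * log23))"
  proof (rule smalloI_tendsto)
    have "((\<lambda>\<epsilon>::real. \<epsilon> powr (4 - 2 * log23)) \<longlongrightarrow> 0) (at_right 0)"
      using log23_bounds by (intro tendsto_powr_0_at_right) simp
    moreover have "\<forall>\<^sub>F \<epsilon>::real in at_right 0. \<epsilon> powr (4 - 2 * log23) = \<epsilon> ^ 4 / \<epsilon> powr (2 * log23)"
      using eventually_at_right_pos by eventually_elim (simp add: powr_diff powr_numeral)
    ultimately show "((\<lambda>\<epsilon>::real. \<epsilon> ^ 4 / \<epsilon> powr (2 * log23)) \<longlongrightarrow> 0) (at_right 0)" by (simp add: filterlim_cong)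
    show "\<forall>\<^sub>F \<epsilon>::real in at_right 0. \<epsilon> powr (2 * log23) \<noteq> 0" using eventually_at_right_pos by eventually_elim simp
  qed
  note o4 = landau_o.big_small_trans[OF ln_ratio_expansion this]
  have "(\<lambda>\<epsilon>. 1 / ln 2 * ((ln (ratio (shift \<epsilon>)) + ratio (shift \<epsilon>) - (2 * ln \<epsilon> - 4 * ln 2 + 2 * ln pi + \<epsilon> + (1 / 4 + 7 * pi\<^sup>2 / 24) * \<epsilon>\<^sup>2 + (1 / 12 + 7 * pi\<^sup>2 / 24) * \<epsilon> ^ 3))
     + (Re (Lfun (shift \<epsilon>) (wfix (shift \<epsilon>) k)) - ratio (shift \<epsilon>) - 8 / 3 * (pi\<^sup>2 / 8) powr log23 * cos (log23 * of_int (2 * k + 1) * pi) * \<epsilon> powr (2 * log23)))) \<in> o[at_right 0](\<lambda>\<epsilon>. \<epsilon> powr (2 * log23))"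
    by (rule landau_o.small.cmult_in_iff[THEN iffD2, OF _ sum_in_smallo(1)[OF o4 L_smallo(1)]]) simp
  moreover have "\<forall>\<^sub>F \<epsilon> in at_right 0. 1 / ln 2 * ((ln (ratio (shift \<epsilon>)) + ratio (shift \<epsilon>) - (2 * ln \<epsilon> - 4 * ln 2 + 2 * ln pi + \<epsilon> + (1 / 4 + 7 * pi\<^sup>2 / 24) * \<epsilon>\<^sup>2 + (1 / 12 + 7 * pi\<^sup>2 / 24) * \<epsilon> ^ 3))
     + (Re (Lfun (shift \<epsilon>) (wfix (shift \<epsilon>) k)) - ratio (shift \<epsilon>) - 8 / 3 * (pi\<^sup>2 / 8) powr log23 * cos (log23 * of_int (2 * k + 1) * pi) * \<epsilon> powr (2 * log23))) =
     Re (root_branch k \<epsilon>) -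
            (2 / ln 2 * ln \<epsilon> + (- 3 + 2 / ln 2 * ln pi)
             + 1 / ln 2 * \<epsilon>
             + 1 / ln 2 * (1 / 4 + 7 * pi\<^sup>2 / 24) * \<epsilon>\<^sup>2
             + 1 / ln 2 * (1 / 12 + 7 * pi\<^sup>2 / 24) * \<epsilon> ^ 3
             + 8 / (3 * ln 2) * (pi\<^sup>2 / 8) powr log23
                 * cos (log23 * of_int (2 * k + 1) * pi)
                 * \<epsilon> powr (2 * log23))"
    using eventually_shift_admissible
  proof eventually_elim
    case (elim \<epsilon>)
    \<comment> \<open>The constant -3 is \<open>1 - 4\<close>: the 1 stems from
      \<open>s = 1 - w\<close>, and \<open>-4 * ln 2\<close> is divided by
      \<open>ln 2\<close>.\<close>
    have gen: "1 / l * ((a + b - (2 * c - 4 * l + 2 * d + x + p * x2 + q * x3)) + (L - b - 8 / 3 * K * C * E)) =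
        1 + (a + L) / l - (2 / l * c + (- 3 + 2 / l * d) + 1 / l * x + 1 / l * p * x2 + 1 / l * q * x3 + 8 / (3 * l) * K * C * E)"
      if "l > 0" for l a b c d x p x2 q x3 L K C E :: real
      using that by (simp add: field_simps)
    show ?case unfolding Re_Im_root_branch(1)[OF elim] by (rule gen) simp
  qed
  ultimately show "(\<lambda>\<epsilon>. Re (root_branch k \<epsilon>) -
            (2 / ln 2 * ln \<epsilon> + (- 3 + 2 / ln 2 * ln pi)
             + 1 / ln 2 * \<epsilon>
             + 1 / ln 2 * (1 / 4 + 7 * pi\<^sup>2 / 24) * \<epsilon>\<^sup>2
             + 1 / ln 2 * (1 / 12 + 7 * pi\<^sup>2 / 24) * \<epsilon> ^ 3
             + 8 / (3 * ln 2) * (pi\<^sup>2 / 8) powr log23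
                 * cos (log23 * of_int (2 * k + 1) * pi)
                 * \<epsilon> powr (2 * log23))) \<in> o[at_right 0](\<lambda>\<epsilon>. \<epsilon> powr (2 * log23))"
    by (rule landau_o.small.in_cong[THEN iffD1, rotated])
qed

lemma root_branch_Im_expansion:
  "(\<lambda>\<epsilon>. Im (root_branch k \<epsilon>) -
            (1 / ln 2 * of_int (2 * k + 1) * pi
             + 8 / (3 * ln 2) * (pi\<^sup>2 / 8) powr (ln 3 / ln 2)
                 * sin (ln 3 / ln 2 * of_int (2 * k + 1) * pi)
                 * \<epsilon> powr (2 * (ln 3 / ln 2))))
         \<in> o[at_right 0](\<lambda>\<epsilon>. \<epsilon> powr (2 * (ln 3 / ln 2)))"
  unfolding log23_def[symmetric]
proof -
  have "(\<lambda>\<epsilon>. 1 / ln 2 * (Im (Lfun (shift \<epsilon>) (wfix (shift \<epsilon>) k)) - 8 / 3 * (pi\<^sup>2 / 8) powr log23 * sin (log23 * of_int (2 * k + 1) * pi) * \<epsilon> powr (2 * log23))) \<in> o[at_right 0](\<lambda>\<epsilon>. \<epsilon> powr (2 * log23))"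
    by (rule landau_o.small.cmult_in_iff[THEN iffD2, OF _ L_smallo(2)]) simp
  moreover have "\<forall>\<^sub>F \<epsilon> in at_right 0. 1 / ln 2 * (Im (Lfun (shift \<epsilon>) (wfix (shift \<epsilon>) k)) - 8 / 3 * (pi\<^sup>2 / 8) powr log23 * sin (log23 * of_int (2 * k + 1) * pi) * \<epsilon> powr (2 * log23)) =
     Im (root_branch k \<epsilon>) -
            (1 / ln 2 * of_int (2 * k + 1) * pi
             + 8 / (3 * ln 2) * (pi\<^sup>2 / 8) powr log23
                 * sin (log23 * of_int (2 * k + 1) * pi)
                 * \<epsilon> powr (2 * log23))"
    using eventually_shift_admissible
  proof eventually_elim
    case (elim \<epsilon>)
    have gen: "1 / l * (L - 8 / 3 * K * C * E) = (n * p + L) / l - (1 / l * n * p + 8 / (3 * l) * K * C * E)"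
      if "l > 0" for l n p L K C E :: real
      using that by (simp add: field_simps)
    show ?case unfolding Re_Im_root_branch(2)[OF elim] by (rule gen) simp
  qed
  ultimately show "(\<lambda>\<epsilon>. Im (root_branch k \<epsilon>) -
            (1 / ln 2 * of_int (2 * k + 1) * pi
             + 8 / (3 * ln 2) * (pi\<^sup>2 / 8) powr log23
                 * sin (log23 * of_int (2 * k + 1) * pi)
                 * \<epsilon> powr (2 * log23))) \<in> o[at_right 0](\<lambda>\<epsilon>. \<epsilon> powr (2 * log23))"
    by (rule landau_o.small.in_cong[THEN iffD1, rotated])
qed

lemma root_branch_Im_smallo:
  "(\<lambda>\<epsilon>. Im (root_branch k \<epsilon>) - of_int (2 * k + 1) * pi / ln 2) \<in> o[at_right 0](\<lambda>\<epsilon>. \<epsilon>)"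
proof -
  define C where "C = 8 / (3 * ln 2) * (pi\<^sup>2 / 8) powr log23 * sin (log23 * of_int (2 * k + 1) * pi)"
  have o: "(\<lambda>\<epsilon>::real. \<epsilon> powr (2 * log23)) \<in> o[at_right 0](\<lambda>\<epsilon>. \<epsilon>)"
  proof (rule smalloI_tendsto)
    have "((\<lambda>\<epsilon>::real. \<epsilon> powr (2 * log23 - 1)) \<longlongrightarrow> 0) (at_right 0)"
      using log23_bounds by (intro tendsto_powr_0_at_right) simp
    moreover have "\<forall>\<^sub>F \<epsilon>::real in at_right 0. \<epsilon> powr (2 * log23 - 1) = \<epsilon> powr (2 * log23) / \<epsilon>"
      using eventually_at_right_pos by eventually_elim (simp add: powr_diff)
    ultimately show "((\<lambda>\<epsilon>::real. \<epsilon> powr (2 * log23) / \<epsilon>) \<longlongrightarrow> 0) (at_right 0)" by (simp add: filterlim_cong)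
    show "\<forall>\<^sub>F \<epsilon>::real in at_right 0. \<epsilon> \<noteq> 0" using eventually_at_right_pos by eventually_elim simp
  qed
  have "(\<lambda>\<epsilon>. Im (root_branch k \<epsilon>) - (1 / ln 2 * of_int (2 * k + 1) * pi + C * \<epsilon> powr (2 * log23))) \<in> o[at_right 0](\<lambda>\<epsilon>. \<epsilon>)"
    using landau_o.small_trans[OF root_branch_Im_expansion[of k, folded log23_def] o] by (simp only: C_def)
  moreover have "(\<lambda>\<epsilon>. C * \<epsilon> powr (2 * log23)) \<in> o[at_right 0](\<lambda>\<epsilon>. \<epsilon>)"
  proof (cases "C = 0")
    case False thus ?thesis using o by simp
  qed simp
  ultimately have "(\<lambda>\<epsilon>. (Im (root_branch k \<epsilon>) - (1 / ln 2 * of_int (2 * k + 1) * pi + C * \<epsilon> powr (2 * log23))) + C * \<epsilon> powr (2 * log23)) \<in> o[at_right 0](\<lambda>\<epsilon>. \<epsilon>)"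
    by (rule sum_in_smallo)
  moreover have "(Im (root_branch k \<epsilon>) - (1 / ln 2 * of_int (2 * k + 1) * pi + C * \<epsilon> powr (2 * log23))) + C * \<epsilon> powr (2 * log23) = Im (root_branch k \<epsilon>) - of_int (2 * k + 1) * pi / ln 2" for \<epsilon>
    by simp
  ultimately show ?thesis by (simp only:)
qed

section \<open>Zeros in horizontal strips\<close>

lemma eventually_at_right_shift: "eventually P (at_right 0) \<Longrightarrow> \<forall>\<^sub>F \<epsilon> in at_right 0. P (shift \<epsilon>)"
  using filterlim_shift by (simp add: filterlim_iff)

lemma eventually_shift_less: "b > 0 \<Longrightarrow> \<forall>\<^sub>F \<epsilon> in at_right 0. 0 < shift \<epsilon> \<and> shift \<epsilon> < b"
  by (rule eventually_at_right_shift) (use eventually_at_right_real[of 0 b] in simp)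

lemma eventually_ln_ratio: "\<forall>\<^sub>F \<epsilon> in at_right 0. ln (ratio (shift \<epsilon>)) \<le> c"
proof (rule eventually_at_right_shift)
  have "(ratio \<longlongrightarrow> 0) (at_right 0)"
    unfolding ratio_def[abs_def] c1_def c2_def by (auto intro!: tendsto_eq_intros)
  hence "\<forall>\<^sub>F \<beta> in at_right 0. ratio \<beta> < exp c" by (rule order_tendstoD) simp
  moreover have "\<forall>\<^sub>F \<beta>::real in at_right 0. 0 < \<beta> \<and> \<beta> < 1 / 4"
    using eventually_at_right_real[of 0 "1/4"] by simp
  ultimately show "\<forall>\<^sub>F \<beta> in at_right 0. ln (ratio \<beta>) \<le> c"
  proof eventually_elim
    case (elim \<beta>)
    have "ln (ratio \<beta>) \<le> ln (exp c)" using elim ratio_pos[of \<beta>] by (intro ln_mono) auto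
    thus ?case by simp
  qed
qed

lemma Re_powr_real: "x > 0 \<Longrightarrow> Re (complex_of_real x powr (- s)) = x powr (- Re s) * cos (Im s * ln x)"
proof -
  assume x: "x > 0"
  have "complex_of_real x powr (- s) = exp (- s * of_real (ln x))" using x by (simp add: powr_def Ln_of_real)
  thus ?thesis using x by (simp add: Re_exp powr_def)
qed

lemma cos_ge_half: "\<bar>x\<bar> \<le> 1 \<Longrightarrow> cos (x::real) \<ge> 1 / 2"
proof -
  assume x: "\<bar>x\<bar> \<le> 1"
  have "cos (pi / 3) \<le> cos \<bar>x\<bar>" using x pi_gt3 by (intro cos_monotone_0_pi_le) auto
  thus ?thesis by (simp add: cos_60)
qed

lemma hseries_tail:
  assumes "a \<ge> 0" "Re s \<ge> 2"
  shows "norm (\<Sum>n. (of_nat (Suc n) + of_real a) powr (- s) :: complex) \<le> 3"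
proof -
  have s: "(\<lambda>n. real (Suc n) powr (-2)) sums (pi\<^sup>2 / 6)"
  proof -
    have "real (Suc n) powr (-2) = 1 / (real (Suc n))\<^sup>2" for n
      using powr_minus[of "real (Suc n)" 2] by (simp add: inverse_eq_divide)
    thus ?thesis using inverse_squares_sums by (simp add: add_ac del: of_nat_Suc)
  qed
  have "norm (\<Sum>n. (of_nat (Suc n) + of_real a) powr (- s) :: complex) \<le> (\<Sum>n. real (Suc n) powr (-2))"
    by (rule norm_suminf_le) (use hterm_le[OF assms] s in \<open>auto simp: sums_iff\<close>)
  also have "\<dots> = pi\<^sup>2 / 6" using s by (simp add: sums_iff)
  also have "\<dots> \<le> 4\<^sup>2 / 6" using pi_less_4 by (intro divide_right_mono power_mono) auto
  finally show ?thesis by simp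
qed

text \<open>The leading terms with bases \<open>1 + \<beta>\<close> and \<open>1 - \<beta>\<close>
  dominate. As \<open>2 * T * \<beta> \<le> 1\<close>, their phases stay within 1 radian, so their
  mean has real part at least 1/4; the other terms contribute at most \<open>6 / 64\<close>, where
  \<open>2 powr (-6) = 1 / 64\<close> and every tail is at most 3. For larger \<open>Im s\<close>
  the phases are no longer controlled, which confines the argument to horizontal strips.\<close>

lemma EZ_right_nonzero:
  assumes \<beta>: "0 \<le> \<beta>" "\<beta> \<le> 1 / 4" "2 * T * \<beta> \<le> 1" and s: "Re s \<ge> 6" "\<bar>Im s\<bar> \<le> T"
  shows "EZ \<beta> s \<noteq> 0"
proof
  assume Z: "EZ \<beta> s = 0"
  define x y where "x = (1 + \<beta>) / 2" and "y = (1 - \<beta>) / 2"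
  have xy: "x > 0" "y > 0" using \<beta> by (auto simp: x_def y_def)
  define t where "t = (\<lambda>a. \<Sum>n. (of_nat (Suc n) + complex_of_real a) powr (- s))"
  have hs: "hseries a s = of_real a powr (- s) + t a" if "a > 0" for a
    unfolding t_def using that s by (intro hseries_split) auto
  have t: "norm (t a) \<le> 3" if "a \<ge> 0" for a unfolding t_def using that s by (intro hseries_tail) auto
  have s1: "s \<noteq> 1" using s by auto
  have two: "norm (2 powr (- s) :: complex) \<le> 1 / 64"
  proof -
    have "norm (2 powr (- s) :: complex) = 2 powr (- Re s)" using norm_nat_powr[of 2 s] by simp
    also have "\<dots> \<le> 2 powr (-6)" using s by (intro powr_mono) auto
    also have "(2::real) powr (-6) = 1 / 64" using powr_minus[of "2::real" 6] by simp
    finally show ?thesis .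
  qed
  have pm: "2 powr (- s) * of_real a powr (- s) = complex_of_real (2 * a) powr (- s)" if "a > 0" for a
    using powr_times_real[of 2 "of_real a" "- s"] that by simp
  have "EZ \<beta> s = (s - 1) * (2 powr (- s) * (hseries 1 s + (hseries x s + hseries y s) / 2))"
    unfolding EZ_def x_def[symmetric] y_def[symmetric] using s xy by (simp add: hurwitz_Z_series algebra_simps)
  hence z: "2 powr (- s) * (hseries 1 s + (hseries x s + hseries y s) / 2) = 0" using Z s1 by simp
  have h1: "hseries 1 s = t 0"
    unfolding t_def hseries_def by (simp add: add_ac)
  have e0: "2 powr (- s) * (hseries 1 s + (hseries x s + hseries y s) / 2) =
     (2 powr (- s) * of_real x powr (- s) + 2 powr (- s) * of_real y powr (- s)) / 2 + 2 powr (- s) * (t 0 + (t x + t y) / 2)"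
    unfolding h1 hs[OF xy(1)] hs[OF xy(2)] by (simp add: algebra_simps add_divide_distrib)
  have xx: "2 * x = 1 + \<beta>" "2 * y = 1 - \<beta>" by (simp_all add: x_def y_def)
  from e0[unfolded z pm[OF xy(1)] pm[OF xy(2)] xx, symmetric]
  have eq: "(complex_of_real (1 + \<beta>) powr (- s) + complex_of_real (1 - \<beta>) powr (- s)) / 2 = - (2 powr (- s) * (t 0 + (t x + t y) / 2))"
    by (simp only: eq_neg_iff_add_eq_0)
  have "norm (t 0 + (t x + t y) / 2) \<le> 3 + (3 + 3) / 2"
  proof (intro order_trans[OF norm_triangle_ineq] add_mono t)
    have "norm (t x + t y) \<le> 3 + 3" using xy by (intro order_trans[OF norm_triangle_ineq] add_mono t) auto
    thus "norm ((t x + t y) / 2) \<le> (3 + 3) / 2" by (simp add: norm_divide)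
  qed simp
  hence "norm (2 powr (- s) * (t 0 + (t x + t y) / 2)) \<le> 1 / 64 * 6"
    unfolding norm_mult using two by (intro mult_mono) auto
  hence up: "Re ((complex_of_real (1 + \<beta>) powr (- s) + complex_of_real (1 - \<beta>) powr (- s)) / 2) \<le> 6 / 64"
    using complex_Re_le_cmod[of "(complex_of_real (1 + \<beta>) powr (- s) + complex_of_real (1 - \<beta>) powr (- s)) / 2"] unfolding eq by simp
  have T: "T \<ge> 0" using s by linarith
  have l1: "\<bar>Im s * ln (1 + \<beta>)\<bar> \<le> 1"
  proof -
    have "\<bar>ln (1 + \<beta>)\<bar> \<le> \<beta>" using \<beta> ln_add_one_self_le_self[of \<beta>] by simp
    hence "\<bar>Im s\<bar> * \<bar>ln (1 + \<beta>)\<bar> \<le> T * \<beta>" using s T by (intro mult_mono) auto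
    also have "\<dots> \<le> 2 * T * \<beta>" using T \<beta> by simp
    finally show ?thesis using \<beta> by (simp add: abs_mult)
  qed
  have l2: "\<bar>Im s * ln (1 - \<beta>)\<bar> \<le> 1"
  proof -
    have "- ln (1 - \<beta>) = ln (1 / (1 - \<beta>))" using \<beta> by (simp add: ln_div)
    also have "\<dots> \<le> 1 / (1 - \<beta>) - 1" using \<beta> by (intro ln_le_minus_one) auto
    also have "\<dots> = \<beta> / (1 - \<beta>)" using \<beta> by (simp add: field_simps)
    also have "\<dots> \<le> \<beta> / (1 / 2)" using \<beta> by (intro divide_left_mono) auto
    also have "\<dots> = 2 * \<beta>" by simp
    finally have "- ln (1 - \<beta>) \<le> 2 * \<beta>" .
    moreover have "ln (1 - \<beta>) \<le> 0" using \<beta> by simp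
    ultimately have "\<bar>ln (1 - \<beta>)\<bar> \<le> 2 * \<beta>" by linarith
    hence "\<bar>Im s\<bar> * \<bar>ln (1 - \<beta>)\<bar> \<le> T * (2 * \<beta>)" using s T by (intro mult_mono) auto
    thus ?thesis using \<beta> by (simp add: abs_mult mult_ac)
  qed
  have "Re (complex_of_real (1 + \<beta>) powr (- s)) \<ge> 0"
    using cos_ge_half[OF l1] \<beta> by (subst Re_powr_real) auto
  moreover have "Re (complex_of_real (1 - \<beta>) powr (- s)) \<ge> 1 / 2"
  proof -
    have "(1 - \<beta>) powr 0 \<le> (1 - \<beta>) powr (- Re s)" using \<beta> s by (intro powr_mono') auto
    hence "1 * (1 / 2) \<le> (1 - \<beta>) powr (- Re s) * cos (Im s * ln (1 - \<beta>))"
      using cos_ge_half[OF l2] \<beta> by (intro mult_mono) auto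
    thus ?thesis using \<beta> by (subst Re_powr_real) auto
  qed
  ultimately show False using up by simp
qed

lemma continuous_on_EZ: "continuous_on ({0..1/2} \<times> UNIV) (\<lambda>(\<beta>,s). EZ \<beta> s)"
proof -
  have c: "continuous_on ({0..1/2} \<times> UNIV) (\<lambda>p. hurwitz_Z (h (fst p)) (snd p))"
    if "continuous_on {0..1/2} h" "\<And>x. x \<in> {0..1/2} \<Longrightarrow> h x > 0" for h :: "real \<Rightarrow> real"
  proof -
    have "continuous_on ({0..1/2} \<times> UNIV) (\<lambda>p. (\<lambda>(a,s). hurwitz_Z a s) (h (fst p), snd p))"
    proof (rule continuous_on_compose2[OF continuous_on_hurwitz_Z])
      show "continuous_on ({0..1/2} \<times> (UNIV :: complex set)) (\<lambda>p. (h (fst p), snd p))"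
        by (intro continuous_on_Pair continuous_on_compose2[OF that(1) continuous_on_fst[OF continuous_on_id]] continuous_on_snd[OF continuous_on_id]) auto
    qed (use that(2) in auto)
    thus ?thesis by simp
  qed
  show ?thesis
    unfolding EZ_def split_beta
    by (intro continuous_on_mult continuous_on_add continuous_on_divide continuous_on_const c
          continuous_on_powr_complex continuous_on_minus continuous_on_snd continuous_on_id continuous_intros) auto
qed

text \<open>On the compact set \<open>EZ 0\<close> stays away from 0 by a positive minimum, and
  uniform continuity in \<open>(\<beta>,s)\<close> keeps \<open>EZ \<beta>\<close> closer to
  \<open>EZ 0\<close> than that minimum.\<close>

lemma EZ_compact_nonzero:
  assumes R: "compact R" "\<And>s. s \<in> R \<Longrightarrow> EZ 0 s \<noteq> 0"
  obtains b where "b > 0" "\<And>\<beta> s. 0 \<le> \<beta> \<Longrightarrow> \<beta> < b \<Longrightarrow> s \<in> R \<Longrightarrow> EZ \<beta> s \<noteq> 0"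
proof (cases "R = {}")
  case False
  have c0: "continuous_on R (EZ 0)" by (intro holomorphic_on_imp_continuous_on holomorphic_EZ) auto
  obtain s0 where s0: "s0 \<in> R" "\<And>s. s \<in> R \<Longrightarrow> norm (EZ 0 s0) \<le> norm (EZ 0 s)"
    using continuous_attains_inf[OF R(1) False continuous_on_norm[OF c0]] by blast
  define m where "m = norm (EZ 0 s0)"
  have m: "m > 0" using R(2) s0 by (simp add: m_def)
  have "uniformly_continuous_on ({0..1/2} \<times> R) (\<lambda>(\<beta>,s). EZ \<beta> s)"
    by (intro compact_uniformly_continuous compact_Times R compact_Icc continuous_on_subset[OF continuous_on_EZ]) auto
  then obtain d where d: "d > 0" "\<And>x x'. x \<in> {0..1/2} \<times> R \<Longrightarrow> x' \<in> {0..1/2} \<times> R \<Longrightarrow> dist x' x < d \<Longrightarrow> dist ((\<lambda>(\<beta>,s). EZ \<beta> s) x') ((\<lambda>(\<beta>,s). EZ \<beta> s) x) < m"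
    using m unfolding uniformly_continuous_on_def by meson
  show ?thesis
  proof (rule that[of "min d (1/2)"])
    fix \<beta> s assume *: "0 \<le> \<beta>" "\<beta> < min d (1/2)" "s \<in> R"
    have "dist (EZ \<beta> s) (EZ 0 s) < m"
      using d(2)[of "(0, s)" "(\<beta>, s)"] * by (simp add: dist_Pair_Pair)
    moreover have "m \<le> norm (EZ 0 s)" using s0(2)[OF *(3)] by (simp add: m_def)
    ultimately show "EZ \<beta> s \<noteq> 0" by (auto simp: dist_norm)
  qed (use d in auto)
qed (use that[of 1] in auto)

section \<open>The branches of zeros\<close>

text \<open>Up to an error of \<open>1 / (100 * ln 2)\<close> the imaginary parts are odd multiples
  of \<open>pi / ln 2\<close>. They therefore keep away from the real axis, which carries the
  trivial zeros, and from each other. These gaps later trap continuous branches.\<close>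

lemma root_branch_props:
  assumes "admissible (shift \<epsilon>)"
  shows "Re (root_branch k \<epsilon>) \<le> - 14"
    and "4 \<le> \<bar>Im (root_branch k \<epsilon>)\<bar>"
    and "j \<noteq> k \<Longrightarrow> 1 \<le> \<bar>Im (root_branch j \<epsilon>) - Im (root_branch k \<epsilon>)\<bar>"
    and "Fser (shift \<epsilon>) (1 - root_branch k \<epsilon>) = 0"
    and "root_branch k \<epsilon> \<notin> zeta_zeros"
proof -
  show R: "Re (root_branch k \<epsilon>) \<le> - 14" using wfix(1)[OF assms, of k] by (simp add: root_branch_def)
  define d where "d = (\<lambda>k. Im (Lfun (shift \<epsilon>) (wfix (shift \<epsilon>) k)))"
  have d: "\<bar>d k\<bar> \<le> 1 / 100" for k
    using Lfun_small(2)[OF assms wfix(1)[OF assms, of k]] abs_Im_le_cmod[of "Lfun (shift \<epsilon>) (wfix (shift \<epsilon>) k)"]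
    unfolding d_def by linarith
  have I: "Im (root_branch k \<epsilon>) * ln 2 = of_int (2 * k + 1) * pi + d k" for k
    using Re_Im_root_branch(2)[OF assms, of k] by (simp add: d_def)
  have l: "0 < ln (2::real)" "ln (2::real) \<le> 7 / 10" using ln2_bounds by auto
  have odd: "\<bar>of_int (2 * k + 1) :: real\<bar> \<ge> 1" 
  proof -
    have "\<bar>2 * k + 1\<bar> \<ge> 1" by presburger
    hence "real_of_int \<bar>2 * k + 1\<bar> \<ge> 1" by linarith
    thus ?thesis by simp
  qed
  have "1 * pi \<le> \<bar>of_int (2 * k + 1)\<bar> * pi" using odd by (intro mult_right_mono) auto
  also have "\<dots> = \<bar>of_int (2 * k + 1) * pi\<bar>" unfolding abs_mult by simp
  finally have "pi - 1 / 100 \<le> \<bar>Im (root_branch k \<epsilon>) * ln 2\<bar>"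
    unfolding I using d[of k] by linarith
  also have "\<dots> \<le> \<bar>Im (root_branch k \<epsilon>)\<bar> * (7 / 10)"
    unfolding abs_mult using l by (intro mult_left_mono) auto
  finally show I4: "4 \<le> \<bar>Im (root_branch k \<epsilon>)\<bar>" using pi_gt3 by simp
  show "1 \<le> \<bar>Im (root_branch j \<epsilon>) - Im (root_branch k \<epsilon>)\<bar>" if "j \<noteq> k"
  proof -
    have "\<bar>j - k\<bar> \<ge> 1" using that by linarith
    hence "real_of_int \<bar>j - k\<bar> \<ge> 1" by linarith
    hence "1 * (2 * pi) \<le> \<bar>of_int (j - k)\<bar> * (2 * pi)" by (intro mult_right_mono) auto
    also have "\<dots> = \<bar>of_int (j - k) * (2 * pi)\<bar>" by (simp add: abs_mult)
    also have "of_int (j - k) * (2 * pi) = (Im (root_branch j \<epsilon>) - Im (root_branch k \<epsilon>)) * ln 2 - (d j - d k)"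
      unfolding left_diff_distrib I by (simp add: algebra_simps)
    finally have "2 * pi - 2 / 100 \<le> \<bar>(Im (root_branch j \<epsilon>) - Im (root_branch k \<epsilon>)) * ln 2\<bar>"
      using d[of j] d[of k] by linarith
    also have "\<dots> \<le> \<bar>Im (root_branch j \<epsilon>) - Im (root_branch k \<epsilon>)\<bar> * (7 / 10)"
      unfolding abs_mult using l by (intro mult_left_mono) auto
    finally have "2 * pi - 2 / 100 \<le> \<bar>Im (root_branch j \<epsilon>) - Im (root_branch k \<epsilon>)\<bar> * (7 / 10)" .
    moreover have "1 \<le> X" if "2 * pi - 2 / 100 \<le> X * (7 / 10)" for X :: real
      using that pi_gt3 by (simp add: field_simps)
    ultimately show ?thesis by blast
  qed
  have "Fser (shift \<epsilon>) (wfix (shift \<epsilon>) k) = 0"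
    using Fser_zeros_wfix[OF assms wfix(1)[OF assms, of k]] by blast
  thus "Fser (shift \<epsilon>) (1 - root_branch k \<epsilon>) = 0" by (simp add: root_branch_def)
  show "root_branch k \<epsilon> \<notin> zeta_zeros"
    using zeta_zeros_left[of "root_branch k \<epsilon>"] sin_zero_real[of "root_branch k \<epsilon>"] R I4 by auto
qed

lemma admissible_epsilon:
  assumes "admissible (shift \<epsilon>)" "0 < \<epsilon>" "\<epsilon> < 1"
  shows "E_zeros (1 - \<epsilon>) = {s. EZ (shift \<epsilon>) s = 0}" "root_branch k \<epsilon> \<in> E_zeros (1 - \<epsilon>)"
proof -
  show *: "E_zeros (1 - \<epsilon>) = {s. EZ (shift \<epsilon>) s = 0}" using assms by (intro E_zeros_eq) auto
  show "root_branch k \<epsilon> \<in> E_zeros (1 - \<epsilon>)"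
    unfolding * using EZ_left_zero_iff[of "shift \<epsilon>" "root_branch k \<epsilon>"] root_branch_props(1,4)[OF assms(1), of k] adm_bounds[OF assms(1)] by simp
qed

text \<open>In terms of \<open>w = 1 - s\<close> the range \<open>1 + a \<le> Re w \<le> 15\<close>
  is free of zeros for small \<open>\<beta>\<close>, and for \<open>Re w \<ge> 15\<close> every zero
  is a fixed point. All bounds are independent of \<open>k\<close>, so a single threshold for
  \<open>\<epsilon>\<close> serves the infinite family.\<close>

lemma eventually_left_zeros:
  assumes "a > 0"
  shows "\<forall>\<^sub>F \<epsilon> in at_right 0. {s \<in> E_zeros (1 - \<epsilon>). Re s \<le> - a} - zeta_zeros = range (\<lambda>k. root_branch k \<epsilon>)"
proof -
  obtain b where b: "b > 0" "b \<le> 1" "\<And>\<beta> w. 0 \<le> \<beta> \<Longrightarrow> \<beta> < b \<Longrightarrow> 1 + a \<le> Re w \<Longrightarrow> Re w \<le> 15 \<Longrightarrow> Fser \<beta> w \<noteq> 0"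
    using Fser_nonzero_middle[OF assms, of 15] by blast
  have "\<forall>\<^sub>F \<epsilon>::real in at_right 0. 0 < \<epsilon> \<and> \<epsilon> < 1" using eventually_at_right_real[of 0 1] by simp
  thus ?thesis
    \<comment> \<open>The value \<open>- (2 + a)\<close> moves all branches to
      \<open>Re s \<le> - a\<close> simultaneously, because \<open>Lfun\<close> is at most 1/100 for
      every \<open>k\<close> and \<open>ln 2 < 1\<close>.\<close>
    using eventually_shift_admissible eventually_shift_less[OF b(1)] eventually_ln_ratio[of "- (2 + a)"]
  proof eventually_elim
    case (elim \<epsilon>)
    note adm = elim(2) and Ez = admissible_epsilon(1)[OF elim(2)]
    have b01: "0 \<le> shift \<epsilon>" "shift \<epsilon> < 1" using elim b by auto
    show ?case
    proof (intro equalityI subsetI)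
      fix s assume "s \<in> {s \<in> E_zeros (1 - \<epsilon>). Re s \<le> - a} - zeta_zeros"
      hence s: "EZ (shift \<epsilon>) s = 0" "Re s \<le> - a" "s \<notin> zeta_zeros" using Ez elim by auto
      hence "Fser (shift \<epsilon>) (1 - s) = 0"
        using EZ_left_zero_iff[OF b01, of s] zeta_zeros_left[of s] assms by auto
      moreover from this have "Re (1 - s) \<ge> 15" using b(3)[of "shift \<epsilon>" "1 - s"] elim b01 s by force
      ultimately obtain k where "1 - s = wfix (shift \<epsilon>) k" using Fser_zeros_wfix[OF adm] by blast
      hence "s = root_branch k \<epsilon>" by (simp add: root_branch_def algebra_simps)
      thus "s \<in> range (\<lambda>k. root_branch k \<epsilon>)" by blast
    next
      fix s assume "s \<in> range (\<lambda>k. root_branch k \<epsilon>)"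
      then obtain k where s: "s = root_branch k \<epsilon>" by blast
      define l where "l = Re (Lfun (shift \<epsilon>) (wfix (shift \<epsilon>) k))"
      have "l \<le> 1 / 100" using Lfun_small(2)[OF adm wfix(1)[OF adm, of k]] complex_Re_le_cmod[of "Lfun (shift \<epsilon>) (wfix (shift \<epsilon>) k)"]
        unfolding l_def by linarith
      moreover have "(1 + a) * ln 2 \<le> (1 + a) * 1" using assms ln2_bounds by (intro mult_left_mono) auto
      ultimately have "ln (ratio (shift \<epsilon>)) + l \<le> (- a - 1) * ln 2" using elim(4) by (simp add: algebra_simps)
      hence "(ln (ratio (shift \<epsilon>)) + l) / ln 2 \<le> - a - 1" by (subst pos_divide_le_eq) auto
      hence "Re s \<le> - a" unfolding s Re_Im_root_branch(1)[OF adm] l_def[symmetric] by linarith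
      thus "s \<in> {s \<in> E_zeros (1 - \<epsilon>). Re s \<le> - a} - zeta_zeros"
        using root_branch_props(5)[OF adm] admissible_epsilon(2)[OF adm] elim s by auto
    qed
  qed
qed

lemma root_branch_at_bot: "filterlim (\<lambda>\<epsilon>. Re (root_branch k \<epsilon>)) at_bot (at_right 0)"
  unfolding filterlim_at_bot
proof
  fix Z :: real
  have "\<forall>\<^sub>F \<epsilon> in at_right 0. {s \<in> E_zeros (1 - \<epsilon>). Re s \<le> - max 1 (- Z)} - zeta_zeros = range (\<lambda>k. root_branch k \<epsilon>)"
    by (rule eventually_left_zeros) simp
  thus "\<forall>\<^sub>F \<epsilon> in at_right 0. Re (root_branch k \<epsilon>) \<le> Z"
  proof eventually_elim
    case (elim \<epsilon>)
    have "root_branch k \<epsilon> \<in> {s \<in> E_zeros (1 - \<epsilon>). Re s \<le> - max 1 (- Z)} - zeta_zeros"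
      unfolding elim by blast
    hence "Re (root_branch k \<epsilon>) \<le> - max 1 (- Z)" by blast
    thus ?case by linarith
  qed
qed

lemma closed_zeta_zeros: "closed zeta_zeros"
proof -
  have "continuous_on UNIV (hurwitz_Z 1)" by (intro holomorphic_on_imp_continuous_on holomorphic_hurwitz_Z) simp
  hence "closed {s. hurwitz_Z 1 s = 0}" by (intro closed_Collect_eq continuous_on_const)
  thus ?thesis by (simp add: zeta_zeros_eq)
qed

lemma zeta_zeros_isolated:
  assumes "z \<in> zeta_zeros"
  obtains r where "r > 0" "r \<le> 1" "\<And>x. dist x z < r \<Longrightarrow> x \<in> zeta_zeros \<Longrightarrow> x = z"
proof -
  obtain r where r: "0 < r" "ball z r \<subseteq> UNIV" "\<And>x. x \<in> ball z r - {z} \<Longrightarrow> hurwitz_Z 1 x \<noteq> 0"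
    using isolated_zeros[of "hurwitz_Z 1" UNIV z 1] assms hurwitz_Z_1[of 1] holomorphic_hurwitz_Z[of 1]
    by (auto simp: zeta_zeros_eq)
  show ?thesis
    by (rule that[of "min r 1"]) (use r in \<open>auto simp: zeta_zeros_eq dist_commute\<close>)
qed

text \<open>Three ranges of \<open>Re s\<close>: left of -1 the zeros are already known, right of 6
  there are none, and in between the rectangle without the discs about zeta zeros is compact, so
  \<open>EZ \<beta>\<close> inherits the nonvanishing of \<open>EZ 0\<close>.\<close>

lemma eventually_strip_zeros:
  assumes "T > 0" "\<eta> > 0"
  shows "\<forall>\<^sub>F \<epsilon> in at_right 0. \<forall>s\<in>E_zeros (1 - \<epsilon>). \<bar>Im s\<bar> \<le> T \<longrightarrow>
           (\<exists>k. s = root_branch k \<epsilon>) \<or> (\<exists>z\<in>zeta_zeros. dist s z < \<eta>)"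
proof -
  define R where "R = {s. -1 \<le> Re s \<and> Re s \<le> 6 \<and> \<bar>Im s\<bar> \<le> T} - (\<Union>z\<in>zeta_zeros. ball z \<eta>)"
  have "compact {s. -1 \<le> Re s \<and> Re s \<le> 6 \<and> \<bar>Im s\<bar> \<le> T}"
  proof -
    have "{s. -1 \<le> Re s \<and> Re s \<le> 6 \<and> \<bar>Im s\<bar> \<le> T} = cbox (Complex (-1) (-T)) (Complex 6 T)"
      by (auto simp: in_cbox_complex_iff abs_le_iff)
    thus ?thesis by simp
  qed
  hence "compact R" unfolding R_def by (intro compact_diff open_UN) auto
  moreover have "EZ 0 s \<noteq> 0" if "s \<in> R" for s
    using that assms by (auto simp: R_def EZ_0 zeta_zeros_eq)
  ultimately obtain b where b: "b > 0" "\<And>\<beta> s. 0 \<le> \<beta> \<Longrightarrow> \<beta> < b \<Longrightarrow> s \<in> R \<Longrightarrow> EZ \<beta> s \<noteq> 0"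
    using EZ_compact_nonzero by blast
  define b' where "b' = min (min b (1 / 4)) (1 / (2 * T))"
  have b': "b' > 0" using b assms by (simp add: b'_def)
  have "\<forall>\<^sub>F \<epsilon>::real in at_right 0. 0 < \<epsilon> \<and> \<epsilon> < 1" using eventually_at_right_real[of 0 1] by simp
  thus ?thesis using eventually_shift_less[OF b'] eventually_left_zeros[OF zero_less_one]
  proof eventually_elim
    case (elim \<epsilon>)
    have Ez: "E_zeros (1 - \<epsilon>) = {s. EZ (shift \<epsilon>) s = 0}" using elim by (intro E_zeros_eq) auto
    have sh: "0 \<le> shift \<epsilon>" "shift \<epsilon> < b" "shift \<epsilon> \<le> 1 / 4" "2 * T * shift \<epsilon> \<le> 1"
      using elim(2) assms by (auto simp: b'_def field_simps)
    show ?case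
    proof (intro ballI impI)
      fix s assume s: "s \<in> E_zeros (1 - \<epsilon>)" "\<bar>Im s\<bar> \<le> T"
      hence z: "EZ (shift \<epsilon>) s = 0" using Ez by simp
      consider "Re s \<le> -1" | "Re s \<ge> 6" | "-1 \<le> Re s" "Re s \<le> 6" by linarith
      thus "(\<exists>k. s = root_branch k \<epsilon>) \<or> (\<exists>z\<in>zeta_zeros. dist s z < \<eta>)"
      proof cases
        case 1
        show ?thesis
        proof (cases "s \<in> zeta_zeros")
          case True thus ?thesis using assms by (intro disjI2 bexI[of _ s]) auto
        next
          case False
          hence "s \<in> range (\<lambda>k. root_branch k \<epsilon>)" using elim(3) s(1) 1 by blast
          thus ?thesis by blast
        qed
      next
        case 2
        thus ?thesis using EZ_right_nonzero[OF sh(1,3,4)] s z by blast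
      next
        case 3
        hence "s \<notin> R" using b(2)[OF sh(1,2)] z by blast
        thus ?thesis using 3 s by (auto simp: R_def dist_commute)
      qed
    qed
  qed
qed

section \<open>Following a continuous branch of zeros\<close>

lemma connected_barrier:
  fixes h :: "'a::topological_space \<Rightarrow> real"
  assumes "connected I" "continuous_on I h" "x \<in> I" "h x < c" "\<And>y. y \<in> I \<Longrightarrow> h y \<noteq> c" "y \<in> I"
  shows "h y < c"
proof (rule ccontr)
  assume "\<not> h y < c"
  hence "c \<in> {h x..h y}" using assms(4) by simp
  moreover have "connected (h ` I)" by (rule connected_continuous_image[OF assms(2,1)])
  ultimately have "c \<in> h ` I"
    using connected_contains_Icc[of "h ` I" "h x" "h y"] assms(3,6) by blast
  thus False using assms(5) by blast
qed

text \<open>Bolzano-Weierstrass for a filter: if each point of \<open>K\<close> had a ball that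
  \<open>f\<close> eventually avoids, finitely many of these balls would cover \<open>K\<close>, and
  \<open>f\<close> would eventually avoid \<open>K\<close>.\<close>

lemma frequently_compact_accumulation:
  fixes f :: "'a \<Rightarrow> 'b::metric_space"
  assumes "compact K" "\<exists>\<^sub>F x in F. f x \<in> K"
  obtains p where "p \<in> K" "\<And>r. r > 0 \<Longrightarrow> \<exists>\<^sub>F x in F. dist (f x) p < r"
proof (rule ccontr)
  assume "\<not> thesis"
  hence "\<forall>p\<in>K. \<exists>r>0. \<forall>\<^sub>F x in F. \<not> dist (f x) p < r"
    using that unfolding frequently_def by blast
  then obtain r where r: "\<And>p. p \<in> K \<Longrightarrow> r p > 0" "\<And>p. p \<in> K \<Longrightarrow> \<forall>\<^sub>F x in F. \<not> dist (f x) p < r p"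
    by metis
  have "K \<subseteq> (\<Union>p\<in>K. ball p (r p))" using r(1) by force
  then obtain C where C: "C \<subseteq> K" "finite C" "K \<subseteq> (\<Union>p\<in>C. ball p (r p))"
    using compactE_image[OF assms(1), of K "\<lambda>p. ball p (r p)"] by auto
  have "\<forall>\<^sub>F x in F. \<forall>p\<in>C. \<not> dist (f x) p < r p"
    using C r(2) by (intro eventually_ball_finite) auto
  hence "\<forall>\<^sub>F x in F. f x \<notin> K"
    by eventually_elim (use C(3) in \<open>auto simp: dist_commute\<close>)
  thus False using assms(2) unfolding frequently_def by blast
qed

lemma left_half_plane_threshold:
  obtains \<epsilon>1 where "0 < \<epsilon>1" "\<epsilon>1 \<le> 1" "\<And>\<epsilon>. 0 < \<epsilon> \<Longrightarrow> \<epsilon> < \<epsilon>1 \<Longrightarrow> admissible (shift \<epsilon>)"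
    "\<And>\<epsilon>. 0 < \<epsilon> \<Longrightarrow> \<epsilon> < \<epsilon>1 \<Longrightarrow> {s \<in> E_zeros (1 - \<epsilon>). Re s \<le> - (1 / 2)} - zeta_zeros = range (\<lambda>k. root_branch k \<epsilon>)"
proof -
  have "\<forall>\<^sub>F \<epsilon> in at_right 0. admissible (shift \<epsilon>) \<and> {s \<in> E_zeros (1 - \<epsilon>). Re s \<le> - (1 / 2)} - zeta_zeros = range (\<lambda>k. root_branch k \<epsilon>)"
    using eventually_shift_admissible eventually_left_zeros[of "1 / 2"] by (simp add: eventually_conj)
  then obtain b where "b > 0" "\<And>\<epsilon>. 0 < \<epsilon> \<Longrightarrow> \<epsilon> < b \<Longrightarrow> admissible (shift \<epsilon>) \<and> {s \<in> E_zeros (1 - \<epsilon>). Re s \<le> - (1 / 2)} - zeta_zeros = range (\<lambda>k. root_branch k \<epsilon>)"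
    unfolding eventually_at_right_field by blast
  thus ?thesis using that[of "min b 1"] by auto
qed

lemma continuous_on_root_branch:
  assumes "\<And>\<epsilon>. 0 < \<epsilon> \<Longrightarrow> \<epsilon> < \<epsilon>0 \<Longrightarrow> admissible (shift \<epsilon>)" "\<epsilon>0 \<le> 1"
  shows "continuous_on {0<..<\<epsilon>0} (root_branch k)"
proof -
  have "continuous_on {0<..<\<epsilon>0} shift"
    unfolding shift_def[abs_def] by (intro continuous_intros) (use assms(2) in auto)
  hence "continuous_on {0<..<\<epsilon>0} (\<lambda>\<epsilon>. wfix (shift \<epsilon>) k)"
    by (rule continuous_on_compose2[where g = "\<lambda>\<beta>. wfix \<beta> k" and t = "Collect admissible", OF continuous_on_wfix, rotated]) (use assms(1) in auto)
  thus ?thesis unfolding root_branch_def[abs_def] by (intro continuous_on_diff continuous_on_const)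
qed

lemma root_branch_not_tends_to_zeta_zero:
  assumes "\<forall>\<^sub>F \<epsilon> in at_right 0. s \<epsilon> = root_branch k \<epsilon>"
  shows "\<not> tends_to_zeta_zero s"
proof
  assume "tends_to_zeta_zero s"
  then obtain z where "(s \<longlongrightarrow> z) (at_right 0)" by (auto simp: tends_to_zeta_zero_def)
  hence "((\<lambda>\<epsilon>. Re (s \<epsilon>)) \<longlongrightarrow> Re z) (at_right 0)" by (rule tendsto_Re)
  hence "\<forall>\<^sub>F \<epsilon> in at_right 0. Re z - 1 < Re (s \<epsilon>)" by (rule order_tendstoD) simp
  moreover have "\<forall>\<^sub>F \<epsilon> in at_right 0. Re (root_branch k \<epsilon>) \<le> Re z - 1"
    using root_branch_at_bot[of k] unfolding filterlim_at_bot by blast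
  ultimately have "\<forall>\<^sub>F \<epsilon>::real in at_right 0. False"
    using assms by eventually_elim simp
  thus False by simp
qed

text \<open>Zeros are discrete, so a continuous branch cannot leave the one it follows. A branch
  that ever meets some \<open>root_branch k\<close> stays on it; one that reaches
  \<open>Re s \<le> -1\<close> without doing so sits still on a trivial zero; any other is
  frequently in a compact rectangle, accumulates at a zero of zeta and must converge to it. The last
  two outcomes contradict \<open>nt\<close>.\<close>

lemma zero_branch_cases:
  assumes zb: "zero_branch s" and Im: "\<not> filterlim (\<lambda>\<epsilon>. \<bar>Im (s \<epsilon>)\<bar>) at_top (at_right 0)"
    and nt: "\<not> tends_to_zeta_zero s"
  shows "\<exists>k. \<forall>\<^sub>F \<epsilon> in at_right 0. s \<epsilon> = root_branch k \<epsilon>"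
proof -
  obtain \<delta> where \<delta>: "\<delta> > 0" "continuous_on {0<..<\<delta>} s" "\<And>\<epsilon>. \<epsilon> \<in> {0<..<\<delta>} \<Longrightarrow> s \<epsilon> \<in> E_zeros (1 - \<epsilon>)"
    using zb by (auto simp: zero_branch_def)
  obtain \<epsilon>1 where \<epsilon>1: "0 < \<epsilon>1" "\<epsilon>1 \<le> 1" "\<And>\<epsilon>. 0 < \<epsilon> \<Longrightarrow> \<epsilon> < \<epsilon>1 \<Longrightarrow> admissible (shift \<epsilon>)"
    "\<And>\<epsilon>. 0 < \<epsilon> \<Longrightarrow> \<epsilon> < \<epsilon>1 \<Longrightarrow> {s \<in> E_zeros (1 - \<epsilon>). Re s \<le> - (1 / 2)} - zeta_zeros = range (\<lambda>k. root_branch k \<epsilon>)"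
    using left_half_plane_threshold by blast
  define d where "d = min \<delta> \<epsilon>1"
  define I where "I = {0<..<d}"
  have d: "d > 0" using \<delta> \<epsilon>1 by (simp add: d_def)
  have conI: "connected I" by (simp add: I_def)
  have contI: "continuous_on I s" by (rule continuous_on_subset[OF \<delta>(2)]) (auto simp: I_def d_def)
  have zI: "s \<epsilon> \<in> E_zeros (1 - \<epsilon>)" "admissible (shift \<epsilon>)" if "\<epsilon> \<in> I" for \<epsilon>
    using \<delta>(3) \<epsilon>1(3) that by (auto simp: I_def d_def)
  have leftI: "s \<epsilon> \<in> zeta_zeros \<or> (\<exists>k. s \<epsilon> = root_branch k \<epsilon>)" if "\<epsilon> \<in> I" "Re (s \<epsilon>) \<le> - (1 / 2)" for \<epsilon>
  proof -
    have "{s \<in> E_zeros (1 - \<epsilon>). Re s \<le> - (1 / 2)} - zeta_zeros = range (\<lambda>k. root_branch k \<epsilon>)"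
      using \<epsilon>1(4) that(1) by (auto simp: I_def d_def)
    thus ?thesis using zI(1)[OF that(1)] that(2) by blast
  qed
  have evI: "\<forall>\<^sub>F \<epsilon> in at_right 0. \<epsilon> \<in> I" unfolding I_def by (rule eventually_at_right_real[OF d])
  have Im0: "Im z = 0" if "z \<in> zeta_zeros" "Re z < 0" for z
    using that zeta_zeros_left[of z] sin_zero_real[of z] by auto
  show ?thesis
  proof (cases "\<exists>\<epsilon>\<in>I. \<exists>k. s \<epsilon> = root_branch k \<epsilon>")
    case True
    then obtain e k where ek: "e \<in> I" "s e = root_branch k e" by blast
    define h where "h = (\<lambda>\<epsilon>. norm (s \<epsilon> - root_branch k \<epsilon>))"
    have conth: "continuous_on I h"
      unfolding h_def by (intro continuous_on_norm continuous_on_diff contI continuous_on_subset[OF continuous_on_root_branch[OF \<epsilon>1(3,2)]])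
        (auto simp: I_def d_def)
    \<comment> \<open>Within 1/4 of \<open>root_branch k\<close> the branch is left of -1/2 and off
      the real axis, hence some \<open>root_branch j\<close>, and the spacing of imaginary parts
      forces \<open>j = k\<close>. So the distance \<open>h\<close> never takes the value
      1/4.\<close>
    have gap: "s \<epsilon> = root_branch k \<epsilon>" if \<epsilon>: "\<epsilon> \<in> I" "h \<epsilon> \<le> 1 / 4" for \<epsilon>
    proof -
      note adm = zI(2)[OF \<epsilon>(1)]
      have "\<bar>Re (s \<epsilon>) - Re (root_branch k \<epsilon>)\<bar> \<le> 1 / 4" and I4: "\<bar>Im (s \<epsilon>) - Im (root_branch k \<epsilon>)\<bar> \<le> 1 / 4"
        using abs_Re_le_cmod[of "s \<epsilon> - root_branch k \<epsilon>"] abs_Im_le_cmod[of "s \<epsilon> - root_branch k \<epsilon>"] that(2)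
        unfolding h_def by auto
      hence R: "Re (s \<epsilon>) \<le> - (1 / 2)" using root_branch_props(1)[OF adm, of k] by linarith
      have "s \<epsilon> \<notin> zeta_zeros"
        using Im0[of "s \<epsilon>"] R I4 root_branch_props(2)[OF adm, of k] by auto
      then obtain j where j: "s \<epsilon> = root_branch j \<epsilon>" using leftI[OF \<epsilon>(1) R] by blast
      have "j = k"
      proof (rule ccontr)
        assume "j \<noteq> k"
        thus False using root_branch_props(3)[OF adm, of j k] I4 j by simp
      qed
      thus ?thesis using j by simp
    qed
    have "h \<epsilon> < 1 / 4" if "\<epsilon> \<in> I" for \<epsilon>
    proof (rule connected_barrier[OF conI conth ek(1) _ _ that])
      show "h y \<noteq> 1 / 4" if "y \<in> I" for y
      proof
        assume "h y = 1 / 4"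
        moreover from this have "s y = root_branch k y" using gap[OF that] by simp
        ultimately show False by (simp add: h_def)
      qed
    qed (simp add: h_def ek)
    hence "\<forall>\<^sub>F \<epsilon> in at_right 0. s \<epsilon> = root_branch k \<epsilon>"
      using evI by (auto elim!: eventually_mono intro!: gap less_imp_le)
    thus ?thesis by blast
  next
    case notA: False
    show ?thesis
    proof (cases "\<exists>\<epsilon>\<in>I. Re (s \<epsilon>) \<le> - 1")
      case True
      then obtain e where e: "e \<in> I" "Re (s e) \<le> - 1" by blast
      define z where "z = s e"
      have z: "z \<in> zeta_zeros" using leftI[of e] e notA by (auto simp: z_def)
      obtain r where r: "r > 0" "r \<le> 1" "\<And>x. dist x z < r \<Longrightarrow> x \<in> zeta_zeros \<Longrightarrow> x = z"
        using zeta_zeros_isolated[OF z] by blast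
      define h where "h = (\<lambda>\<epsilon>. norm (s \<epsilon> - z))"
      have conth: "continuous_on I h" unfolding h_def by (intro continuous_on_norm continuous_on_diff contI continuous_on_const)
      \<comment> \<open>The room between -1 and -1/2 ensures that \<open>leftI\<close> applies on
        the whole disc of radius \<open>r / 2\<close>, since \<open>r \<le> 1\<close>.\<close>
      have gap: "s \<epsilon> = z" if "\<epsilon> \<in> I" "h \<epsilon> \<le> r / 2" for \<epsilon>
      proof -
        have "\<bar>Re (s \<epsilon>) - Re z\<bar> \<le> 1 / 2"
          using abs_Re_le_cmod[of "s \<epsilon> - z"] that(2) r(2) unfolding h_def by auto
        hence "Re (s \<epsilon>) - Re z \<le> 1 / 2" by linarith
        hence "Re (s \<epsilon>) \<le> - (1 / 2)" using e(2) by (simp add: z_def)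
        hence "s \<epsilon> \<in> zeta_zeros" using leftI[OF that(1)] notA that(1) by blast
        moreover have "dist (s \<epsilon>) z < r" using that(2) r(1) by (simp add: h_def dist_norm)
        ultimately show ?thesis using r(3) by blast
      qed
      have "h \<epsilon> < r / 2" if "\<epsilon> \<in> I" for \<epsilon>
      proof (rule connected_barrier[OF conI conth e(1) _ _ that])
        show "h y \<noteq> r / 2" if "y \<in> I" for y
        proof
          assume "h y = r / 2"
          moreover from this have "s y = z" using gap[OF that] by simp
          ultimately show False using r by (simp add: h_def)
        qed
      qed (use r in \<open>simp add: h_def z_def\<close>)
      hence "\<forall>\<^sub>F \<epsilon> in at_right 0. s \<epsilon> = z"
        using evI by (auto elim!: eventually_mono intro!: gap less_imp_le)
      hence "(s \<longlongrightarrow> z) (at_right 0)" by (rule tendsto_eventually)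
      thus ?thesis using nt z by (auto simp: tends_to_zeta_zero_def)
    next
      case notB: False
      obtain T0 where T0: "\<not> (\<forall>\<^sub>F \<epsilon> in at_right 0. T0 \<le> \<bar>Im (s \<epsilon>)\<bar>)"
        using Im unfolding filterlim_at_top by blast
      define T where "T = max T0 1"
      have T: "T \<ge> 1" by (simp add: T_def)
      have fT: "\<exists>\<^sub>F \<epsilon> in at_right 0. \<bar>Im (s \<epsilon>)\<bar> < T"
        using T0 unfolding frequently_def T_def by (auto elim!: contrapos_nn eventually_mono)
      define K where "K = cbox (Complex (-1) (-T)) (Complex 6 T)"
      define b where "b = min (1 / 4) (1 / (2 * T))"
      have b: "b > 0" using T by (simp add: b_def)
      have "\<forall>\<^sub>F \<epsilon> in at_right 0. \<bar>Im (s \<epsilon>)\<bar> < T \<longrightarrow> s \<epsilon> \<in> K"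
        using evI eventually_shift_less[OF b]
      proof eventually_elim
        case (elim \<epsilon>)
        have \<epsilon>: "0 < \<epsilon>" "\<epsilon> < 1" using elim(1) \<epsilon>1 by (auto simp: I_def d_def)
        have z: "EZ (shift \<epsilon>) (s \<epsilon>) = 0"
          using admissible_epsilon(1)[OF zI(2)[OF elim(1)] \<epsilon>] zI(1)[OF elim(1)] by simp
        have sh: "0 \<le> shift \<epsilon>" "shift \<epsilon> \<le> 1 / 4" "2 * T * shift \<epsilon> \<le> 1"
          using elim(2) T by (auto simp: b_def field_simps)
        show ?case
        proof
          assume *: "\<bar>Im (s \<epsilon>)\<bar> < T"
          have "Re (s \<epsilon>) < 6"
          proof (rule ccontr)
            assume "\<not> Re (s \<epsilon>) < 6"
            thus False using EZ_right_nonzero[OF sh, of "s \<epsilon>"] * z by simp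
          qed
          moreover have "Re (s \<epsilon>) > -1" using notB elim(1) by force
          ultimately show "s \<epsilon> \<in> K" using * by (auto simp: K_def in_cbox_complex_iff)
        qed
      qed
      with fT have fK: "\<exists>\<^sub>F \<epsilon> in at_right 0. s \<epsilon> \<in> K"
        by (rule frequently_rev_mp)
      obtain p where p: "p \<in> K" "\<And>r. r > 0 \<Longrightarrow> \<exists>\<^sub>F \<epsilon> in at_right 0. dist (s \<epsilon>) p < r"
        using frequently_compact_accumulation[OF _ fK] by (auto simp: K_def)
      \<comment> \<open>The strip of half-width \<open>T + 1\<close> contains the unit disc about
        \<open>p\<close>, and the alternative of lying on a root branch is excluded by
        \<open>notA\<close>.\<close>
      have near: "\<forall>\<^sub>F \<epsilon> in at_right 0. dist (s \<epsilon>) p < 1 \<longrightarrow> (\<exists>z\<in>zeta_zeros. dist (s \<epsilon>) z < \<eta>)" if "\<eta> > 0" for \<eta>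
      proof -
        have "T + 1 > 0" using T by simp
        from evI eventually_strip_zeros[OF this that] show ?thesis
        proof eventually_elim
          case (elim \<epsilon>)
          show ?case
          proof
            assume "dist (s \<epsilon>) p < 1"
            hence "\<bar>Im (s \<epsilon>) - Im p\<bar> < 1" using abs_Im_le_cmod[of "s \<epsilon> - p"] by (simp add: dist_norm)
            moreover have "\<bar>Im p\<bar> \<le> T" using p(1) by (auto simp: K_def in_cbox_complex_iff)
            ultimately have "\<bar>Im (s \<epsilon>)\<bar> \<le> T + 1" by linarith
            thus "\<exists>z\<in>zeta_zeros. dist (s \<epsilon>) z < \<eta>" using elim(2) zI(1)[OF elim(1)] notA elim(1) by blast
          qed
        qed
      qed
      have "p \<in> closure zeta_zeros"
        unfolding closure_approachable
      proof (intro allI impI)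
        fix e :: real assume e: "e > 0"
        have "\<exists>\<^sub>F \<epsilon>::real in at_right 0. \<exists>z\<in>zeta_zeros. dist z p < e"
        proof (rule frequently_rev_mp[OF p(2)[of "min 1 (e / 2)"]])
          show "\<forall>\<^sub>F \<epsilon> in at_right 0. dist (s \<epsilon>) p < min 1 (e / 2) \<longrightarrow> (\<exists>z\<in>zeta_zeros. dist z p < e)"
            using near[OF half_gt_zero[OF e]]
          proof (eventually_elim, intro impI)
            fix \<epsilon> assume 1: "dist (s \<epsilon>) p < 1 \<longrightarrow> (\<exists>z\<in>zeta_zeros. dist (s \<epsilon>) z < e / 2)" and 2: "dist (s \<epsilon>) p < min 1 (e / 2)"
            then obtain z where z: "z \<in> zeta_zeros" "dist (s \<epsilon>) z < e / 2" by auto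
            have "dist z p \<le> dist (s \<epsilon>) z + dist (s \<epsilon>) p" by (metis dist_commute dist_triangle)
            thus "\<exists>z\<in>zeta_zeros. dist z p < e" using z 2 by (intro bexI[of _ z]) auto
          qed
        qed (use e in auto)
        thus "\<exists>z\<in>zeta_zeros. dist z p < e" by (auto dest: frequently_ex)
      qed
      hence pz: "p \<in> zeta_zeros" using closed_zeta_zeros by (simp add: closure_closed)
      obtain r0 where r0: "r0 > 0" "r0 \<le> 1" "\<And>x. dist x p < r0 \<Longrightarrow> x \<in> zeta_zeros \<Longrightarrow> x = p"
        using zeta_zeros_isolated[OF pz] by blast
      have "(s \<longlongrightarrow> p) (at_right 0)"
      proof (rule tendstoI)
        fix e :: real assume e: "e > 0"
        \<comment> \<open>The circle of radius \<open>c\<close> about \<open>p\<close> is eventually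
          avoided: a value on it would be within \<open>c / 2\<close> of a zeta zero, which
          isolation identifies as \<open>p\<close>, at distance \<open>c\<close>. As the branch is
          frequently inside the circle, it is eventually confined there.\<close>
        define c where "c = min (r0 / 2) (e / 2)"
        have c: "c > 0" "c \<le> r0 / 2" "c < e" using e r0 by (auto simp: c_def min_def)
        have "\<forall>\<^sub>F \<epsilon> in at_right 0. \<epsilon> \<in> I \<and> dist (s \<epsilon>) p \<noteq> c"
          using evI near[OF half_gt_zero[OF c(1)]]
        proof eventually_elim
          case (elim \<epsilon>)
          have "dist (s \<epsilon>) p \<noteq> c"
          proof
            assume eq: "dist (s \<epsilon>) p = c"
            hence "dist (s \<epsilon>) p < 1" using c r0 by linarith
            then obtain z where z: "z \<in> zeta_zeros" "dist (s \<epsilon>) z < c / 2" using elim by blast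
            have "dist z p \<le> dist (s \<epsilon>) z + dist (s \<epsilon>) p" by (metis dist_commute dist_triangle)
            hence "z = p" using r0(3)[of z] z eq c r0 by linarith
            thus False using z eq c by simp
          qed
          thus ?case using elim by blast
        qed
        then obtain b where b: "b > 0" "\<And>\<epsilon>. 0 < \<epsilon> \<Longrightarrow> \<epsilon> < b \<Longrightarrow> \<epsilon> \<in> I \<and> dist (s \<epsilon>) p \<noteq> c"
          unfolding eventually_at_right_field by blast
        have evb: "\<forall>\<^sub>F \<epsilon> in at_right 0. \<epsilon> \<in> {0<..<b}" by (rule eventually_at_right_real[OF b(1)])
        have "\<exists>\<^sub>F \<epsilon> in at_right 0. \<epsilon> \<in> {0<..<b} \<and> dist (s \<epsilon>) p < c"
          by (rule frequently_rev_mp[OF p(2)[OF c(1)]]) (use evb in \<open>auto elim!: eventually_mono\<close>)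
        then obtain x where x: "x \<in> {0<..<b}" "dist (s x) p < c" by (auto dest: frequently_ex)
        have "dist (s \<epsilon>) p < c" if "\<epsilon> \<in> {0<..<b}" for \<epsilon>
        proof (rule connected_barrier[where I = "{0<..<b}" and h = "\<lambda>\<epsilon>. dist (s \<epsilon>) p", OF _ _ x(1) x(2) _ that])
          show "continuous_on {0<..<b} (\<lambda>\<epsilon>. dist (s \<epsilon>) p)"
            by (intro continuous_on_dist continuous_on_const continuous_on_subset[OF contI]) (use b in auto)
        qed (use b in auto)
        thus "\<forall>\<^sub>F \<epsilon> in at_right 0. dist (s \<epsilon>) p < e"
          using evb c(3) by (auto elim!: eventually_mono intro: less_trans)
      qed
      thus ?thesis using nt pz by (auto simp: tends_to_zeta_zero_def)
    qed
  qed
qed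

lemma bij_betw_odd_lattice: "bij_betw (\<lambda>k::int. of_int (2 * k + 1) * pi / ln 2) UNIV odd_lattice"
  unfolding bij_betw_def odd_lattice_def by (auto simp: inj_on_def)

section \<open>The main theorem\<close>

theorem theorem1:
  shows "\<exists>(\<rho> :: int \<Rightarrow> real \<Rightarrow> complex) \<epsilon>\<^sub>0.
    0 < \<epsilon>\<^sub>0 \<and> \<epsilon>\<^sub>0 \<le> 1 \<and>
    \<comment> \<open>the members of the family are nontrivial off-critical zeros, on a common range of \<open>\<epsilon>\<close>\<close>
    (\<forall>k. continuous_on {0<..<\<epsilon>\<^sub>0} (\<rho> k) \<and>
         (\<forall>\<epsilon>\<in>{0<..<\<epsilon>\<^sub>0}. \<rho> k \<epsilon> \<in> E_zeros (1 - \<epsilon>) - zeta_zeros \<and> off_critical (\<rho> k \<epsilon>))) \<and>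
    \<comment> \<open>they are the zeros other than those tending to zeros of zeta: for branches,
        in left half-planes, and uniformly in horizontal strips\<close>
    (\<forall>s. zero_branch s \<and> \<not> filterlim (\<lambda>\<epsilon>. \<bar>Im (s \<epsilon>)\<bar>) at_top (at_right 0) \<longrightarrow>
         (\<not> tends_to_zeta_zero s \<longleftrightarrow> (\<exists>k. \<forall>\<^sub>F \<epsilon> in at_right 0. s \<epsilon> = \<rho> k \<epsilon>))) \<and>
    (\<forall>a>0. \<forall>\<^sub>F \<epsilon> in at_right 0.
         {s \<in> E_zeros (1 - \<epsilon>). Re s \<le> - a} - zeta_zeros = range (\<lambda>k. \<rho> k \<epsilon>)) \<and>
    (\<forall>T>0. \<forall>\<eta>>0. \<forall>\<^sub>F \<epsilon> in at_right 0.
         \<forall>s\<in>E_zeros (1 - \<epsilon>). \<bar>Im s\<bar> \<le> T \<longrightarrow>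
           (\<exists>k. s = \<rho> k \<epsilon>) \<or> (\<exists>z\<in>zeta_zeros. dist s z < \<eta>)) \<and>
    \<comment> \<open>asymptotic expansions\<close>
    (\<forall>k. (\<lambda>\<epsilon>. Re (\<rho> k \<epsilon>) -
            (2 / ln 2 * ln \<epsilon> + (- 3 + 2 / ln 2 * ln pi)
             + 1 / ln 2 * \<epsilon>
             + 1 / ln 2 * (1 / 4 + 7 * pi\<^sup>2 / 24) * \<epsilon>\<^sup>2
             + 1 / ln 2 * (1 / 12 + 7 * pi\<^sup>2 / 24) * \<epsilon> ^ 3
             + 8 / (3 * ln 2) * (pi\<^sup>2 / 8) powr (ln 3 / ln 2)
                 * cos (ln 3 / ln 2 * of_int (2 * k + 1) * pi)
                 * \<epsilon> powr (2 * (ln 3 / ln 2))))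
         \<in> o[at_right 0](\<lambda>\<epsilon>. \<epsilon> powr (2 * (ln 3 / ln 2)))) \<and>
    (\<forall>k. (\<lambda>\<epsilon>. Im (\<rho> k \<epsilon>) -
            (1 / ln 2 * of_int (2 * k + 1) * pi
             + 8 / (3 * ln 2) * (pi\<^sup>2 / 8) powr (ln 3 / ln 2)
                 * sin (ln 3 / ln 2 * of_int (2 * k + 1) * pi)
                 * \<epsilon> powr (2 * (ln 3 / ln 2))))
         \<in> o[at_right 0](\<lambda>\<epsilon>. \<epsilon> powr (2 * (ln 3 / ln 2)))) \<and>
    \<comment> \<open>the two particular consequences\<close>
    (\<forall>k. filterlim (\<lambda>\<epsilon>. Re (\<rho> k \<epsilon>)) at_bot (at_right 0)) \<and>
    (\<exists>y :: int \<Rightarrow> real. bij_betw y UNIV odd_lattice \<and>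
         (\<forall>k. (\<lambda>\<epsilon>. Im (\<rho> k \<epsilon>) - y k) \<in> o[at_right 0](\<lambda>\<epsilon>. \<epsilon>)))"
proof -
  obtain \<epsilon>1 where \<epsilon>1: "0 < \<epsilon>1" "\<epsilon>1 \<le> 1" "\<And>\<epsilon>. 0 < \<epsilon> \<Longrightarrow> \<epsilon> < \<epsilon>1 \<Longrightarrow> admissible (shift \<epsilon>)"
  proof (rule left_half_plane_threshold)
    fix \<epsilon>1 assume "0 < \<epsilon>1" "\<epsilon>1 \<le> 1" "\<And>\<epsilon>. 0 < \<epsilon> \<Longrightarrow> \<epsilon> < \<epsilon>1 \<Longrightarrow> admissible (shift \<epsilon>)"
    thus thesis by (rule that)
  qed
  have zero: "root_branch k \<epsilon> \<in> E_zeros (1 - \<epsilon>) - zeta_zeros \<and> off_critical (root_branch k \<epsilon>)"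
    if "\<epsilon> \<in> {0<..<\<epsilon>1}" for k \<epsilon>
  proof -
    have adm: "admissible (shift \<epsilon>)" using \<epsilon>1(3) that by simp
    show ?thesis
      using admissible_epsilon(2)[OF adm, of k] root_branch_props(1,5)[OF adm, of k] that \<epsilon>1(2)
      by (simp add: off_critical_def)
  qed
  have cont: "continuous_on {0<..<\<epsilon>1} (root_branch k)" for k
    by (rule continuous_on_root_branch[OF \<epsilon>1(3,2)])
  have branches: "\<not> tends_to_zeta_zero s \<longleftrightarrow> (\<exists>k. \<forall>\<^sub>F \<epsilon> in at_right 0. s \<epsilon> = root_branch k \<epsilon>)"
    if "zero_branch s \<and> \<not> filterlim (\<lambda>\<epsilon>. \<bar>Im (s \<epsilon>)\<bar>) at_top (at_right 0)" for s
    using zero_branch_cases[of s] root_branch_not_tends_to_zeta_zero[of s] that by blast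
  have lattice: "\<exists>y :: int \<Rightarrow> real. bij_betw y UNIV odd_lattice \<and>
         (\<forall>k. (\<lambda>\<epsilon>. Im (root_branch k \<epsilon>) - y k) \<in> o[at_right 0](\<lambda>\<epsilon>. \<epsilon>))"
    by (intro exI[of _ "\<lambda>k. of_int (2 * k + 1) * pi / ln 2"] conjI bij_betw_odd_lattice allI root_branch_Im_smallo)
  have family: "\<forall>k. continuous_on {0<..<\<epsilon>1} (root_branch k) \<and>
       (\<forall>\<epsilon>\<in>{0<..<\<epsilon>1}. root_branch k \<epsilon> \<in> E_zeros (1 - \<epsilon>) - zeta_zeros \<and> off_critical (root_branch k \<epsilon>))"
    using cont zero by blast
  show ?thesis
    apply (rule exI[of _ root_branch], rule exI[of _ \<epsilon>1])
    apply (rule conjI, rule \<epsilon>1(1))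
    apply (rule conjI, rule \<epsilon>1(2))
    apply (rule conjI, rule family)
    apply (rule conjI, rule allI, rule impI, rule branches, assumption)
    apply (rule conjI, rule allI, rule impI, rule eventually_left_zeros, assumption)
    apply (rule conjI, rule allI, rule impI, rule allI, rule impI, rule eventually_strip_zeros, assumption, assumption)
    apply (rule conjI, rule allI, rule root_branch_Re_expansion)
    apply (rule conjI, rule allI, rule root_branch_Im_expansion)
    apply (rule conjI, rule allI, rule root_branch_at_bot)
    apply (rule lattice)
    done
qed

end
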